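(* Let $c,\omega,\delta\in\mathbb R$, $\gamma\in\left(\frac13,\frac12\right)$, $2\omega\notin\pi\mathbb Z$, let $\{q_n\}_{n=1}^\infty\in l^1$ be a real sequence, and let $$b_n=\frac{c\sin(2\omega n+\delta)}{n^\gamma}+q_n,\qquad n\ge1.$$ Let $\mathcal J=\mathcal J(1,b_n)$ be the associated Jacobi operator, $\rho'$ its spectral density, and $F:\overline{\mathbb D}\cap U\to\mathbb C$ the Jost function (defined in the context). Then the spectrum of $\mathcal J$ is purely absolutely continuous on $(-2,2)\setminus\{\pm2\cos\omega,\pm2\cos2\omega\}$, and for almost all $\lambda\in(-2,2)$ the spectral density of $\mathcal J$ equals $$\rho'(\lambda)=\frac{\sqrt{4-\lambda^2}}{2\pi\left|F\left(\frac\lambda2-i\frac{\sqrt{4-\lambda^2}}2\right)\right|^2}.$$ The denominator on the right-hand side does not vanish for $\lambda\in(-2,2)\setminus\{\pm2\cos\omega,\pm2\cos2\omega\}$.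
   Context: $\mathbb D$ is the open unit disc in $\mathbb C$, $\overline{\mathbb D}$ its closure, $\mathbb T$ the unit circle. The square root $\sqrt{4-\lambda^2}$ is positive for $\lambda\in(-2,2)$. $\mathcal J=\mathcal J(1,b_n)$ is the (bounded self-adjoint) operator in $l^2=l^2(\mathbb N)$ given by $(\mathcal Ju)_1=b_1u_1+u_2$ and $(\mathcal Ju)_n=u_{n-1}+b_nu_n+u_{n+1}$ for $n\ge2$. The polynomials of the first kind are $P_1(\lambda)=1$, $P_2(\lambda)=\lambda-b_1$, $P_{n+1}(\lambda)=(\lambda-b_n)P_n(\lambda)-P_{n-1}(\lambda)$ for $n\ge2$. The polynomials of the second kind $Q_n$ satisfy the same recurrence for $n\ge2$ with $Q_1(\lambda)=0$, $Q_2(\lambda)=1$. Spectral density: for $\lambda\in\mathbb C\setminus\mathbb R$ the Weyl function $m(\lambda)$ is the unique number such that $\{Q_n(\lambda)+m(\lambda)P_n(\lambda)\}_{n\ge1}\in l^2$. The spectral measure $d\rho$ of $\mathcal J$ (the spectral measure of the first basis vector $e_1$) satisfies $m(\lambda)=\int_{\mathbb R}\frac{d\rho(x)}{x-\lambda}$ for $\lambda\in\mathbb C\setminus\mathbb R$. The spectral density is $\rho'(\lambda)=\frac1\pi\mathrm{Im}\,m(\lambda+i0)$ for a.a. $\lambda\in\mathbb R$. $U:=\mathbb C\setminus\{0,1,-1,e^{\pm i\omega},-e^{\pm i\omega},e^{\pm2i\omega},-e^{\pm2i\omega}\}$, and for $z\in U$ $$\mu_2(z):=\frac{c^2z^2(1+z^2)e^{2i\omega}}{4(1-z^2)(z^2-e^{2i\omega})(1-z^2e^{2i\omega})}.$$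 Jost function: $F$ is the function on $\overline{\mathbb D}\cap U$ determined by the following asymptotics. For $z\in\mathbb D\setminus\{0\}$, as $n\to\infty$, $$P_n\left(z+\tfrac1z\right)=\frac{zF(z)}{1-z^2}\frac1{z^n}\exp\left(\frac{\mu_2(z)n^{1-2\gamma}}{1-2\gamma}\right)+o\left(\frac1{|z|^n}\exp\left(\frac{\mathrm{Re}\,\mu_2(z)n^{1-2\gamma}}{1-2\gamma}\right)\right).$$ For $z\in\mathbb T\cap U$, as $n\to\infty$, $$P_n\left(z+\tfrac1z\right)=\frac{zF(z)}{1-z^2}\frac1{z^n}\exp\left(\frac{\mu_2(z)n^{1-2\gamma}}{1-2\gamma}\right)+\frac{z\overline{F(z)}}{z^2-1}z^n\exp\left(-\frac{\mu_2(z)n^{1-2\gamma}}{1-2\gamma}\right)+o(1).$$ *)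

theory Defs
  imports "HOL-Analysis.Analysis" "HOL-Library.Landau_Symbols"
begin

section \<open>Jacobi operators with unit off-diagonal entries\<close>

text \<open>
  Sequences are indexed by \<open>n = 1, 2, \<dots>\<close>. They are represented as functions on \<^typ>\<open>nat\<close>;
  an element of \<open>l\<^sup>2\<close> takes the dummy value 0 at index 0, and \<open>b 0\<close> is never used.
\<close>

definition l2 :: "(nat \<Rightarrow> complex) set" where
  "l2 = {u. u 0 = 0 \<and> summable (\<lambda>n. (cmod (u n))\<^sup>2)}"

definition l2_inner :: "(nat \<Rightarrow> complex) \<Rightarrow> (nat \<Rightarrow> complex) \<Rightarrow> complex" where
  "l2_inner u v = (\<Sum>n. u n * cnj (v n))"

definition jacobi :: "(nat \<Rightarrow> real) \<Rightarrow> (nat \<Rightarrow> complex) \<Rightarrow> nat \<Rightarrow> complex" where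
  "jacobi b u n =
     (if n = 0 then 0
      else if n = 1 then of_real (b 1) * u 1 + u 2
      else u (n - 1) + of_real (b n) * u n + u (n + 1))"

definition jacobi_resolvent ::
    "(nat \<Rightarrow> real) \<Rightarrow> complex \<Rightarrow> (nat \<Rightarrow> complex) \<Rightarrow> nat \<Rightarrow> complex" where
  "jacobi_resolvent b z u = (THE v. v \<in> l2 \<and> (\<forall>n. jacobi b v n - z * v n = u n))"

text \<open>
  The spectral measure of a vector \<open>u\<close>, i.e. \<open>\<langle>E(\<cdot>)u, u\<rangle>\<close> with \<open>E\<close> the projection-valued
  spectral measure of the operator, given as the unique finite Borel measure whose Stieltjes
  transform is the matrix element \<open>\<langle>(J - z)\<^sup>-\<^sup>1 u, u\<rangle>\<close> of the resolvent.
\<close>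

definition spectral_measure :: "(nat \<Rightarrow> real) \<Rightarrow> (nat \<Rightarrow> complex) \<Rightarrow> real measure" where
  "spectral_measure b u =
     (THE M. sets M = sets borel \<and> finite_measure M \<and>
        (\<forall>z. z \<notin> \<real> \<longrightarrow>
           (\<integral>x. 1 / (complex_of_real x - z) \<partial>M) = l2_inner (jacobi_resolvent b z u) u))"

text \<open>
  The spectrum is purely absolutely continuous on a Borel set \<open>S\<close> iff the range of \<open>E(S)\<close> lies in
  the absolutely continuous subspace, i.e. the spectral measure of every vector is absolutely
  continuous on \<open>S\<close> with respect to Lebesgue measure.
\<close>

definition purely_ac_spectrum_on :: "(nat \<Rightarrow> real) \<Rightarrow> real set \<Rightarrow> bool" where
  "purely_ac_spectrum_on b S \<longleftrightarrow>
     (\<forall>u\<in>l2. absolutely_continuous (restrict_space lborel S)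
                                   (restrict_space (spectral_measure b u) S))"


section \<open>Orthogonal polynomials, Weyl function and spectral density\<close>

fun P_poly :: "(nat \<Rightarrow> real) \<Rightarrow> nat \<Rightarrow> complex \<Rightarrow> complex" where
  "P_poly b 0 z = 0"
| "P_poly b (Suc 0) z = 1"
| "P_poly b (Suc (Suc 0)) z = z - of_real (b 1)"
| "P_poly b (Suc (Suc (Suc n))) z =
     (z - of_real (b (Suc (Suc n)))) * P_poly b (Suc (Suc n)) z - P_poly b (Suc n) z"

fun Q_poly :: "(nat \<Rightarrow> real) \<Rightarrow> nat \<Rightarrow> complex \<Rightarrow> complex" where
  "Q_poly b 0 z = 0"
| "Q_poly b (Suc 0) z = 0"
| "Q_poly b (Suc (Suc 0)) z = 1"
| "Q_poly b (Suc (Suc (Suc n))) z =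
     (z - of_real (b (Suc (Suc n)))) * Q_poly b (Suc (Suc n)) z - Q_poly b (Suc n) z"

definition weyl_m :: "(nat \<Rightarrow> real) \<Rightarrow> complex \<Rightarrow> complex" where
  "weyl_m b z = (THE m. (\<lambda>n. Q_poly b n z + m * P_poly b n z) \<in> l2)"

definition spectral_density :: "(nat \<Rightarrow> real) \<Rightarrow> real \<Rightarrow> real" where
  "spectral_density b x = 1 / pi * Lim (at_right 0) (\<lambda>\<epsilon>. Im (weyl_m b (Complex x \<epsilon>)))"


section \<open>The Jost function\<close>

definition U_set :: "real \<Rightarrow> complex set" where
  "U_set \<omega> = UNIV - {0, 1, -1, cis \<omega>, cis (-\<omega>), - cis \<omega>, - cis (-\<omega>),
      cis (2*\<omega>), cis (-2*\<omega>), - cis (2*\<omega>), - cis (-2*\<omega>)}"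

definition mu2 :: "real \<Rightarrow> real \<Rightarrow> complex \<Rightarrow> complex" where
  "mu2 c \<omega> z = (of_real c)\<^sup>2 * z\<^sup>2 * (1 + z\<^sup>2) * cis (2*\<omega>) /
     (4 * (1 - z\<^sup>2) * (z\<^sup>2 - cis (2*\<omega>)) * (1 - z\<^sup>2 * cis (2*\<omega>)))"

definition growth_exponent :: "real \<Rightarrow> real \<Rightarrow> real \<Rightarrow> complex \<Rightarrow> nat \<Rightarrow> complex" where
  "growth_exponent c \<omega> \<gamma> z n = mu2 c \<omega> z * of_real (real n powr (1 - 2*\<gamma>)) / of_real (1 - 2*\<gamma>)"

text \<open>\<open>w\<close> is a value at \<open>z\<close> compatible with the asymptotics that determine the Jost function.\<close>

definition is_jost_value ::
    "real \<Rightarrow> real \<Rightarrow> real \<Rightarrow> (nat \<Rightarrow> real) \<Rightarrow> complex \<Rightarrow> complex \<Rightarrow> bool" where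
  "is_jost_value c \<omega> \<gamma> b z w \<longleftrightarrow>
     (z \<in> ball 0 1 - {0} \<longrightarrow>
        (\<lambda>n. P_poly b n (z + 1/z)
             - z * w / (1 - z\<^sup>2) * (1 / z^n) * exp (growth_exponent c \<omega> \<gamma> z n))
        \<in> o(\<lambda>n. of_real (1 / cmod z ^ n * exp (Re (growth_exponent c \<omega> \<gamma> z n))))) \<and>
     (z \<in> sphere 0 1 \<inter> U_set \<omega> \<longrightarrow>
        (\<lambda>n. P_poly b n (z + 1/z)
             - (z * w / (1 - z\<^sup>2) * (1 / z^n) * exp (growth_exponent c \<omega> \<gamma> z n)
                + z * cnj w / (z\<^sup>2 - 1) * z^n * exp (- growth_exponent c \<omega> \<gamma> z n)))
        \<in> o(\<lambda>n. 1))"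

text \<open>Meaningful for \<open>z \<in> cball 0 1 \<inter> U_set \<omega>\<close> only.\<close>

definition jost :: "real \<Rightarrow> real \<Rightarrow> real \<Rightarrow> (nat \<Rightarrow> real) \<Rightarrow> complex \<Rightarrow> complex" where
  "jost c \<omega> \<gamma> b z = (THE w. is_jost_value c \<omega> \<gamma> b z w)"

end

(*
On the real axis write lambda = z + 1/z with |z| = 1 and Im z < 0, and put
alpha_n = z^n (P_{n+1} - z P_n). Then alpha_{n+1}/alpha_n is explicit in b_{n+1} and the unimodular
quantity theta_n = conj alpha_n / alpha_n. Expanding log(alpha_{n+1}/alpha_n) to second order and
summing by parts twice, all oscillating terms sum uniformly on compact sets away from the four
critical points; what remains is mu_2 n^(-2 gamma), so alpha_n exp(-growth) converges, locally
uniformly, to a zero-free limit, which is the Jost function F.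

For Im w > 0 the measures Im w / (pi |P_{n+1} + w P_n|^2) dx integrate P_j P_k (j, k <= n) to
delta_jk; hence they converge weakly to the spectral measure rho, whatever w is. Near a point x0
take w = -z(x0): since |P_{n+1} - z P_n| = |alpha_n| -> |F|, the densities are eventually close to
sqrt(4 - x0^2) / (2 pi |F|^2), and this transfers to rho: it has no singular part near x0, and
its Poisson integral, which is Im m, tends to pi times that value. Spectral measures of arbitrary
vectors are absolutely continuous with respect to rho.
*)

theory Submission
  imports Defs "HOL-Probability.Probability" "HOL-Complex_Analysis.Complex_Analysis"
begin

section \<open>Uniformly convergent series and summation by parts\<close>

text \<open>Two obstacles shape the argument. The real solution P_n may vanish, so its ratios cannot
  be expanded; passing to the complex \<open>jost_amp\<close> makes the one-step coefficient purely
  imaginary, and this alone keeps the amplitude nonzero. The increments of the phase theta_n are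
  only of the order of b_n, so a first summation by parts leaves terms of order n^(-2 gamma) that
  need not converge; a second one leaves order n^(-3 gamma), summable because gamma > 1/3.
  Uniformity on compact sets is what allows weak limits to be compared with Lebesgue measure on a
  whole neighbourhood of x0.

  On the spectral side w must be constant, since orthonormality comes from a contour argument in the
  variable of integration, whereas the amplitude at x involves z(x). With w frozen at -z(x0) the
  discrepancy is (z(x) - z(x0)) P_n(x), small near x0 because P_n is locally bounded. That the weak
  limit is the same for every w rests on uniqueness of the measure, that is, on the absence of
  nonzero square summable solutions of the recurrence with v_0 = 0 at nonreal spectral
  parameters.\<close>

definition unif_summable :: "'a set \<Rightarrow> (nat \<Rightarrow> 'a \<Rightarrow> complex) \<Rightarrow> bool" where
  "unif_summable K t \<longleftrightarrow> uniformly_convergent_on K (\<lambda>N x. \<Sum>n<N. t n x)"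

lemma unif_summable_add: "unif_summable K t \<Longrightarrow> unif_summable K t' \<Longrightarrow> unif_summable K (\<lambda>n x. t n x + t' n x)"
  unfolding unif_summable_def by (simp add: sum.distrib uniformly_convergent_add)

lemma unif_summable_diff: "unif_summable K t \<Longrightarrow> unif_summable K t' \<Longrightarrow> unif_summable K (\<lambda>n x. t n x - t' n x)"
  unfolding unif_summable_def by (simp add: sum_subtractf uniformly_convergent_minus)

lemma unif_summable_cong: "(\<And>n x. x \<in> K \<Longrightarrow> t n x = t' n x) \<Longrightarrow> unif_summable K t \<Longrightarrow> unif_summable K t'"
  unfolding unif_summable_def
  by (subst uniformly_convergent_cong[where g = "\<lambda>N x. \<Sum>n<N. t n x" and B = K])
     (auto intro!: always_eventually sum.cong)

lemma unif_summable_cmult: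
  assumes t: "unif_summable K t" and c: "\<And>x. x \<in> K \<Longrightarrow> cmod (c x) \<le> C"
  shows "unif_summable K (\<lambda>n x. c x * t n x)"
proof -
  from t obtain T where T: "uniform_limit K (\<lambda>N x. \<Sum>n<N. t n x) T sequentially"
    unfolding unif_summable_def uniformly_convergent_on_def by blast
  have "uniform_limit K (\<lambda>N x. c x * (\<Sum>n<N. t n x)) (\<lambda>x. c x * T x) sequentially"
  proof (rule uniform_limitI)
    fix e :: real assume e: "e > 0"
    have "\<forall>\<^sub>F N in sequentially. \<forall>x\<in>K. dist (\<Sum>n<N. t n x) (T x) < e / (\<bar>C\<bar> + 1)"
      using e by (intro uniform_limitD[OF T]) simp
    then show "\<forall>\<^sub>F N in sequentially. \<forall>x\<in>K. dist (c x * (\<Sum>n<N. t n x)) (c x * T x) < e"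
    proof eventually_elim
      case (elim N)
      show ?case
      proof
        fix x assume x: "x \<in> K"
        have "dist (c x * (\<Sum>n<N. t n x)) (c x * T x) = cmod (c x) * dist (\<Sum>n<N. t n x) (T x)"
          by (simp add: dist_norm flip: right_diff_distrib norm_mult)
        also have "\<dots> \<le> (\<bar>C\<bar> + 1) * dist (\<Sum>n<N. t n x) (T x)"
          using c[OF x] by (intro mult_right_mono) auto
        also have "\<dots> < (\<bar>C\<bar> + 1) * (e / (\<bar>C\<bar> + 1))"
          using elim x by (intro mult_strict_left_mono) auto
        finally show "dist (c x * (\<Sum>n<N. t n x)) (c x * T x) < e" by simp
      qed
    qed
  qed
  then show ?thesis
    unfolding unif_summable_def uniformly_convergent_on_def by (auto simp: sum_distrib_left)
qed

lemma unif_summable_dominated: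
  assumes "summable M" and "\<forall>\<^sub>F n in sequentially. \<forall>x\<in>K. cmod (t n x) \<le> C * M n"
  shows "unif_summable K t"
  unfolding unif_summable_def
  using assms by (intro Weierstrass_m_test'_ev[where M = "\<lambda>n. C * M n"] summable_mult)

text \<open>Summation by parts: the summand is the difference of the increment of
  \<open>z^(n+1) a_n X_n\<close>, which tends to 0 uniformly, and a term dominated by
  \<open>B (a_n - a_(n+1))\<close>. The increments of \<open>X\<close> stay inside the summand,
  because for first order terms they are too large to be split off. Nothing is divided by
  \<open>z - 1\<close>.\<close>

lemma unif_summable_abel:
  fixes a :: "nat \<Rightarrow> real" and z :: "'a \<Rightarrow> complex" and X :: "nat \<Rightarrow> 'a \<Rightarrow> complex"
  assumes z: "\<And>x. x \<in> K \<Longrightarrow> cmod (z x) = 1"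
    and X: "\<And>n x. x \<in> K \<Longrightarrow> cmod (X n x) \<le> B"
    and a: "decseq a" "a \<longlonglongrightarrow> 0"
  shows "unif_summable K (\<lambda>n x. (z x - 1) * (z x ^ Suc n * (a n * X n x))
            + z x * (z x ^ Suc n * (a n * (X (Suc n) x - X n x))))"
proof -
  have a0: "a n \<ge> 0" for n
    using a by (rule decseq_ge)
  let ?A = "\<lambda>n x. z x * (z x ^ n * a n * X n x)"
  have "uniform_limit K ?A (\<lambda>x. 0) sequentially"
  proof (rule uniform_limit_null_comparison)
    show "\<forall>\<^sub>F N in sequentially. \<forall>x\<in>K. norm (?A N x) \<le> a N * B"
      using a0 X by (auto simp: norm_mult norm_power z intro!: always_eventually mult_left_mono)
    have "(\<lambda>N. a N * B) \<longlonglongrightarrow> 0"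
      using tendsto_mult[OF a(2) tendsto_const[of B]] by simp
    then show "uniform_limit K (\<lambda>N x. a N * B) (\<lambda>x. 0) sequentially"
      unfolding uniform_limit_iff by (auto dest: tendstoD)
  qed
  then have "uniform_limit K (\<lambda>N x. ?A N x - ?A 0 x) (\<lambda>x. 0 - ?A 0 x) sequentially"
    by (rule uniform_limit_minus) (rule uniform_limit_const)
  then have 1: "unif_summable K (\<lambda>n x. ?A (Suc n) x - ?A n x)"
    unfolding unif_summable_def by (subst sum_lessThan_telescope) (rule uniformly_convergentI)
  have 2: "unif_summable K (\<lambda>n x. z x * (z x ^ Suc n * of_real (a (Suc n) - a n) * X (Suc n) x))"
  proof (rule unif_summable_dominated)
    show "summable (\<lambda>n. a n - a (Suc n))"
      using telescope_summable'[OF a(2)] .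
    show "\<forall>\<^sub>F n in sequentially. \<forall>x\<in>K.
      cmod (z x * (z x ^ Suc n * of_real (a (Suc n) - a n) * X (Suc n) x)) \<le> B * (a n - a (Suc n))"
    proof (intro always_eventually allI ballI)
      fix n x assume x: "x \<in> K"
      have "cmod (z x * (z x ^ Suc n * of_real (a (Suc n) - a n) * X (Suc n) x))
          = (a n - a (Suc n)) * cmod (X (Suc n) x)"
        using decseq_SucD[OF a(1), of n] by (simp add: norm_mult norm_power z[OF x] del: of_real_diff)
      also have "\<dots> \<le> (a n - a (Suc n)) * B"
        using decseq_SucD[OF a(1), of n] X[OF x] by (intro mult_left_mono) auto
      finally show "cmod (z x * (z x ^ Suc n * of_real (a (Suc n) - a n) * X (Suc n) x)) \<le> B * (a n - a (Suc n))"
        by (simp add: mult.commute)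
    qed
  qed
  show ?thesis
    by (rule unif_summable_cong[OF _ unif_summable_diff[OF 1 2]]) (simp add: algebra_simps)
qed

text \<open>When the increments of \<open>X\<close> weighted by \<open>a\<close> are summable, they
  can be removed from the Abel sum. Keeping \<open>z - 1\<close> as a factor admits points of
  \<open>K\<close> where \<open>z = 1\<close>, provided that the coefficient supplies this
  factor.\<close>

lemma unif_summable_oscillating:
  fixes a :: "nat \<Rightarrow> real" and z :: "'a \<Rightarrow> complex" and X :: "nat \<Rightarrow> 'a \<Rightarrow> complex"
  assumes z: "\<And>x. x \<in> K \<Longrightarrow> cmod (z x) = 1"
    and X: "\<And>n x. x \<in> K \<Longrightarrow> cmod (X n x) \<le> B"
    and a: "decseq a" "a \<longlonglongrightarrow> 0"
    and dX: "\<And>n x. x \<in> K \<Longrightarrow> a n * cmod (X (Suc n) x - X n x) \<le> C * M n" "summable M"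
  shows "unif_summable K (\<lambda>n x. (z x - 1) * (z x ^ Suc n * (a n * X n x)))"
proof -
  have a0: "a n \<ge> 0" for n
    using a by (rule decseq_ge)
  have "unif_summable K (\<lambda>n x. z x * (z x ^ Suc n * (a n * (X (Suc n) x - X n x))))"
  proof (rule unif_summable_dominated[OF dX(2)], intro always_eventually allI ballI)
    fix n x assume x: "x \<in> K"
    show "cmod (z x * (z x ^ Suc n * (of_real (a n) * (X (Suc n) x - X n x)))) \<le> C * M n"
      using dX(1)[OF x, of n] a0[of n] by (simp add: norm_mult norm_power z[OF x])
  qed
  from unif_summable_diff[OF unif_summable_abel[where X = X, OF z X a] this] show ?thesis
    by (rule unif_summable_cong[rotated]) auto
qed

text \<open>Tail of the logarithmic series from the cubic term on, compared with a geometric series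
  of ratio 1/2. The cube is the order that becomes summable for
  \<open>1/3 < \<gamma>\<close>.\<close>

lemma Ln_approx_quadratic:
  assumes "cmod z \<le> 1/2"
  shows "cmod (Ln (1 + z) - (z - z\<^sup>2 / 2)) \<le> 2 * cmod z ^ 3"
proof -
  have z: "cmod z < 1" using assms by simp
  let ?f = "\<lambda>n. (-1)^Suc n / of_nat n * z ^ n"
  have s: "?f sums ln (1 + z)" using Ln_series[OF z] .
  have s3: "(\<lambda>n. ?f (n + 3)) sums (ln (1 + z) - (z - z\<^sup>2 / 2))"
    using sums_split_initial_segment[OF s, of 3] by (simp add: eval_nat_numeral)
  have b: "norm (?f (n + 3)) \<le> cmod z ^ 3 * (1/2) ^ n" for n
  proof -
    have "norm (?f (n + 3)) = (cmod z ^ 3 * cmod z ^ n) / (3 + real n)"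
    proof -
      have "cmod (of_nat (n + 3) :: complex) = 3 + real n" by (simp only: norm_of_nat)
      then show ?thesis
        unfolding norm_mult norm_divide norm_power power_add by simp
    qed
    also have "\<dots> \<le> (cmod z ^ 3 * cmod z ^ n) / 1"
      by (intro divide_left_mono) auto
    also have "\<dots> \<le> cmod z ^ 3 * (1/2) ^ n"
      using assms by (auto intro!: mult_left_mono power_mono)
    finally show ?thesis .
  qed
  have g: "(\<lambda>n. cmod z ^ 3 * (1/2::real) ^ n) sums (cmod z ^ 3 * 2)"
    using sums_mult[OF geometric_sums[of "1/2::real"], of "cmod z ^ 3"] by simp
  have "norm (suminf (\<lambda>n. ?f (n + 3))) \<le> suminf (\<lambda>n. cmod z ^ 3 * (1/2) ^ n)"
    using b g by (intro norm_suminf_le) (auto simp: sums_iff)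
  then show ?thesis using s3 g by (simp add: sums_iff)
qed

text \<open>\<open>exp\<close> is not uniformly continuous, so a bound is needed; it is assumed for
  the exponentials rather than for \<open>T\<close>. One index with distance below 1 transfers it to
  \<open>exp (L x)\<close>, and the difference factors as
  \<open>exp (L x) * (exp (T n x - L x) - 1)\<close>.\<close>

lemma uniform_limit_exp:
  fixes T :: "nat \<Rightarrow> 'a \<Rightarrow> complex"
  assumes T: "uniform_limit K T L sequentially"
    and b: "\<And>n. \<exists>B. \<forall>x\<in>K. cmod (exp (T n x)) \<le> B"
  shows "uniform_limit K (\<lambda>n x. exp (T n x)) (\<lambda>x. exp (L x)) sequentially"
proof -
  obtain N where N: "\<forall>x\<in>K. dist (T N x) (L x) < 1"
    using uniform_limitD[OF T, of 1] by (auto simp: eventually_sequentially)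
  obtain B where B: "\<forall>x\<in>K. cmod (exp (T N x)) \<le> B" using b by blast
  have LB: "cmod (exp (L x)) \<le> \<bar>B\<bar> * exp 1" if "x \<in> K" for x
  proof -
    have "exp (L x) = exp (T N x) * exp (L x - T N x)" by (simp flip: exp_add)
    moreover have "cmod (exp (L x - T N x)) \<le> exp 1"
      using N that norm_exp[of "L x - T N x"]
      by (smt (verit) dist_norm exp_le_cancel_iff norm_minus_commute)
    moreover have "cmod (exp (T N x)) \<le> \<bar>B\<bar>" using B that by force
    ultimately show ?thesis
      by (simp only: norm_mult) (intro mult_mono, auto)
  qed
  show ?thesis
  proof (rule uniform_limitI)
    fix e :: real assume e: "e > 0"
    define C where "C = \<bar>B\<bar> * exp 1 + 1"
    have C: "C > 0" unfolding C_def by (simp add: add_nonneg_pos)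
    have "continuous (at 0) (exp :: complex \<Rightarrow> complex)" by simp
    then obtain d where d: "d > 0" "\<And>w::complex. cmod w < d \<Longrightarrow> cmod (exp w - 1) < e / C"
      unfolding continuous_at_eps_delta using e C
      by (metis diff_zero dist_norm divide_pos_pos exp_zero)
    from uniform_limitD[OF T d(1)]
    show "\<forall>\<^sub>F n in sequentially. \<forall>x\<in>K. dist (exp (T n x)) (exp (L x)) < e"
    proof eventually_elim
      case (elim n)
      show ?case
      proof
        fix x assume x: "x \<in> K"
        have "exp (T n x) - exp (L x) = exp (L x) * (exp (T n x - L x) - 1)"
          by (simp add: algebra_simps flip: exp_add)
        then have "dist (exp (T n x)) (exp (L x)) = cmod (exp (L x)) * cmod (exp (T n x - L x) - 1)"
          by (simp add: dist_norm norm_mult)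
        also have "\<dots> \<le> C * cmod (exp (T n x - L x) - 1)"
          using LB[OF x] by (intro mult_right_mono) (auto simp: C_def)
        also have "\<dots> < C * (e / C)"
          using elim x C by (intro mult_strict_left_mono d) (auto simp: dist_norm)
        finally show "dist (exp (T n x)) (exp (L x)) < e" using C by simp
      qed
    qed
  qed
qed

section \<open>Modified Pruefer variables for a decaying oscillating perturbation\<close>

definition unif_bounded :: "'a set \<Rightarrow> ('a \<Rightarrow> complex) \<Rightarrow> bool" where
  "unif_bounded K c \<longleftrightarrow> (\<exists>C. \<forall>x\<in>K. cmod (c x) \<le> C)"

named_theorems unif_bounded_intros

lemma unif_bounded_const [unif_bounded_intros]: "unif_bounded K (\<lambda>x. k)"
  unfolding unif_bounded_def by auto

lemma unif_bounded_add [unif_bounded_intros]: "unif_bounded K f \<Longrightarrow> unif_bounded K g \<Longrightarrow> unif_bounded K (\<lambda>x. f x + g x)"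
  unfolding unif_bounded_def by (meson norm_triangle_mono)

lemma unif_bounded_minus [unif_bounded_intros]: "unif_bounded K f \<Longrightarrow> unif_bounded K (\<lambda>x. - f x)"
  unfolding unif_bounded_def by simp

lemma unif_bounded_diff [unif_bounded_intros]: "unif_bounded K f \<Longrightarrow> unif_bounded K g \<Longrightarrow> unif_bounded K (\<lambda>x. f x - g x)"
  using unif_bounded_add[of K f "\<lambda>x. - g x"] unif_bounded_minus[of K g] by simp

lemma unif_bounded_mult [unif_bounded_intros]: "unif_bounded K f \<Longrightarrow> unif_bounded K g \<Longrightarrow> unif_bounded K (\<lambda>x. f x * g x)"
proof -
  assume "unif_bounded K f" "unif_bounded K g"
  then obtain C D where C: "\<forall>x\<in>K. cmod (f x) \<le> C" and D: "\<forall>x\<in>K. cmod (g x) \<le> D"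
    unfolding unif_bounded_def by blast
  have "cmod (f x * g x) \<le> \<bar>C\<bar> * \<bar>D\<bar>" if "x \<in> K" for x
    unfolding norm_mult using C D that by (intro mult_mono) force+
  then show ?thesis unfolding unif_bounded_def by blast
qed

lemma unif_bounded_power [unif_bounded_intros]: "unif_bounded K f \<Longrightarrow> unif_bounded K (\<lambda>x. f x ^ n)"
  by (induction n) (auto intro: unif_bounded_intros)

lemma unif_bounded_inverse:
  assumes "d > 0" "\<And>x. x \<in> K \<Longrightarrow> d \<le> cmod (f x)"
  shows "unif_bounded K (\<lambda>x. inverse (f x))"
  unfolding unif_bounded_def using assms
  by (intro exI[of _ "inverse d"]) (auto simp: norm_inverse intro!: le_imp_inverse_le)

lemma unif_summable_unif_bounded: "unif_summable K t \<Longrightarrow> unif_bounded K c \<Longrightarrow> unif_summable K (\<lambda>n x. c x * t n x)"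
  unfolding unif_bounded_def using unif_summable_cmult by blast

text \<open>Here \<open>e\<close>, \<open>f\<close>, \<open>w\<close>, \<open>v\<close> stand for
  the powers of order m + 1 of \<open>E\<close>, \<open>cnj E\<close>, \<open>u\<close>,
  \<open>cnj u\<close>, and \<open>t\<close> for \<open>\<theta>\<close>. The left side collects
  everything of second order: what the first summation by parts leaves once the increment of
  \<open>\<theta>\<close> is inserted, and the quadratic term of the logarithm. The right side sorts
  it by frequency; only \<open>(g1 + g2 - 1) * (p * p')\<close> does not oscillate, and it becomes
  \<open>mu\<close>.\<close>

lemma wkb_second_order_identity:
  fixes e f w v p p' g1 g2 t :: complex
  assumes "e * f = 1" "w * v = 1"
  shows "- (p * g1 * e + p' * g2 * f) * w * (p * e + p' * f) * (2 * t - v - w * t\<^sup>2)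
           - (p * e + p' * f)\<^sup>2 * (1 - w * t)\<^sup>2 / 2 =
         (g1 + g2 - 1) * (p * p') + (g1 - 1/2) * p\<^sup>2 * e\<^sup>2 + (g2 - 1/2) * p'\<^sup>2 * f\<^sup>2
           + (2 - 2 * g1 - 2 * g2) * (p * p') * (w * t)
           + (1 - 2 * g1) * p\<^sup>2 * (e\<^sup>2 * w * t) + (1 - 2 * g2) * p'\<^sup>2 * (f\<^sup>2 * w * t)
           + (g1 + g2 - 1) * (p * p') * (w\<^sup>2 * t\<^sup>2)
           + (g1 - 1/2) * p\<^sup>2 * (e\<^sup>2 * w\<^sup>2 * t\<^sup>2) + (g2 - 1/2) * p'\<^sup>2 * (f\<^sup>2 * w\<^sup>2 * t\<^sup>2)"
proof -
  \<comment> \<open>Doubled to clear the halves, so that \<open>algebra\<close> works with integer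
    coefficients.\<close>
  have "2 * (- (p * g1 * e + p' * g2 * f) * w * (p * e + p' * f) * (2 * t - v - w * t\<^sup>2))
           - (p * e + p' * f)\<^sup>2 * (1 - w * t)\<^sup>2 =
         2 * (g1 + g2 - 1) * (p * p') + (2 * g1 - 1) * p\<^sup>2 * e\<^sup>2 + (2 * g2 - 1) * p'\<^sup>2 * f\<^sup>2
           + 2 * (2 - 2 * g1 - 2 * g2) * (p * p') * (w * t)
           + 2 * (1 - 2 * g1) * p\<^sup>2 * (e\<^sup>2 * w * t) + 2 * (1 - 2 * g2) * p'\<^sup>2 * (f\<^sup>2 * w * t)
           + 2 * (g1 + g2 - 1) * (p * p') * (w\<^sup>2 * t\<^sup>2)
           + (2 * g1 - 1) * p\<^sup>2 * (e\<^sup>2 * w\<^sup>2 * t\<^sup>2) + (2 * g2 - 1) * p'\<^sup>2 * (f\<^sup>2 * w\<^sup>2 * t\<^sup>2)"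
    using assms by algebra
  moreover have "2 * a - b = c \<Longrightarrow> a - b / 2 = c / 2" for a b c :: complex
    by (simp add: field_simps)
  ultimately show ?thesis
    by (simp only:) (simp add: field_simps)
qed

text \<open>Here \<open>b m\<close> and \<open>q m\<close> stand for the coefficients \<open>b\<^sub>m\<^sub>+\<^sub>1\<close> and \<open>q\<^sub>m\<^sub>+\<^sub>1\<close>
  of the matrix, so that \<open>\<alpha>\<close> starts at index 0.\<close>

locale wkb =
  fixes K :: "'a set" and s u mu :: "'a \<Rightarrow> complex" and E p :: complex
    and \<gamma> d :: real and q b :: "nat \<Rightarrow> real" and \<alpha> :: "nat \<Rightarrow> 'a \<Rightarrow> complex"
  assumes gamma: "1/3 < \<gamma>" "\<gamma> < 1/2"
    and s_imag: "\<And>x. x \<in> K \<Longrightarrow> cnj (s x) = - s x"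
    and s_bdd: "unif_bounded K s"
    and u1: "\<And>x. x \<in> K \<Longrightarrow> cmod (u x) = 1"
    and E1: "cmod E = 1"
    and q: "summable (\<lambda>n. \<bar>q n\<bar>)"
    and b: "\<And>m. complex_of_real (b m)
      = of_real (real (Suc m) powr -\<gamma>) * (p * E ^ Suc m + cnj p * cnj E ^ Suc m) + of_real (q m)"
    and d: "d > 0"
    and res: "d \<le> cmod (E - 1)" "d \<le> cmod (E\<^sup>2 - 1)"
      "\<And>x. x \<in> K \<Longrightarrow> d \<le> cmod (u x - 1)"
      "\<And>x. x \<in> K \<Longrightarrow> d \<le> cmod (E * u x - 1)" "\<And>x. x \<in> K \<Longrightarrow> d \<le> cmod (cnj E * u x - 1)"
      "\<And>x. x \<in> K \<Longrightarrow> d \<le> cmod (E\<^sup>2 * u x - 1)" "\<And>x. x \<in> K \<Longrightarrow> d \<le> cmod ((cnj E)\<^sup>2 * u x - 1)"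
    and mu: "\<And>x. x \<in> K \<Longrightarrow> mu x = (s x)\<^sup>2 * (p * cnj p) * ((u x)\<^sup>2 - 1)
        / ((E * u x - 1) * (cnj E * u x - 1))"
    and \<alpha>0: "\<And>x. x \<in> K \<Longrightarrow> \<alpha> 0 x = 1"
    and \<alpha>_Suc: "\<And>m x. x \<in> K \<Longrightarrow>
      \<alpha> (Suc m) x = \<alpha> m x - s x * of_real (b m) * (\<alpha> m x - u x ^ Suc m * cnj (\<alpha> m x))"
begin

definition a :: "nat \<Rightarrow> real" where "a m = real (Suc m) powr -\<gamma>"

definition \<theta> :: "nat \<Rightarrow> 'a \<Rightarrow> complex" where "\<theta> m x = cnj (\<alpha> m x) / \<alpha> m x"

definition y :: "nat \<Rightarrow> 'a \<Rightarrow> complex" where "y m x = s x * of_real (b m)"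

text \<open>Relative increment: \<open>\<alpha> (Suc m) x = \<alpha> m x * (1 + r m x)\<close>,
  written through \<open>\<theta>\<close> so that only bounded quantities occur.\<close>

definition r :: "nat \<Rightarrow> 'a \<Rightarrow> complex" where "r m x = - (y m x * (1 - u x ^ Suc m * \<theta> m x))"

definition \<beta> :: "nat \<Rightarrow> complex" where "\<beta> m = of_real (a m) * (p * E ^ Suc m + cnj p * cnj E ^ Suc m)"

text \<open>Quadratic polynomial in \<open>\<theta>\<close> that drives the discrete Riccati
  equation \<open>\<theta>_step\<close>.\<close>

definition D :: "nat \<Rightarrow> 'a \<Rightarrow> complex" where
  "D m x = 2 * \<theta> m x - cnj (u x) ^ Suc m - u x ^ Suc m * (\<theta> m x)\<^sup>2"

lemma a_pos: "a m > 0" and a_le1: "a m \<le> 1"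
  unfolding a_def using gamma powr_mono[of "-\<gamma>" 0 "real (Suc m)"] by auto

lemma a_decseq: "decseq a"
  unfolding a_def decseq_def using gamma by (auto intro!: powr_mono2')

lemma a_lim: "a \<longlonglongrightarrow> 0"
proof -
  have "(\<lambda>m. real m powr -\<gamma>) \<longlonglongrightarrow> 0"
    using gamma by (intro tendsto_neg_powr filterlim_real_sequentially) auto
  then show ?thesis unfolding a_def by (rule LIMSEQ_Suc)
qed

lemma a2_decseq: "decseq (\<lambda>m. (a m)\<^sup>2)"
  using a_decseq a_pos unfolding decseq_def by (meson less_imp_le power_mono)

lemma a2_lim: "(\<lambda>m. (a m)\<^sup>2) \<longlonglongrightarrow> 0"
  using tendsto_power[OF a_lim, of 2] by simp

text \<open>Common summable majorant of the remainders: third order in \<open>a\<close>, or at least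
  first order in \<open>q\<close>.\<close>

definition eps :: "nat \<Rightarrow> real" where "eps m = (a m) ^ 3 + \<bar>q m\<bar>"

lemma eps_summable: "summable eps"
proof -
  \<comment> \<open>Third order is the first that is summable: \<open>3 * \<gamma> > 1\<close>,
    whereas \<open>2 * \<gamma> < 1\<close>.\<close>
  have "summable (\<lambda>m. real m powr (-3 * \<gamma>))"
    using gamma by (subst summable_real_powr_iff) auto
  then have "summable (\<lambda>m. real (Suc m) powr (-3 * \<gamma>))"
    by (subst summable_Suc_iff)
  moreover have "real (Suc m) powr (-3 * \<gamma>) = (a m) ^ 3" for m
  proof -
    have "a m ^ 3 = a m powr 3" using a_pos[of m] by simp
    then show ?thesis unfolding a_def by (simp add: powr_powr mult.commute)
  qed
  ultimately show ?thesis using q unfolding eps_def by (intro summable_add) auto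
qed

definition Q :: real where "Q = (\<Sum>n. \<bar>q n\<bar>)"

lemma q_le: "\<bar>q m\<bar> \<le> Q"
  unfolding Q_def using sum_le_suminf[OF q, of "{m}"] by simp

lemma \<beta>_le: "cmod (\<beta> m) \<le> 2 * cmod p * a m"
proof -
  have "cmod (p * E ^ Suc m + cnj p * cnj E ^ Suc m) \<le> cmod p + cmod p"
    by (rule order.trans[OF norm_triangle_ineq]) (simp add: norm_mult norm_power E1)
  then show ?thesis
    unfolding \<beta>_def norm_mult using a_pos[of m] mult_left_mono[of _ "2 * cmod p" "a m"]
    by (auto simp: mult_ac)
qed

lemma b_eq: "complex_of_real (b m) = \<beta> m + of_real (q m)"
  unfolding b \<beta>_def a_def ..

lemma b_le: "\<bar>b m\<bar> \<le> 2 * cmod p * a m + \<bar>q m\<bar>"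
proof -
  have "\<bar>b m\<bar> = cmod (complex_of_real (b m))" by simp
  also have "\<dots> \<le> cmod (\<beta> m) + \<bar>q m\<bar>"
    unfolding b_eq by (rule order.trans[OF norm_triangle_ineq]) simp
  finally show ?thesis using \<beta>_le[of m] by linarith
qed

definition Bb :: real where "Bb = 2 * cmod p + Q"

lemma b_le': "\<bar>b m\<bar> \<le> Bb"
proof -
  have "cmod p * a m \<le> cmod p * 1" by (intro mult_left_mono a_le1) auto
  then show ?thesis using b_le[of m] q_le[of m] unfolding Bb_def by linarith
qed

definition S :: real where "S = (SOME C. C \<ge> 0 \<and> (\<forall>x\<in>K. cmod (s x) \<le> C))"

lemma S: "S \<ge> 0" "x \<in> K \<Longrightarrow> cmod (s x) \<le> S"
proof -
  have "\<exists>C. C \<ge> 0 \<and> (\<forall>x\<in>K. cmod (s x) \<le> C)"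
    using s_bdd unfolding unif_bounded_def by (metis abs_ge_self abs_ge_zero order.trans)
  from someI_ex[OF this] show "S \<ge> 0" "x \<in> K \<Longrightarrow> cmod (s x) \<le> S" unfolding S_def by auto
qed

lemma b_lim: "b \<longlonglongrightarrow> 0"
proof (rule Lim_null_comparison)
  show "\<forall>\<^sub>F m in sequentially. norm (b m) \<le> 2 * cmod p * a m + \<bar>q m\<bar>"
    using b_le by simp
  have "(\<lambda>m. 2 * cmod p * a m + \<bar>q m\<bar>) \<longlonglongrightarrow> 2 * cmod p * 0 + 0"
    by (intro tendsto_intros a_lim summable_LIMSEQ_zero q)
  then show "(\<lambda>m. 2 * cmod p * a m + \<bar>q m\<bar>) \<longlonglongrightarrow> 0" by simp
qed

lemma y_imag: "x \<in> K \<Longrightarrow> cnj (y m x) = - y m x"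
  unfolding y_def by (simp add: s_imag)

lemma y_le: "x \<in> K \<Longrightarrow> cmod (y m x) \<le> S * \<bar>b m\<bar>"
  unfolding y_def norm_mult using S by (simp add: mult_right_mono)

lemma y_le': "x \<in> K \<Longrightarrow> cmod (y m x) \<le> S * Bb"
  using y_le[of x m] b_le'[of m] S(1) by (meson mult_left_mono order.trans)

text \<open>Division by zero yields 0, so the bound holds before \<open>\<alpha>\<close> is known to
  be nonzero; the nonvanishing proof relies on it.\<close>

lemma \<theta>_le: "cmod (\<theta> m x) \<le> 1"
  unfolding \<theta>_def by (cases "\<alpha> m x = 0") (auto simp: norm_divide)

lemma cmod_u_pow [simp]: "x \<in> K \<Longrightarrow> cmod (u x ^ n) = 1" "x \<in> K \<Longrightarrow> cmod (cnj (u x) ^ n) = 1"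
  by (simp_all add: norm_power u1)

lemma w\<theta>_le: "x \<in> K \<Longrightarrow> cmod (1 - u x ^ n * \<theta> m x) \<le> 2"
  by (rule order.trans[OF norm_triangle_ineq4]) (use \<theta>_le[of m x] in \<open>simp add: norm_mult del: power_Suc\<close>)

lemma r_le: "x \<in> K \<Longrightarrow> cmod (r m x) \<le> 2 * cmod (y m x)"
  unfolding r_def using mult_left_mono[OF w\<theta>_le[of x "Suc m" m] norm_ge_zero[of "y m x"]]
  by (simp add: norm_mult)

lemma r_le': "x \<in> K \<Longrightarrow> cmod (r m x) \<le> 2 * S * \<bar>b m\<bar>"
  using r_le[of x m] y_le[of x m] by linarith

text \<open>\<open>y\<close> is purely imaginary, hence
  \<open>cmod (1 - y) = sqrt (1 + t\<^sup>2)\<close> exceeds \<open>t = cmod y\<close>, which bounds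
  the other summand of \<open>1 + r\<close>. Rationalising \<open>sqrt (1 + t\<^sup>2) - t\<close>
  gives an explicit bound for the inverse, without any smallness of \<open>b\<close>.\<close>

lemma inv_1r: assumes x: "x \<in> K" shows "1 + r m x \<noteq> 0" "cmod (inverse (1 + r m x)) \<le> 1 + 2 * (S * Bb)"
proof -
  let ?t = "cmod (y m x)"
  have re: "Re (y m x) = 0" using y_imag[OF x, of m] by (simp add: complex_eq_iff)
  have "cmod (1 - y m x) = sqrt (1 + ?t\<^sup>2)"
    by (simp add: cmod_def re)
  moreover have "cmod (1 + r m x) \<ge> cmod (1 - y m x) - ?t"
  proof -
    have "cmod (y m x * (u x ^ Suc m * \<theta> m x)) \<le> ?t * 1"
      unfolding norm_mult using \<theta>_le[of m x] by (intro mult_left_mono) (auto simp: x simp del: power_Suc)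
    moreover have "1 + r m x = (1 - y m x) + y m x * (u x ^ Suc m * \<theta> m x)"
      unfolding r_def by (simp add: algebra_simps)
    ultimately show ?thesis
      using norm_diff_ineq[of "1 - y m x" "y m x * (u x ^ Suc m * \<theta> m x)"] by (simp only:)
  qed
  ultimately have 1: "cmod (1 + r m x) \<ge> sqrt (1 + ?t\<^sup>2) - ?t" by simp
  have 2: "(sqrt (1 + ?t\<^sup>2) - ?t) * (sqrt (1 + ?t\<^sup>2) + ?t) = 1"
    by (simp add: algebra_simps power2_eq_square flip: real_sqrt_mult)
  have 3: "sqrt (1 + ?t\<^sup>2) + ?t \<le> 1 + 2 * ?t"
    using sqrt_sum_squares_le_sum[of 1 ?t] by simp
  have 4: "sqrt (1 + ?t\<^sup>2) + ?t > 0" by (simp add: add_pos_nonneg)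
  have 5: "sqrt (1 + ?t\<^sup>2) - ?t = inverse (sqrt (1 + ?t\<^sup>2) + ?t)"
    using 2 4 by (simp add: field_simps)
  have pos: "sqrt (1 + ?t\<^sup>2) - ?t > 0" using 4 unfolding 5 by simp
  then show "1 + r m x \<noteq> 0" using 1 by auto
  have "cmod (inverse (1 + r m x)) \<le> inverse (sqrt (1 + ?t\<^sup>2) - ?t)"
    unfolding norm_inverse using 1 pos by (intro le_imp_inverse_le)
  also have "\<dots> = sqrt (1 + ?t\<^sup>2) + ?t" unfolding 5 by simp
  finally show "cmod (inverse (1 + r m x)) \<le> 1 + 2 * (S * Bb)"
    using 3 y_le'[OF x, of m] by linarith
qed

lemma \<alpha>_nonzero: "x \<in> K \<Longrightarrow> \<alpha> m x \<noteq> 0"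
  and \<alpha>_ratio: "x \<in> K \<Longrightarrow> \<alpha> (Suc m) x = \<alpha> m x * (1 + r m x)"
proof -
  assume x: "x \<in> K"
  have ratio: "\<alpha> (Suc m) x = \<alpha> m x * (1 + r m x)" if "\<alpha> m x \<noteq> 0" for m
    unfolding \<alpha>_Suc[OF x] r_def y_def \<theta>_def using that by (simp add: field_simps)
  show "\<alpha> m x \<noteq> 0"
    by (induction m) (auto simp: \<alpha>0 x ratio inv_1r)
  then show "\<alpha> (Suc m) x = \<alpha> m x * (1 + r m x)" using ratio by blast
qed

text \<open>Conjugating the recursion flips the sign of \<open>y\<close>, so numerator and
  denominator of \<open>\<theta> (Suc m) x\<close> are both affine in \<open>\<theta> m x\<close>;
  subtracting \<open>\<theta> m x\<close> gives a discrete Riccati equation.\<close>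

lemma \<theta>_step: 
  assumes x: "x \<in> K"
  shows "\<theta> (Suc m) x - \<theta> m x = y m x * D m x * inverse (1 + r m x)"
proof -
  have nz: "\<alpha> m x \<noteq> 0" "1 + r m x \<noteq> 0" using \<alpha>_nonzero inv_1r x by auto
  have cn: "cnj (\<alpha> (Suc m) x) = \<alpha> m x * (\<theta> m x + y m x * (\<theta> m x - cnj (u x) ^ Suc m))"
  proof -
    have c: "cnj (\<alpha> m x) = \<alpha> m x * \<theta> m x" using nz by (simp add: \<theta>_def)
    have "cnj (\<alpha> (Suc m) x) = cnj (\<alpha> m x) + y m x * (cnj (\<alpha> m x) - cnj (u x) ^ Suc m * \<alpha> m x)"
      unfolding \<alpha>_Suc[OF x] y_def by (simp add: s_imag[OF x])
    then show ?thesis unfolding c by (simp add: algebra_simps)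
  qed
  have "\<theta> (Suc m) x = (\<theta> m x + y m x * (\<theta> m x - cnj (u x) ^ Suc m)) / (1 + r m x)"
    unfolding \<theta>_def[of "Suc m" x] cn unfolding \<alpha>_ratio[OF x] using nz by (intro mult_divide_mult_cancel_left)
  then have "\<theta> (Suc m) x - \<theta> m x = 
    (\<theta> m x + y m x * (\<theta> m x - cnj (u x) ^ Suc m) - \<theta> m x * (1 + r m x)) / (1 + r m x)"
    using nz by (simp add: field_simps)
  also have "\<theta> m x + y m x * (\<theta> m x - cnj (u x) ^ Suc m) - \<theta> m x * (1 + r m x) = y m x * D m x"
    unfolding r_def D_def by (simp add: algebra_simps power2_eq_square)
  finally show ?thesis by (simp add: divide_inverse)
qed

lemma D_le: assumes x: "x \<in> K" shows "cmod (D m x) \<le> 4"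
proof -
  have "cmod (\<theta> m x) ^ 2 \<le> 1" using \<theta>_le[of m x] by (simp add: power_le_one)
  then have "cmod (u x ^ Suc m * (\<theta> m x)\<^sup>2) \<le> 1" 
    unfolding norm_mult norm_power[of "\<theta> m x"] cmod_u_pow(1)[OF x] by simp
  moreover have "cmod (cnj (u x) ^ Suc m) = 1" using x by (rule cmod_u_pow)
  moreover have "cmod (2 * \<theta> m x) \<le> 2" using \<theta>_le[of m x] by (simp add: norm_mult)
  ultimately show ?thesis
    unfolding D_def by (smt (verit) norm_triangle_ineq4)
qed

lemma ab_le: "(a m)\<^sup>2 * \<bar>b m\<bar> \<le> (2 * cmod p + 1) * eps m"
proof -
  have "(a m)\<^sup>2 * \<bar>b m\<bar> \<le> (a m)\<^sup>2 * (2 * cmod p * a m + \<bar>q m\<bar>)"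
    by (intro mult_left_mono b_le) auto
  also have "\<dots> = 2 * cmod p * (a m)^3 + (a m)\<^sup>2 * \<bar>q m\<bar>"
    by (simp add: algebra_simps power3_eq_cube power2_eq_square)
  also have "\<dots> \<le> 2 * cmod p * (a m)^3 + 1 * \<bar>q m\<bar>"
    using a_le1[of m] a_pos[of m] by (intro add_left_mono mult_right_mono) (auto intro: power_le_one)
  also have "\<dots> \<le> (2 * cmod p + 1) * eps m"
    unfolding eps_def using a_pos[of m] by (simp add: algebra_simps)
  finally show ?thesis .
qed

lemma \<theta>_diff_le:
  assumes x: "x \<in> K" shows "cmod (\<theta> (Suc m) x - \<theta> m x) \<le> 4 * S * (1 + 2 * (S * Bb)) * \<bar>b m\<bar>"
proof -
  have "cmod (\<theta> (Suc m) x - \<theta> m x) = cmod (y m x) * cmod (D m x) * cmod (inverse (1 + r m x))"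
    unfolding \<theta>_step[OF x] norm_mult ..
  also have "\<dots> \<le> (S * \<bar>b m\<bar>) * 4 * (1 + 2 * (S * Bb))"
    using S(1) by (intro mult_mono y_le D_le inv_1r x) auto
  finally show ?thesis by (simp add: mult_ac)
qed

text \<open>Here summation by parts closes: \<open>\<theta>\<close> moves by at most a multiple of
  \<open>\<bar>b m\<bar>\<close>, so against the weight \<open>a\<^sup>2\<close> its increments are
  of third order or contain \<open>q\<close>, hence are dominated by \<open>eps\<close>.\<close>

lemma unif_summable_second_order:
  assumes z: "\<And>x. x \<in> K \<Longrightarrow> cmod (z x) = 1" and c: "unif_bounded K c"
  shows "unif_summable K (\<lambda>m x. c x * ((z x - 1) * (z x ^ Suc m * (of_real ((a m)\<^sup>2) * \<theta> m x ^ j))))"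
proof (intro unif_summable_unif_bounded[OF _ c] unif_summable_oscillating[where B = 1 and M = eps
    and C = "j * (4 * S * (1 + 2 * (S * Bb)) * (2 * cmod p + 1))"])
  fix m x assume x: "x \<in> K"
  show "cmod (\<theta> m x ^ j) \<le> 1"
    using \<theta>_le[of m x] by (simp add: norm_power power_le_one)
  have Bb: "Bb \<ge> 0" using b_le'[of 0] by linarith
  have "(a m)\<^sup>2 * cmod (\<theta> (Suc m) x ^ j - \<theta> m x ^ j) \<le> (a m)\<^sup>2 * (j * cmod (\<theta> (Suc m) x - \<theta> m x))"
    by (intro mult_left_mono norm_power_diff \<theta>_le) auto
  also have "\<dots> \<le> (a m)\<^sup>2 * (j * (4 * S * (1 + 2 * (S * Bb)) * \<bar>b m\<bar>))"
    by (intro mult_left_mono \<theta>_diff_le x) auto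
  also have "\<dots> = (j * (4 * S * (1 + 2 * (S * Bb)))) * ((a m)\<^sup>2 * \<bar>b m\<bar>)" by simp
  also have "\<dots> \<le> (j * (4 * S * (1 + 2 * (S * Bb)))) * ((2 * cmod p + 1) * eps m)"
    using S(1) Bb by (intro mult_left_mono ab_le) auto
  finally show "(a m)\<^sup>2 * cmod (\<theta> (Suc m) x ^ j - \<theta> m x ^ j)
    \<le> j * (4 * S * (1 + 2 * (S * Bb)) * (2 * cmod p + 1)) * eps m" by (simp add: mult_ac)
qed (use z a2_decseq a2_lim eps_summable in auto)

lemma unif_summable_second_order_nonres:
  assumes z: "\<And>x. x \<in> K \<Longrightarrow> cmod (z x) = 1" and c: "unif_bounded K c"
    and zd: "\<And>x. x \<in> K \<Longrightarrow> d \<le> cmod (z x - 1)"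
  shows "unif_summable K (\<lambda>m x. c x * (z x ^ Suc m * (of_real ((a m)\<^sup>2) * \<theta> m x ^ j)))"
proof -
  have "unif_summable K (\<lambda>m x. (c x * inverse (z x - 1)) *
      ((z x - 1) * (z x ^ Suc m * (of_real ((a m)\<^sup>2) * \<theta> m x ^ j))))"
    by (intro unif_summable_second_order z unif_bounded_intros c unif_bounded_inverse[OF d] zd)
  moreover have "z x \<noteq> 1" if "x \<in> K" for x using zd[OF that] d by auto
  ultimately show ?thesis
    by (elim unif_summable_cong[rotated]) (simp add: field_simps)
qed

end

section \<open>Second order expansion of the logarithm of the amplitude\<close>

lemma unif_bounded_exp [unif_bounded_intros]: "unif_bounded K f \<Longrightarrow> unif_bounded K (\<lambda>x. exp (f x))"
  unfolding unif_bounded_def by (meson exp_le_cancel_iff norm_exp order.trans)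

lemma unif_bounded_divide:
  assumes "unif_bounded K f" "d > 0" "\<And>x. x \<in> K \<Longrightarrow> d \<le> cmod (g x)"
  shows "unif_bounded K (\<lambda>x. f x / g x)"
  unfolding divide_inverse by (intro unif_bounded_intros assms unif_bounded_inverse[OF assms(2)])

text \<open>Exact bookkeeping for the main series. Its pieces are the errors from \<open>q\<close>
  in the linear and quadratic terms, pure oscillations of first order, two Abel sums for the
  frequencies \<open>z1\<close> and \<open>z2\<close>, the error of replacing the increment
  \<open>dt\<close> by \<open>s * bt * D\<close>, and a second order bracket left to
  \<open>wkb_second_order_identity\<close>. The \<open>dt\<close> terms that complete the Abel sums
  are taken off again through \<open>g1\<close> and \<open>g2\<close>.\<close>

lemma wkb_assembly:
  fixes r s t dt bt a e f w v p p' c1 c2 g1 g2 z1 z2 M D :: complex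
  assumes "c1 * (z1 - 1) = 1" "c2 * (z2 - 1) = 1" "g1 = c1 * z1" "g2 = c2 * z2"
    and bt: "bt = a * (p * e + p' * f)" and D: "D = 2 * t - v - w * t\<^sup>2"
  shows "r - r\<^sup>2 / 2 - M * a\<^sup>2 =
     (r + s * bt * (1 - w * t)) - 1/2 * (r\<^sup>2 - s\<^sup>2 * bt\<^sup>2 * (1 - w * t)\<^sup>2)
     - s * p * (e * a) - s * p' * (f * a)
     + s * p * c1 * ((z1 - 1) * (e * w * (a * t)) + z1 * (e * w * (a * dt)))
     + s * p' * c2 * ((z2 - 1) * (f * w * (a * t)) + z2 * (f * w * (a * dt)))
     - s * p * g1 * (e * w * (a * (dt - s * bt * D)))
     - s * p' * g2 * (f * w * (a * (dt - s * bt * D)))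
     + (s\<^sup>2 * a\<^sup>2 * (- (p * g1 * e + p' * g2 * f) * w * (p * e + p' * f) * (2 * t - v - w * t\<^sup>2)
           - (p * e + p' * f)\<^sup>2 * (1 - w * t)\<^sup>2 / 2) - M * a\<^sup>2)"
proof -
  have 1: "s * p * c1 * ((z1 - 1) * (e * w * (a * t)) + z1 * (e * w * (a * dt)))
      = s * p * (e * w * (a * t)) + s * p * g1 * (e * w * (a * dt))"
    using assms(1,3) by algebra
  have 2: "s * p' * c2 * ((z2 - 1) * (f * w * (a * t)) + z2 * (f * w * (a * dt)))
      = s * p' * (f * w * (a * t)) + s * p' * g2 * (f * w * (a * dt))"
    using assms(2,4) by algebra
  show ?thesis
    unfolding 1 2 bt D by (simp add: field_simps) algebra
qed

context wkb
begin

text \<open>Primitive of \<open>t powr (-2 * \<gamma>)\<close>; \<open>mu x * h n\<close> will be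
  the \<open>growth_exponent\<close>.\<close>

definition h :: "nat \<Rightarrow> real" where "h m = real m powr (1 - 2 * \<gamma>) / (1 - 2 * \<gamma>)"

lemma unif_bounded_mu: "unif_bounded K mu"
proof -
  have "unif_bounded K (\<lambda>x. (s x)\<^sup>2 * (p * cnj p) * ((u x)\<^sup>2 - 1)
      / (E * u x - 1) / (cnj E * u x - 1))"
    using u1 by (intro unif_bounded_divide[OF _ d] unif_bounded_intros res s_bdd)
      (auto simp: unif_bounded_def intro!: exI[of _ 1])
  then show ?thesis unfolding unif_bounded_def by (auto simp: mu)
qed

lemma unif_bounded_u: "unif_bounded K u" unfolding unif_bounded_def using u1 by (intro exI[of _ 1]) auto

text \<open>By the mean value theorem the increment of \<open>h\<close> is
  \<open>z powr (-2 * \<gamma>)\<close> with \<open>m < z < m + 1\<close>, while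
  \<open>(a m)\<^sup>2\<close> is the value at m + 1; monotonicity encloses both, and the bound
  telescopes. Index 0 is left out because \<open>0 powr x\<close> is 0.\<close>

lemma h_increment:
  assumes "m \<ge> 1"
  shows "\<bar>(a m)\<^sup>2 - (h (Suc m) - h m)\<bar> \<le> real m powr (-2*\<gamma>) - real (Suc m) powr (-2*\<gamma>)"
proof -
  define k where "k = 1 - 2 * \<gamma>"
  have k: "k > 0" "k < 1" using gamma by (auto simp: k_def)
  have "\<exists>z. real m < z \<and> z < real m + 1 \<and>
      (real m + 1) powr k / k - real m powr k / k = (real m + 1 - real m) * z powr (k - 1)"
    using assms k by (intro MVT2) (auto intro!: derivative_eq_intros simp: field_simps powr_diff)
  then obtain z where z: "real m < z" "z < real m + 1" and e: "h (Suc m) - h m = z powr (-2*\<gamma>)"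
    unfolding h_def k_def[symmetric] by (auto simp: k_def add.commute)
  have 1: "z powr (-2*\<gamma>) \<le> real m powr (-2*\<gamma>)" "real (Suc m) powr (-2*\<gamma>) \<le> z powr (-2*\<gamma>)"
    using z assms gamma by (auto intro!: powr_mono2')
  have "(a m)\<^sup>2 = a m powr 2" using a_pos[of m] by simp
  then have "(a m)\<^sup>2 = real (Suc m) powr (-2*\<gamma>)" unfolding a_def by (simp add: powr_powr mult.commute)
  then show ?thesis using 1 e by linarith
qed

lemma unif_summable_h: "unif_summable K (\<lambda>m x. mu x * of_real ((a m)\<^sup>2 - (h (Suc m) - h m)))"
proof (rule unif_summable_unif_bounded[OF _ unif_bounded_mu])
  have "(\<lambda>m. real m powr (-2*\<gamma>)) \<longlonglongrightarrow> 0"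
    using gamma by (intro tendsto_neg_powr filterlim_real_sequentially) auto
  from telescope_summable'[OF this]
  show "unif_summable K (\<lambda>m x. of_real ((a m)\<^sup>2 - (h (Suc m) - h m)))"
    by (rule unif_summable_dominated[where C = 1])
      (auto simp del: of_real_diff intro!: eventually_sequentiallyI[of 1] h_increment[simplified])
qed

lemma unif_summable_err1: "unif_summable K (\<lambda>m x. r m x + s x * \<beta> m * (1 - u x ^ Suc m * \<theta> m x))"
proof (rule unif_summable_dominated[OF q], intro always_eventually allI ballI)
  fix m x assume x: "x \<in> K"
  have "r m x + s x * \<beta> m * (1 - u x ^ Suc m * \<theta> m x) = - (s x * of_real (q m) * (1 - u x ^ Suc m * \<theta> m x))"
    unfolding r_def y_def b_eq by (simp add: algebra_simps)
  then have "cmod (r m x + s x * \<beta> m * (1 - u x ^ Suc m * \<theta> m x))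
      = cmod (s x) * \<bar>q m\<bar> * cmod (1 - u x ^ Suc m * \<theta> m x)" by (simp only: norm_minus_cancel norm_mult norm_of_real)
  also have "\<dots> \<le> S * \<bar>q m\<bar> * 2"
    using S(1) by (intro mult_mono w\<theta>_le x S(2)) auto
  finally show "cmod (r m x + s x * \<beta> m * (1 - u x ^ Suc m * \<theta> m x)) \<le> (2 * S) * \<bar>q m\<bar>" by simp
qed

lemma unif_summable_err2: "unif_summable K (\<lambda>m x. (r m x)\<^sup>2 - (s x)\<^sup>2 * (\<beta> m)\<^sup>2 * (1 - u x ^ Suc m * \<theta> m x)\<^sup>2)"
proof (rule unif_summable_dominated[OF q], intro always_eventually allI ballI)
  fix m x assume x: "x \<in> K"
  let ?W = "1 - u x ^ Suc m * \<theta> m x"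
  have \<beta>m: "\<beta> m = of_real (b m) - of_real (q m)" using b_eq[of m] by simp
  have "(r m x)\<^sup>2 - (s x)\<^sup>2 * (\<beta> m)\<^sup>2 * ?W\<^sup>2 = (s x)\<^sup>2 * of_real (q m * (2 * b m - q m)) * ?W\<^sup>2"
    unfolding r_def y_def \<beta>m by (simp add: algebra_simps power2_eq_square)
  then have "cmod ((r m x)\<^sup>2 - (s x)\<^sup>2 * (\<beta> m)\<^sup>2 * ?W\<^sup>2)
      = (cmod (s x))\<^sup>2 * (\<bar>q m\<bar> * \<bar>2 * b m - q m\<bar>) * (cmod ?W)\<^sup>2"
    by (simp only: norm_mult norm_of_real norm_power abs_mult)
  also have "\<dots> \<le> S\<^sup>2 * (\<bar>q m\<bar> * (2 * Bb + Q)) * 2\<^sup>2"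
    using S(1) b_le'[of m] q_le[of m]
    by (intro mult_mono power_mono x S(2) w\<theta>_le) (auto intro!: mult_nonneg_nonneg)
  finally show "cmod ((r m x)\<^sup>2 - (s x)\<^sup>2 * (\<beta> m)\<^sup>2 * ?W\<^sup>2) \<le> (4 * S\<^sup>2 * (2 * Bb + Q)) * \<bar>q m\<bar>"
    by (simp add: mult_ac)
qed

text \<open>The exact increment carries the factor \<open>1 / (1 + r)\<close>. Replacing it by 1 and
  \<open>b\<close> by \<open>\<beta>\<close> costs terms with \<open>q\<close> or
  \<open>\<beta> * r\<close>, and the extra weight \<open>a\<close> makes the latter third
  order.\<close>

lemma unif_summable_err3:
  assumes z: "\<And>x. x \<in> K \<Longrightarrow> cmod (z x) = 1"
  shows "unif_summable K (\<lambda>m x. z x ^ Suc m * (of_real (a m) * (\<theta> (Suc m) x - \<theta> m x - s x * \<beta> m * D m x)))"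
proof (rule unif_summable_dominated[OF eps_summable], intro always_eventually allI ballI)
  fix m x assume x: "x \<in> K"
  let ?i = "inverse (1 + r m x)" and ?c = "1 + 2 * (S * Bb)" and ?C = "4 * S * (1 + 4 * cmod p * S)"
  have Bb: "Bb \<ge> 0" using b_le'[of 0] by linarith
  have c: "?c \<ge> 1" using S Bb by simp
  have i: "?i - 1 = - r m x * ?i" using inv_1r(1)[OF x, of m] by (simp add: field_simps)
  have "\<theta> (Suc m) x - \<theta> m x - s x * \<beta> m * D m x = s x * D m x * (of_real (q m) * ?i + \<beta> m * (?i - 1))"
    unfolding \<theta>_step[OF x] y_def b_eq by (simp add: algebra_simps)
  also have "\<dots> = s x * D m x * ((of_real (q m) - \<beta> m * r m x) * ?i)"
    unfolding i by (simp add: algebra_simps)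
  finally have "cmod (\<theta> (Suc m) x - \<theta> m x - s x * \<beta> m * D m x) =
      cmod (s x) * cmod (D m x) * (cmod (of_real (q m) - \<beta> m * r m x) * cmod ?i)"
    by (simp only: norm_mult)
  also have "\<dots> \<le> S * 4 * ((\<bar>q m\<bar> + (2 * cmod p * a m) * (2 * S * \<bar>b m\<bar>)) * ?c)"
  proof -
    have "cmod (of_real (q m) - \<beta> m * r m x) \<le> \<bar>q m\<bar> + cmod (\<beta> m) * cmod (r m x)"
      by (rule order.trans[OF norm_triangle_ineq4]) (simp add: norm_mult)
    also have "\<dots> \<le> \<bar>q m\<bar> + (2 * cmod p * a m) * (2 * S * \<bar>b m\<bar>)"
      using a_pos[of m] by (intro add_left_mono mult_mono \<beta>_le r_le' x) auto
    finally show ?thesis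
      using S(1) a_pos[of m] by (intro mult_mono D_le inv_1r x S(2)) auto
  qed
  finally have "a m * cmod (\<theta> (Suc m) x - \<theta> m x - s x * \<beta> m * D m x)
      \<le> a m * (S * 4 * ((\<bar>q m\<bar> + (2 * cmod p * a m) * (2 * S * \<bar>b m\<bar>)) * ?c))"
    using a_pos[of m] by (intro mult_left_mono) auto
  also have "\<dots> = (4 * S * ?c) * (a m * \<bar>q m\<bar> + 4 * cmod p * S * ((a m)\<^sup>2 * \<bar>b m\<bar>))"
    by (simp add: algebra_simps power2_eq_square)
  also have "\<dots> \<le> (4 * S * ?c) * (1 * eps m + 4 * cmod p * S * ((2 * cmod p + 1) * eps m))"
  proof -
    have "a m * \<bar>q m\<bar> \<le> 1 * eps m"
      using a_le1[of m] a_pos[of m] unfolding eps_def by (intro mult_mono) auto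
    then show ?thesis using S c by (intro mult_left_mono add_mono ab_le) auto
  qed
  finally show "cmod (z x ^ Suc m * (of_real (a m) * (\<theta> (Suc m) x - \<theta> m x - s x * \<beta> m * D m x)))
      \<le> ((4 * S * ?c) * (1 + 4 * cmod p * S * (2 * cmod p + 1))) * eps m"
    unfolding norm_mult[of "z x ^ Suc m"] norm_mult[of "of_real (a m)"] norm_power z[OF x] power_one norm_of_real
    using a_pos[of m] by (simp only: abs_of_pos mult_1_left) (simp add: algebra_simps)
qed

lemma unif_summable_Ln: "unif_summable K (\<lambda>m x. Ln (1 + r m x) - (r m x - (r m x)\<^sup>2 / 2))"
proof (rule unif_summable_dominated[OF eps_summable])
  \<comment> \<open>The logarithmic estimate needs \<open>cmod (r m x) \<le> 1/2\<close>, which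
    holds eventually; the 1 in \<open>4 * S + 1\<close> covers \<open>S = 0\<close>.\<close>
  have "\<forall>\<^sub>F m in sequentially. \<bar>b m\<bar> < 1 / (4 * S + 1)"
    using tendstoD[OF b_lim, of "1 / (4 * S + 1)"] S(1) by simp
  then show "\<forall>\<^sub>F m in sequentially. \<forall>x\<in>K. cmod (Ln (1 + r m x) - (r m x - (r m x)\<^sup>2 / 2))
     \<le> (2 * (2 * S) ^ 3 * (4 * ((2 * cmod p)^3 + Q\<^sup>2))) * eps m"
  proof eventually_elim
    case (elim m)
    show ?case
    proof
      fix x assume x: "x \<in> K"
      have "\<bar>b m\<bar> * (4 * S + 1) \<le> 1" using elim S(1) by (simp add: field_simps)
      then have "2 * S * \<bar>b m\<bar> \<le> 1/2" by (simp add: algebra_simps)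
      then have "cmod (r m x) \<le> 1/2" using r_le'[OF x, of m] by linarith
      then have "cmod (Ln (1 + r m x) - (r m x - (r m x)\<^sup>2 / 2)) \<le> 2 * cmod (r m x) ^ 3"
        by (rule Ln_approx_quadratic)
      also have "\<dots> \<le> 2 * (2 * S * \<bar>b m\<bar>) ^ 3"
        by (intro mult_left_mono power_mono r_le' x) auto
      also have "\<dots> = 2 * (2 * S) ^ 3 * \<bar>b m\<bar> ^ 3" by (simp add: power_mult_distrib)
      also have "\<dots> \<le> 2 * (2 * S) ^ 3 * ((4 * ((2 * cmod p)^3 + Q\<^sup>2)) * eps m)"
      proof (intro mult_left_mono)
        let ?A = "2 * cmod p * a m"
        have A: "?A \<ge> 0" using a_pos[of m] by simp
        have "\<bar>b m\<bar> ^ 3 \<le> (?A + \<bar>q m\<bar>) ^ 3"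
          by (intro power_mono b_le) auto
        also have "\<dots> \<le> 4 * (?A ^ 3 + \<bar>q m\<bar> ^ 3)"
        proof -
          \<comment> \<open>Convexity of the cube on nonnegative numbers, made explicit by a
            factorisation.\<close>
          have "4 * (X^3 + Y^3) - (X + Y)^3 = 3 * (X + Y) * (X - Y)\<^sup>2" for X Y :: real by algebra
          from this[of ?A "\<bar>q m\<bar>"] A show ?thesis
            by (smt (verit) abs_ge_zero mult_nonneg_nonneg zero_le_power2)
        qed
        also have "\<dots> \<le> 4 * ((2 * cmod p)^3 * eps m + Q\<^sup>2 * eps m)"
        proof -
          have "?A ^ 3 \<le> (2 * cmod p)^3 * eps m"
            unfolding eps_def power_mult_distrib by (intro mult_left_mono) auto
          moreover have "\<bar>q m\<bar> ^ 3 = \<bar>q m\<bar>\<^sup>2 * \<bar>q m\<bar>" by (simp add: power3_eq_cube power2_eq_square)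
          moreover have "\<bar>q m\<bar>\<^sup>2 * \<bar>q m\<bar> \<le> Q\<^sup>2 * eps m"
            using a_pos[of m] q_le[of m] unfolding eps_def
            by (intro mult_mono power_mono) auto
          ultimately show ?thesis by simp
        qed
        finally show "\<bar>b m\<bar> ^ 3 \<le> (4 * ((2 * cmod p)^3 + Q\<^sup>2)) * eps m" by (simp add: algebra_simps)
      qed (use S in auto)
      finally show "cmod (Ln (1 + r m x) - (r m x - (r m x)\<^sup>2 / 2))
        \<le> (2 * (2 * S) ^ 3 * (4 * ((2 * cmod p)^3 + Q\<^sup>2))) * eps m" by (simp only: mult.assoc)
    qed
  qed
qed

text \<open>Weights of the summation by parts at the two first order frequencies
  \<open>E * u\<close> and \<open>cnj E * u\<close>: \<open>c1\<close>, \<open>c2\<close> undo the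
  factor \<open>z - 1\<close>, and \<open>g1\<close>, \<open>g2\<close> are the coefficients that
  the increment of \<open>\<theta>\<close> inherits.\<close>

definition c1 :: "'a \<Rightarrow> complex" where "c1 x = inverse (E * u x - 1)"
definition c2 :: "'a \<Rightarrow> complex" where "c2 x = inverse (cnj E * u x - 1)"
definition g1 :: "'a \<Rightarrow> complex" where "g1 x = c1 x * (E * u x)"
definition g2 :: "'a \<Rightarrow> complex" where "g2 x = c2 x * (cnj E * u x)"

lemma unif_bounded_c: "unif_bounded K c1" "unif_bounded K c2" "unif_bounded K g1" "unif_bounded K g2"
proof -
  show 1: "unif_bounded K c1" unfolding c1_def by (rule unif_bounded_inverse[OF d res(4)])
  show 2: "unif_bounded K c2" unfolding c2_def by (rule unif_bounded_inverse[OF d res(5)])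
  show "unif_bounded K g1" "unif_bounded K g2" unfolding g1_def g2_def by (intro unif_bounded_intros 1 2 unif_bounded_u)+
qed

lemma unif_summable_first_order_const:
  assumes c: "unif_bounded K c" and z: "cmod z = 1" "d \<le> cmod (z - 1)"
  shows "unif_summable K (\<lambda>m x. c x * (z ^ Suc m * of_real (a m)))"
proof -
  have "unif_summable K (\<lambda>m x. (z - 1) * (z ^ Suc m * (of_real (a m) * 1)))"
    by (rule unif_summable_oscillating[where X = "\<lambda>_ _. 1" and B = 1 and C = 0, OF _ _ a_decseq a_lim _ eps_summable])
       (auto simp: z)
  from unif_summable_unif_bounded[OF this, of "\<lambda>x. c x * inverse (z - 1)"]
  have "unif_summable K (\<lambda>m x. c x * inverse (z - 1) * ((z - 1) * (z ^ Suc m * (of_real (a m) * 1))))"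
    by (simp add: unif_bounded_intros c)
  moreover have "z \<noteq> 1" using z d by auto
  ultimately show ?thesis by (elim unif_summable_cong[rotated]) (simp add: field_simps)
qed

text \<open>Every second order product oscillates except the one absorbed by \<open>mu\<close>. The
  series \<open>?S1\<close> to \<open>?S8\<close> are the oscillating terms of
  \<open>wkb_second_order_identity\<close>, in the order in which they stand there.\<close>

lemma unif_summable_main: "unif_summable K (\<lambda>m x. r m x - (r m x)\<^sup>2 / 2 - mu x * of_real ((a m)\<^sup>2))"
proof -
  have Eu: "cmod (E * u x) = 1" "cmod (cnj E * u x) = 1" "cmod (E\<^sup>2 * u x) = 1" "cmod ((cnj E)\<^sup>2 * u x) = 1"
    "cmod ((E * u x)\<^sup>2) = 1" "cmod ((cnj E * u x)\<^sup>2) = 1" "cmod ((u x)\<^sup>2) = 1" if "x \<in> K" for x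
    using that by (simp_all add: norm_mult norm_power E1 u1)
  have cE: "d \<le> cmod (cnj E - 1)" "d \<le> cmod ((cnj E)\<^sup>2 - 1)"
    using res(1,2) by (metis complex_cnj_diff complex_cnj_one complex_mod_cnj complex_cnj_power)+
  note U = unif_bounded_intros s_bdd unif_bounded_c unif_bounded_u
  let ?p = p and ?p' = "cnj p"
  \<comment> \<open>The increment of \<open>\<theta>\<close> is itself of first order, so the Abel
    sum is kept whole here.\<close>
  note A1 = unif_summable_unif_bounded[OF unif_summable_abel[where z = "\<lambda>x. E * u x" and X = \<theta> and B = 1 and K = K, OF Eu(1) \<theta>_le a_decseq a_lim],
      of "\<lambda>x. s x * ?p * c1 x", OF _ unif_bounded_mult[OF unif_bounded_mult[OF s_bdd unif_bounded_const] unif_bounded_c(1)]]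
  note A2 = unif_summable_unif_bounded[OF unif_summable_abel[where z = "\<lambda>x. cnj E * u x" and X = \<theta> and B = 1 and K = K, OF Eu(2) \<theta>_le a_decseq a_lim],
      of "\<lambda>x. s x * ?p' * c2 x", OF _ unif_bounded_mult[OF unif_bounded_mult[OF s_bdd unif_bounded_const] unif_bounded_c(2)]]
  have B1: "unif_summable K (\<lambda>m x. s x * ?p * g1 x * ((E * u x) ^ Suc m *
      (of_real (a m) * (\<theta> (Suc m) x - \<theta> m x - s x * \<beta> m * D m x))))"
    by (intro unif_summable_unif_bounded unif_summable_err3 Eu U)
  have B2: "unif_summable K (\<lambda>m x. s x * ?p' * g2 x * ((cnj E * u x) ^ Suc m *
      (of_real (a m) * (\<theta> (Suc m) x - \<theta> m x - s x * \<beta> m * D m x))))"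
    by (intro unif_summable_unif_bounded unif_summable_err3 Eu U)
  have C1: "unif_summable K (\<lambda>m x. s x * ?p * (E ^ Suc m * of_real (a m)))"
    by (intro unif_summable_first_order_const U res E1)
  have C2: "unif_summable K (\<lambda>m x. s x * ?p' * (cnj E ^ Suc m * of_real (a m)))"
    by (intro unif_summable_first_order_const U cE) (simp add: E1)
  have e2: "unif_summable K (\<lambda>m x. 1/2 * ((r m x)\<^sup>2 - (s x)\<^sup>2 * (\<beta> m)\<^sup>2 * (1 - u x ^ Suc m * \<theta> m x)\<^sup>2))"
    by (rule unif_summable_unif_bounded[OF unif_summable_err2 unif_bounded_const])
  let ?S1 = "\<lambda>m x. ((s x)\<^sup>2 * ((g1 x - 1/2) * ?p\<^sup>2)) * ((E\<^sup>2) ^ Suc m * (of_real ((a m)\<^sup>2) * \<theta> m x ^ 0))"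
    and ?S2 = "\<lambda>m x. ((s x)\<^sup>2 * ((g2 x - 1/2) * ?p'\<^sup>2)) * (((cnj E)\<^sup>2) ^ Suc m * (of_real ((a m)\<^sup>2) * \<theta> m x ^ 0))"
    and ?S3 = "\<lambda>m x. ((s x)\<^sup>2 * ((2 - 2 * g1 x - 2 * g2 x) * (?p * ?p'))) * (u x ^ Suc m * (of_real ((a m)\<^sup>2) * \<theta> m x ^ 1))"
    and ?S4 = "\<lambda>m x. ((s x)\<^sup>2 * ((1 - 2 * g1 x) * ?p\<^sup>2)) * ((E\<^sup>2 * u x) ^ Suc m * (of_real ((a m)\<^sup>2) * \<theta> m x ^ 1))"
    and ?S5 = "\<lambda>m x. ((s x)\<^sup>2 * ((1 - 2 * g2 x) * ?p'\<^sup>2)) * (((cnj E)\<^sup>2 * u x) ^ Suc m * (of_real ((a m)\<^sup>2) * \<theta> m x ^ 1))"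
    and ?S6 = "\<lambda>m x. ((s x)\<^sup>2 * (c1 x * c2 x * (?p * ?p'))) * (((u x)\<^sup>2 - 1) * (((u x)\<^sup>2) ^ Suc m * (of_real ((a m)\<^sup>2) * \<theta> m x ^ 2)))"
    and ?S7 = "\<lambda>m x. ((s x)\<^sup>2 * ((c1 x)\<^sup>2 * (1/2) * ?p\<^sup>2)) * (((E * u x)\<^sup>2 - 1) * (((E * u x)\<^sup>2) ^ Suc m * (of_real ((a m)\<^sup>2) * \<theta> m x ^ 2)))"
    and ?S8 = "\<lambda>m x. ((s x)\<^sup>2 * ((c2 x)\<^sup>2 * (1/2) * ?p'\<^sup>2)) * (((cnj E * u x)\<^sup>2 - 1) * (((cnj E * u x)\<^sup>2) ^ Suc m * (of_real ((a m)\<^sup>2) * \<theta> m x ^ 2)))"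
  txt \<open>The last three terms become resonant at \<open>u = -1\<close>, \<open>E u = -1\<close> and \<open>cnj E u = -1\<close>,
    which are not excluded. Their
    coefficients vanish there, so the factor \<open>\<zeta> - 1\<close> needed for summation by parts is available.\<close>
  have S1: "unif_summable K ?S1"
    by (intro unif_summable_second_order_nonres U res) (simp add: norm_power E1)
  have S2: "unif_summable K ?S2"
    by (intro unif_summable_second_order_nonres U cE) (simp add: norm_power E1)
  have S3: "unif_summable K ?S3"
    by (intro unif_summable_second_order_nonres U res u1)
  have S4: "unif_summable K ?S4"
    by (intro unif_summable_second_order_nonres U res Eu)
  have S5: "unif_summable K ?S5"
    by (intro unif_summable_second_order_nonres U res Eu)
  have S6: "unif_summable K ?S6"
    by (intro unif_summable_second_order U Eu)
  have S7: "unif_summable K ?S7"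
    by (intro unif_summable_second_order U Eu)
  have S8: "unif_summable K ?S8"
    by (intro unif_summable_second_order U Eu)
  note total = unif_summable_add[OF unif_summable_diff[OF unif_summable_diff[OF unif_summable_add[OF unif_summable_add[OF unif_summable_diff[OF unif_summable_diff[OF
      unif_summable_diff[OF unif_summable_err1 e2] C1] C2] A1] A2] B1] B2]
      unif_summable_add[OF unif_summable_add[OF unif_summable_add[OF unif_summable_add[OF unif_summable_add[OF unif_summable_add[OF unif_summable_add[OF S1 S2] S3] S4] S5] S6] S7] S8]]
  show ?thesis
  proof (rule unif_summable_cong[OF _ total])
    fix m x assume x: "x \<in> K"
    let ?e = "E ^ Suc m" and ?f = "cnj E ^ Suc m" and ?w = "u x ^ Suc m" and ?v = "cnj (u x) ^ Suc m"
    have EE: "E * cnj E = 1" "u x * cnj (u x) = 1"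
      using E1 u1[OF x] by (simp_all add: complex_norm_square[symmetric])
    then have ef: "?e * ?f = 1" "?w * ?v = 1" by (simp_all only: power_mult_distrib[symmetric] power_one)
    have nz: "E * u x - 1 \<noteq> 0" "cnj E * u x - 1 \<noteq> 0" using res(4,5)[OF x] d by auto
    have cc: "c1 x * (E * u x - 1) = 1" "c2 x * (cnj E * u x - 1) = 1"
      unfolding c1_def c2_def using nz by auto
    \<comment> \<open>This identity serves twice: it turns the non-oscillating coefficient into
      \<open>mu\<close>, and it exhibits the factor that \<open>?S6\<close> requires.\<close>
    have g12: "g1 x + g2 x - 1 = c1 x * c2 x * ((u x)\<^sup>2 - 1)"
      unfolding g1_def g2_def using cc EE(1) by algebra
    have g11: "g1 x - 1/2 = (c1 x)\<^sup>2 * (1/2) * ((E * u x)\<^sup>2 - 1)"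
      "g2 x - 1/2 = (c2 x)\<^sup>2 * (1/2) * ((cnj E * u x)\<^sup>2 - 1)"
    proof -
      have "2 * g1 x - 1 = (c1 x)\<^sup>2 * ((E * u x)\<^sup>2 - 1)" "2 * g2 x - 1 = (c2 x)\<^sup>2 * ((cnj E * u x)\<^sup>2 - 1)"
        unfolding g1_def g2_def using cc by algebra+
      moreover have "g - 1/2 = z * (1/2) * c" if "2 * g - 1 = z * c" for g z c :: complex
      proof -
        have "g - 1/2 = (2 * g - 1) / 2" by (simp add: field_simps)
        then show ?thesis by (simp add: that)
      qed
      ultimately show "g1 x - 1/2 = (c1 x)\<^sup>2 * (1/2) * ((E * u x)\<^sup>2 - 1)"
        "g2 x - 1/2 = (c2 x)\<^sup>2 * (1/2) * ((cnj E * u x)\<^sup>2 - 1)" by blast+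
    qed
    have mu': "mu x = (s x)\<^sup>2 * ((g1 x + g2 x - 1) * (p * cnj p))"
      unfolding mu[OF x] g12 c1_def c2_def using nz by (simp add: field_simps)
    have pw: "(E * u x) ^ Suc m = ?e * ?w" "(cnj E * u x) ^ Suc m = ?f * ?w"
      "(E\<^sup>2) ^ Suc m = ?e\<^sup>2" "((cnj E)\<^sup>2) ^ Suc m = ?f\<^sup>2" "((u x)\<^sup>2) ^ Suc m = ?w\<^sup>2"
      "(E\<^sup>2 * u x) ^ Suc m = ?e\<^sup>2 * ?w" "((cnj E)\<^sup>2 * u x) ^ Suc m = ?f\<^sup>2 * ?w"
      "((E * u x)\<^sup>2) ^ Suc m = ?e\<^sup>2 * ?w\<^sup>2" "((cnj E * u x)\<^sup>2) ^ Suc m = ?f\<^sup>2 * ?w\<^sup>2"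
      by (simp_all only: power_mult_distrib power_mult[symmetric] mult.commute[of 2])
    have last: "(s x)\<^sup>2 * (of_real (a m))\<^sup>2 * (- (p * g1 x * ?e + cnj p * g2 x * ?f) * ?w * (p * ?e + cnj p * ?f) * (2 * \<theta> m x - ?v - ?w * (\<theta> m x)\<^sup>2)
           - (p * ?e + cnj p * ?f)\<^sup>2 * (1 - ?w * \<theta> m x)\<^sup>2 / 2) - mu x * (of_real (a m))\<^sup>2 =
       ?S1 m x + ?S2 m x + ?S3 m x + ?S4 m x + ?S5 m x + ?S6 m x + ?S7 m x + ?S8 m x"
    proof -
      have S678: "((s x)\<^sup>2 * (c1 x * c2 x * (?p * ?p'))) * (((u x)\<^sup>2 - 1) * X) = (s x)\<^sup>2 * ((g1 x + g2 x - 1) * (?p * ?p')) * X"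
        "((s x)\<^sup>2 * ((c1 x)\<^sup>2 * (1/2) * ?p\<^sup>2)) * (((E * u x)\<^sup>2 - 1) * X) = (s x)\<^sup>2 * ((g1 x - 1/2) * ?p\<^sup>2) * X"
        "((s x)\<^sup>2 * ((c2 x)\<^sup>2 * (1/2) * ?p'\<^sup>2)) * (((cnj E * u x)\<^sup>2 - 1) * X) = (s x)\<^sup>2 * ((g2 x - 1/2) * ?p'\<^sup>2) * X" for X
        unfolding g12 g11 by simp_all
      show ?thesis
        unfolding S678 pw wkb_second_order_identity[OF ef] mu'
        by (simp only: power_0 power_one_right of_real_power mult_1_right) algebra
    qed
    have \<beta>': "\<beta> m = of_real (a m) * (p * ?e + cnj p * ?f)" by (simp add: \<beta>_def)
    note asm = wkb_assembly[OF cc g1_def[of x] g2_def[of x] \<beta>' D_def[of m x],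
        where r = "r m x" and s = "s x" and M = "mu x" and dt = "\<theta> (Suc m) x - \<theta> m x"]
    show "(r m x + s x * \<beta> m * (1 - u x ^ Suc m * \<theta> m x)) -
        1/2 * ((r m x)\<^sup>2 - (s x)\<^sup>2 * (\<beta> m)\<^sup>2 * (1 - u x ^ Suc m * \<theta> m x)\<^sup>2) -
        s x * ?p * (E ^ Suc m * of_real (a m)) - s x * ?p' * (cnj E ^ Suc m * of_real (a m)) +
        s x * ?p * c1 x * ((E * u x - 1) * ((E * u x) ^ Suc m * (of_real (a m) * \<theta> m x)) +
          E * u x * ((E * u x) ^ Suc m * (of_real (a m) * (\<theta> (Suc m) x - \<theta> m x)))) +
        s x * ?p' * c2 x * ((cnj E * u x - 1) * ((cnj E * u x) ^ Suc m * (of_real (a m) * \<theta> m x)) +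
          cnj E * u x * ((cnj E * u x) ^ Suc m * (of_real (a m) * (\<theta> (Suc m) x - \<theta> m x)))) -
        s x * ?p * g1 x * ((E * u x) ^ Suc m * (of_real (a m) * (\<theta> (Suc m) x - \<theta> m x - s x * \<beta> m * D m x))) -
        s x * ?p' * g2 x * ((cnj E * u x) ^ Suc m * (of_real (a m) * (\<theta> (Suc m) x - \<theta> m x - s x * \<beta> m * D m x))) +
       (?S1 m x + ?S2 m x + ?S3 m x + ?S4 m x + ?S5 m x + ?S6 m x + ?S7 m x + ?S8 m x)
        = r m x - (r m x)\<^sup>2 / 2 - mu x * of_real ((a m)\<^sup>2)"
      unfolding last[symmetric] unfolding pw(1,2) of_real_power asm ..
  qed
qed

text \<open>Each summand exponentiates to the ratio of consecutive \<open>\<alpha>\<close> times the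
  change of the growth factor, whatever branch \<open>Ln\<close> picks, so the partial sums give
  \<open>\<alpha>\<close> itself. The limit is an exponential and therefore has no zeros.\<close>

theorem wkb_limit:
  "\<exists>L. uniform_limit K (\<lambda>n x. \<alpha> n x * exp (- (mu x * of_real (h n)))) L sequentially \<and> (\<forall>x\<in>K. L x \<noteq> 0)"
proof -
  let ?t = "\<lambda>m x. Ln (1 + r m x) - mu x * of_real (h (Suc m) - h m)"
  have "unif_summable K ?t"
    by (rule unif_summable_cong[OF _ unif_summable_add[OF unif_summable_add[OF unif_summable_Ln unif_summable_main] unif_summable_h]]) (simp add: algebra_simps)
  then obtain T where T: "uniform_limit K (\<lambda>n x. \<Sum>m<n. ?t m x) T sequentially"
    unfolding unif_summable_def uniformly_convergent_on_def by blast
  have e: "exp (\<Sum>m<n. ?t m x) = \<alpha> n x * exp (- (mu x * of_real (h n)))" if x: "x \<in> K" for n x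
  proof (induction n)
    case 0
    then show ?case using gamma by (simp add: \<alpha>0[OF x] h_def)
  next
    case (Suc n)
    have "exp (?t n x) = (1 + r n x) * exp (- (mu x * of_real (h (Suc n) - h n)))"
      by (simp only: exp_diff exp_minus exp_Ln[OF inv_1r(1)[OF x]] divide_inverse)
    moreover have "exp (- (mu x * of_real (h (Suc n)))) =
        exp (- (mu x * of_real (h n))) * exp (- (mu x * of_real (h (Suc n) - h n)))"
      unfolding exp_add[symmetric] by (simp add: algebra_simps)
    ultimately show ?case
      unfolding sum.lessThan_Suc exp_add Suc \<alpha>_ratio[OF x] by simp
  qed
  \<comment> \<open>A crude bound for each fixed n, as \<open>uniform_limit_exp\<close>
    requires.\<close>
  have ub: "unif_bounded K (\<alpha> n)" for n
  proof (induction n)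
    case 0
    then show ?case unfolding unif_bounded_def by (auto simp: \<alpha>0)
  next
    case (Suc n)
    have "unif_bounded K (r n)"
      unfolding unif_bounded_def by (intro exI[of _ "2 * S * \<bar>b n\<bar>"]) (auto intro: r_le')
    then have "unif_bounded K (\<lambda>x. \<alpha> n x * (1 + r n x))" by (intro unif_bounded_intros Suc)
    then show ?case unfolding unif_bounded_def by (auto simp: \<alpha>_ratio)
  qed
  have "uniform_limit K (\<lambda>n x. exp (\<Sum>m<n. ?t m x)) (\<lambda>x. exp (T x)) sequentially"
  proof (rule uniform_limit_exp[OF T])
    fix n
    have "unif_bounded K (\<lambda>x. \<alpha> n x * exp (- (mu x * of_real (h n))))"
      by (intro unif_bounded_intros ub unif_bounded_mu)
    then show "\<exists>B. \<forall>x\<in>K. cmod (exp (\<Sum>m<n. ?t m x)) \<le> B"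
      unfolding unif_bounded_def using e by auto
  qed
  then have "uniform_limit K (\<lambda>n x. \<alpha> n x * exp (- (mu x * of_real (h n)))) (\<lambda>x. exp (T x)) sequentially"
    by (rule uniform_limit_cong[THEN iffD1, rotated -1]) (auto simp: e simp del: of_real_diff)
  then show ?thesis by (intro exI[of _ "\<lambda>x. exp (T x)"]) simp
qed

end

section \<open>Orthogonal polynomials and Bernstein--Szego weights\<close>

text \<open>Cauchy's theorem on a half disc: the integral over the segment is minus that over the
  arc, where \<open>R z\<close> is close to \<open>c / z\<close> and contributes
  \<open>\<i> * pi * c\<close>.\<close>

lemma half_plane_integral_limit:
  fixes R :: "complex \<Rightarrow> complex" and c :: complex
  assumes cont: "continuous_on {z. Im z \<ge> 0} R"
    and diff: "\<And>z. Im z > 0 \<Longrightarrow> R field_differentiable at z"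
    and lim: "((\<lambda>z. z * R z) \<longlongrightarrow> c) at_infinity"
  shows "((\<lambda>T. integral {-T..T} (\<lambda>x. R (of_real x))) \<longlongrightarrow> - (\<i> * pi * c)) at_top"
proof (rule tendstoI)
  fix e :: real assume e: "e > 0"
  \<comment> \<open>The arc has angular length pi, so this tolerance costs at most e/2.\<close>
  have "e / (2 * pi) > 0" using e by simp
  from tendstoD[OF lim this] obtain T0
    where T0: "\<And>z. cmod z \<ge> T0 \<Longrightarrow> dist (z * R z) c < e / (2 * pi)"
    unfolding eventually_at_infinity by blast
  show "\<forall>\<^sub>F T in at_top. dist (integral {-T..T} (\<lambda>x. R (of_real x))) (- (\<i> * pi * c)) < e"
    using eventually_ge_at_top[of T0] eventually_gt_at_top[of 0]
  proof eventually_elim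
    case (elim T)
    let ?A = "part_circlepath 0 T 0 pi" and ?L = "linepath (complex_of_real (-T)) (complex_of_real T)"
    have fin: "pathfinish ?L = pathstart ?A" "pathfinish ?A = pathstart ?L"
      by (auto simp: cis_conv_exp[symmetric])
    have vp: "valid_path (?L +++ ?A)" using fin by (intro valid_path_join) auto
    have imA: "path_image ?A \<subseteq> {z. Im z \<ge> 0}"
    proof
      fix z assume "z \<in> path_image ?A"
      then obtain t where "t \<in> {0..pi}" "z = of_real T * cis t"
        by (auto simp: path_image_part_circlepath cis_conv_exp mult.commute)
      then show "z \<in> {z. Im z \<ge> 0}" using elim by (auto intro!: mult_nonneg_nonneg sin_ge_zero)
    qed
    have imL: "path_image ?L \<subseteq> {z. Im z \<ge> 0}"
      by (auto simp: closed_segment_def)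
    have cvx: "convex {z. Im z \<ge> 0}" by (rule convex_halfspace_Im_ge)
    have int: "interior {z. Im z \<ge> 0} = {z. Im z > 0}"
      using interior_halfspace_ge[of \<i> 0] by (simp add: inner_complex_def)
    have 0: "(R has_contour_integral 0) (?L +++ ?A)"
      by (rule Cauchy_theorem_convex[OF cont cvx, of "{}"])
        (use vp fin imA imL path_image_join[OF fin(1)] diff in \<open>auto simp: int\<close>)
    have ciL: "R contour_integrable_on ?L" "R contour_integrable_on ?A"
      using 0 fin by (auto simp: has_contour_integral_integrable contour_integrable_join
          valid_path_imp_path dest!: has_contour_integral_integrable)
    then have "contour_integral ?L R + contour_integral ?A R = 0"
      using contour_integral_unique[OF 0] contour_integral_join[OF ciL] by auto
    moreover have "contour_integral ?L R = integral {-T..T} (\<lambda>x. R (of_real x))"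
      using contour_integral_linepath_Reals_eq[of "of_real (-T)" "of_real T" R] elim by auto
    ultimately have L: "integral {-T..T} (\<lambda>x. R (of_real x)) = - contour_integral ?A R" 
      by (simp add: eq_neg_iff_add_eq_0)
    let ?g = "\<lambda>t. R (0 + T * cis t) * T * \<i> * cis t"
    have g1: "(?g has_integral contour_integral ?A R) {0..pi}"
      using has_contour_integral_integral[OF ciL(2)]
      by (subst (asm) has_contour_integral_part_circlepath_iff) auto
    have "((\<lambda>t. \<i> * c) has_integral of_real pi * (\<i> * c)) {0..pi}"
      using has_integral_const_real[of "\<i> * c" 0 pi] by (simp add: scaleR_conv_of_real)
    from has_integral_diff[OF g1 this]
    have d: "((\<lambda>t. ?g t - \<i> * c) has_integral (contour_integral ?A R - of_real pi * (\<i> * c))) {0..pi}" .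
    have "cmod (contour_integral ?A R - of_real pi * (\<i> * c)) \<le> e / (2 * pi) * measure lborel (cbox 0 pi)"
    proof (rule has_integral_bound[OF _ d[folded cbox_interval]])
      show "0 \<le> e / (2 * pi)" using e by simp
      fix t :: real
      have "cmod (of_real T * cis t) \<ge> T0" using elim by (simp add: norm_mult)
      from T0[OF this] have "dist (of_real T * cis t * R (of_real T * cis t)) c < e / (2 * pi)" .
      moreover have "?g t - \<i> * c = \<i> * (of_real T * cis t * R (of_real T * cis t) - c)"
        by (simp add: algebra_simps)
      ultimately show "cmod (?g t - \<i> * c) \<le> e / (2 * pi)"
        by (simp only: norm_mult dist_norm) simp
    qed
    also have "\<dots> < e" using e by (simp add: cbox_interval)
    finally show ?case
      unfolding L dist_norm by (simp add: norm_minus_commute mult_ac)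
  qed
qed

text \<open>The half plane limit is only a principal value. Positivity upgrades it to an integral by
  monotone convergence, which serves the diagonal case; for mixed products, which have no fixed
  sign, integrability is supplied from outside.\<close>

lemma half_plane_Im_integral:
  fixes R :: "complex \<Rightarrow> complex" and a :: real
  assumes cont: "continuous_on {z. Im z \<ge> 0} R"
    and diff: "\<And>z. Im z > 0 \<Longrightarrow> R field_differentiable at z"
    and lim: "((\<lambda>z. z * R z) \<longlongrightarrow> - of_real a) at_infinity"
  shows "(\<lambda>n. \<integral>x. Im (R (of_real x)) * indicator {- real n..real n} x \<partial>lborel) \<longlonglongrightarrow> pi * a"
    and "(\<And>x. Im (R (of_real x)) \<ge> 0) \<Longrightarrow> has_bochner_integral lborel (\<lambda>x. Im (R (of_real x))) (pi * a)"
    and "integrable lborel (\<lambda>x. Im (R (of_real x))) \<Longrightarrow> (\<integral>x. Im (R (of_real x)) \<partial>lborel) = pi * a"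
proof -
  have contR: "continuous_on UNIV (\<lambda>x::real. R (of_real x))"
    by (rule continuous_on_compose2[OF cont]) (auto intro!: continuous_intros)
  then have contI: "continuous_on UNIV (\<lambda>x::real. Im (R (of_real x)))"
    by (intro continuous_intros)
  then have meas [measurable]: "(\<lambda>x::real. Im (R (of_real x))) \<in> borel_measurable borel"
    by (rule borel_measurable_continuous_onI)
  have sint: "set_integrable lborel {- real n..real n} (\<lambda>x. Im (R (of_real x)))" for n
    by (intro borel_integrable_atLeastAtMost' continuous_on_subset[OF contI]) auto
  have eq: "(\<integral>x. Im (R (of_real x)) * indicator {- real n..real n} x \<partial>lborel)
      = Im (integral {- real n..real n} (\<lambda>x. R (of_real x)))" for n
  proof -
    have "(\<integral>x. Im (R (of_real x)) * indicator {- real n..real n} x \<partial>lborel)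
        = (LINT x:{- real n..real n}|lborel. Im (R (of_real x)))"
      unfolding set_lebesgue_integral_def by (simp add: mult.commute)
    also have "\<dots> = integral {- real n..real n} (\<lambda>x. Im (R (of_real x)))"
      by (rule set_borel_integral_eq_integral(2)[OF sint])
    also have "\<dots> = Im (integral {- real n..real n} (\<lambda>x. R (of_real x)))"
      by (rule integral_linear[OF _ bounded_linear_Im, unfolded o_def])
         (intro integrable_continuous_real continuous_on_subset[OF contR], auto)
    finally show ?thesis .
  qed
  have "(\<lambda>n. integral {- real n..real n} (\<lambda>x. R (of_real x))) \<longlonglongrightarrow> - (\<i> * pi * (- of_real a))"
    using filterlim_compose[OF half_plane_integral_limit[OF cont diff lim] filterlim_real_sequentially] .
  from tendsto_Im[OF this] show *: "(\<lambda>n. \<integral>x. Im (R (of_real x)) * indicator {- real n..real n} x \<partial>lborel) \<longlonglongrightarrow> pi * a"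
    unfolding eq by simp
  have ev: "(\<lambda>n. Im (R (of_real x)) * indicator {- real n..real n} x) \<longlonglongrightarrow> Im (R (of_real x))" for x
  proof (rule tendsto_eventually)
    obtain N where "\<bar>x\<bar> \<le> real N" using real_arch_simple by blast
    then show "\<forall>\<^sub>F n in sequentially. Im (R (of_real x)) * indicator {- real n..real n} x = Im (R (of_real x))"
      by (intro eventually_sequentiallyI[of N]) (auto simp: indicator_def)
  qed
  show "has_bochner_integral lborel (\<lambda>x. Im (R (of_real x))) (pi * a)" if pos: "\<And>x. Im (R (of_real x)) \<ge> 0"
  proof (rule has_bochner_integral_monotone_convergence[OF _ _ _ *])
    show "integrable lborel (\<lambda>x. Im (R (complex_of_real x)) * indicat_real {- real n..real n} x)" for n
      using sint[of n] unfolding set_integrable_def by (simp add: mult.commute)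
    show "AE x in lborel. mono (\<lambda>n. Im (R (complex_of_real x)) * indicat_real {- real n..real n} x)"
      using pos by (auto simp: mono_def indicator_def)
  qed (use ev in auto)
  show "(\<integral>x. Im (R (of_real x)) \<partial>lborel) = pi * a" if int: "integrable lborel (\<lambda>x. Im (R (of_real x)))"
  proof (rule LIMSEQ_unique[OF _ *])
    show "(\<lambda>n. \<integral>x. Im (R (of_real x)) * indicator {- real n..real n} x \<partial>lborel) \<longlonglongrightarrow> (\<integral>x. Im (R (of_real x)) \<partial>lborel)"
      by (rule integral_dominated_convergence[where w = "\<lambda>x. \<bar>Im (R (of_real x))\<bar>"])
         (use int ev in \<open>auto simp: indicator_def\<close>)
  qed
qed

section \<open>Polynomials of the first and second kind\<close>

lemma P_poly_rec: "P_poly b (Suc (Suc n)) z = (z - of_real (b (Suc n))) * P_poly b (Suc n) z - P_poly b n z"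
  by (cases n) auto

lemma Q_poly_rec: "n \<ge> 1 \<Longrightarrow> Q_poly b (Suc (Suc n)) z = (z - of_real (b (Suc n))) * Q_poly b (Suc n) z - Q_poly b n z"
  by (cases n) auto

definition P_real :: "(nat \<Rightarrow> real) \<Rightarrow> nat \<Rightarrow> real \<Rightarrow> real" where
  "P_real b n x = Re (P_poly b n (of_real x))"

lemma P_poly_of_real: "P_poly b n (of_real x) = of_real (P_real b n x)"
proof -
  have "P_poly b n (of_real x) \<in> \<real>"
    by (induction b n "of_real x :: complex" rule: P_poly.induct) auto
  then show ?thesis unfolding P_real_def by (simp add: complex_is_Real_iff complex_eq_iff)
qed

lemma Q_poly_real: "Q_poly b n (of_real x) \<in> \<real>"
  by (induction b n "of_real x :: complex" rule: Q_poly.induct) auto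

lemma P_real_simps [simp]: "P_real b 0 x = 0" "P_real b (Suc 0) x = 1"
  by (auto simp: P_real_def)

lemma P_real_rec: "P_real b (Suc (Suc n)) x = (x - b (Suc n)) * P_real b (Suc n) x - P_real b n x"
proof -
  have "complex_of_real (P_real b (Suc (Suc n)) x) =
      of_real ((x - b (Suc n)) * P_real b (Suc n) x - P_real b n x)"
    unfolding P_poly_of_real[symmetric] P_poly_rec by (simp add: P_poly_of_real)
  then show ?thesis by (simp only: of_real_eq_iff)
qed

lemma P_poly_differentiable: "P_poly b n field_differentiable at z"
proof -
  have "P_poly b n field_differentiable at z \<and> P_poly b (Suc n) field_differentiable at z"
  proof (induction n)
    case 0
    have "P_poly b 0 = (\<lambda>_. 0)" "P_poly b (Suc 0) = (\<lambda>_. 1)" by (auto simp: fun_eq_iff)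
    then show ?case by simp
  next
    case (Suc n)
    have "P_poly b (Suc (Suc n)) = (\<lambda>z. (z - of_real (b (Suc n))) * P_poly b (Suc n) z - P_poly b n z)"
      by (auto simp: fun_eq_iff P_poly_rec simp del: P_poly.simps)
    then show ?case using Suc by (auto intro!: derivative_intros)
  qed
  then show ?thesis ..
qed

lemma Q_poly_differentiable: "Q_poly b n field_differentiable at z"
proof (cases n)
  case 0
  have "Q_poly b 0 = (\<lambda>_. 0)" by (auto simp: fun_eq_iff)
  then show ?thesis using 0 by simp
next
  case (Suc m)
  have "Q_poly b (Suc m) field_differentiable at z \<and> Q_poly b (Suc (Suc m)) field_differentiable at z"
  proof (induction m)
    case 0
    have "Q_poly b (Suc 0) = (\<lambda>_. 0)" "Q_poly b (Suc (Suc 0)) = (\<lambda>_. 1)" by (auto simp: fun_eq_iff)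
    then show ?case by simp
  next
    case (Suc m)
    have "Q_poly b (Suc (Suc (Suc m))) = (\<lambda>z. (z - of_real (b (Suc (Suc m)))) * Q_poly b (Suc (Suc m)) z - Q_poly b (Suc m) z)"
      by (auto simp: fun_eq_iff)
    then show ?case using Suc by (auto intro!: derivative_intros)
  qed
  then show ?thesis using Suc by simp
qed

lemma continuous_on_P_poly [continuous_intros]: "continuous_on A f \<Longrightarrow> continuous_on A (\<lambda>x. P_poly b n (f x))"
  by (rule continuous_on_compose2[of UNIV "P_poly b n"])
     (auto intro!: continuous_at_imp_continuous_on field_differentiable_imp_continuous_at P_poly_differentiable)

lemma continuous_on_P_real: "continuous_on A f \<Longrightarrow> continuous_on A (\<lambda>x. P_real b n (f x))"
  unfolding P_real_def by (intro continuous_intros)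

lemma isCont_P_real: "isCont (P_real b n) x"
  using continuous_on_P_real[of UNIV "\<lambda>x. x" b n] by (simp add: continuous_on_eq_continuous_at)

lemma P_real_measurable [measurable]: "P_real b n \<in> borel_measurable borel"
  using continuous_on_P_real[of UNIV "\<lambda>x. x" b n] by (intro borel_measurable_continuous_onI) auto

lemma wronskian:
  "n \<ge> 1 \<Longrightarrow> P_poly b n z * Q_poly b (Suc n) z - P_poly b (Suc n) z * Q_poly b n z = 1"
proof (induction n rule: dec_induct)
  case (step n)
  then show ?case by (simp add: P_poly_rec Q_poly_rec algebra_simps del: P_poly.simps(3,4) Q_poly.simps(3,4))
qed auto

text \<open>For n \<ge> 1, the characteristic polynomial of the n by n truncation with
  \<open>b n\<close> replaced by \<open>b n - w\<close>. For \<open>Im w > 0\<close> this matrix is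
  dissipative, whence all zeros lie in the open lower half plane.\<close>

definition boundary_poly :: "(nat \<Rightarrow> real) \<Rightarrow> complex \<Rightarrow> nat \<Rightarrow> complex \<Rightarrow> complex" where
  "boundary_poly b w n z = P_poly b (Suc n) z + w * P_poly b n z"

text \<open>Discrete Lagrange identity: by the recurrence each step adds
  \<open>Im z * (cmod (P_poly b (Suc n) z))\<^sup>2\<close>.\<close>

lemma Im_P_poly_Suc_cnj: "Im z \<ge> 0 \<Longrightarrow> Im (P_poly b (Suc n) z * cnj (P_poly b n z)) \<ge> 0"
proof (induction n)
  case (Suc n)
  have "P_poly b (Suc (Suc n)) z * cnj (P_poly b (Suc n) z)
      = (z - of_real (b (Suc n))) * of_real ((cmod (P_poly b (Suc n) z))\<^sup>2) - P_poly b n z * cnj (P_poly b (Suc n) z)"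
    unfolding P_poly_rec complex_norm_square by (simp add: algebra_simps)
  moreover have "Im ((z - of_real (b (Suc n))) * of_real ((cmod (P_poly b (Suc n) z))\<^sup>2))
      = Im z * (cmod (P_poly b (Suc n) z))\<^sup>2"
    by (simp del: of_real_power)
  ultimately have "Im (P_poly b (Suc (Suc n)) z * cnj (P_poly b (Suc n) z)) =
      Im z * (cmod (P_poly b (Suc n) z))\<^sup>2 + Im (P_poly b (Suc n) z * cnj (P_poly b n z))"
    by (simp only: minus_complex.simps) simp
  then show ?case using Suc by simp
qed simp

lemma P_poly_consecutive_nonzero: "P_poly b (Suc n) z \<noteq> 0 \<or> P_poly b n z \<noteq> 0"
proof (induction n)
  case (Suc n)
  then show ?case unfolding P_poly_rec by auto
qed simp

text \<open>At a zero, \<open>P_poly b (Suc n) z / P_poly b n z\<close> would equal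
  \<open>- w\<close>, in the open lower half plane, whereas the Lagrange identity puts it in the
  closed upper one.\<close>

lemma boundary_poly_nonzero:
  assumes "Im z \<ge> 0" "Im w > 0"
  shows "boundary_poly b w n z \<noteq> 0"
proof
  assume "boundary_poly b w n z = 0"
  then have e: "P_poly b (Suc n) z = - w * P_poly b n z"
    unfolding boundary_poly_def by (simp add: eq_neg_iff_add_eq_0)
  have "P_poly b (Suc n) z * cnj (P_poly b n z) = - w * of_real ((cmod (P_poly b n z))\<^sup>2)"
    unfolding e complex_norm_square by simp
  then have "Im (P_poly b (Suc n) z * cnj (P_poly b n z)) = - (Im w * (cmod (P_poly b n z))\<^sup>2)" by simp
  with Im_P_poly_Suc_cnj[OF assms(1), of b n] have "Im w * (cmod (P_poly b n z))\<^sup>2 \<le> 0" by simp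
  then have "P_poly b n z = 0" using assms(2) by (simp add: mult_le_0_iff)
  with e P_poly_consecutive_nonzero[of b n z] show False by simp
qed

lemma tendsto_eventually_eqI:
  "(f \<longlongrightarrow> a) F \<Longrightarrow> a = b \<Longrightarrow> eventually (\<lambda>x. f x = g x) F \<Longrightarrow> (g \<longlongrightarrow> b) F"
  by (auto intro: Lim_transform_eventually)

lemma P_poly_asymp:
  "((\<lambda>z. P_poly b (Suc n) z / z ^ n) \<longlongrightarrow> 1) at_infinity \<and> ((\<lambda>z. P_poly b n z / z ^ n) \<longlongrightarrow> 0) at_infinity"
proof (induction n)
  case (Suc n)
  have nz: "\<forall>\<^sub>F z in at_infinity. z \<noteq> (0::complex)" by (rule eventually_not_equal_at_infinity)
  have "((\<lambda>z. (1 - of_real (b (Suc n)) * inverse z) * (P_poly b (Suc n) z / z ^ n)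
      - (P_poly b n z / z ^ n) * inverse z) \<longlongrightarrow> (1 - of_real (b (Suc n)) * 0) * 1 - 0 * 0) at_infinity"
    using Suc by (intro tendsto_intros tendsto_inverse_0) auto
  then have "((\<lambda>z. P_poly b (Suc (Suc n)) z / z ^ Suc n) \<longlongrightarrow> 1) at_infinity"
    by (rule tendsto_eventually_eqI) 
      (use nz in \<open>auto elim!: eventually_mono simp: P_poly_rec field_simps simp del: P_poly.simps(3,4)\<close>)
  moreover have "((\<lambda>z. (P_poly b (Suc n) z / z ^ n) * inverse z) \<longlongrightarrow> 1 * 0) at_infinity"
    using Suc by (intro tendsto_intros tendsto_inverse_0) auto
  then have "((\<lambda>z. P_poly b (Suc n) z / z ^ Suc n) \<longlongrightarrow> 0) at_infinity"
    by (simp add: divide_inverse mult_ac)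
  ultimately show ?case by blast
qed simp

lemma boundary_poly_asymp: "((\<lambda>z. boundary_poly b w n z / z ^ n) \<longlongrightarrow> 1) at_infinity"
proof -
  have "((\<lambda>z. P_poly b (Suc n) z / z ^ n + w * (P_poly b n z / z ^ n)) \<longlongrightarrow> 1 + w * 0) at_infinity"
    using P_poly_asymp[of b n] by (intro tendsto_intros) auto
  then show ?thesis unfolding boundary_poly_def by (simp add: add_divide_distrib)
qed

text \<open>The solution of the recurrence satisfying the boundary condition \<open>y\<^sub>n\<^sub>+\<^sub>1 + w y\<^sub>n = 0\<close>.\<close>

definition boundary_solution :: "(nat \<Rightarrow> real) \<Rightarrow> complex \<Rightarrow> nat \<Rightarrow> nat \<Rightarrow> complex \<Rightarrow> complex" where
  "boundary_solution b w n k z = Q_poly b k z * boundary_poly b w n z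
     - P_poly b k z * (Q_poly b (Suc n) z + w * Q_poly b n z)"

lemma boundary_solution_end:
  assumes "n \<ge> 1"
  shows "boundary_solution b w n n z = -1" "boundary_solution b w n (Suc n) z = w"
  using wronskian[OF assms, of b z] unfolding boundary_solution_def boundary_poly_def by algebra+

lemma boundary_solution_rec:
  "k \<ge> 1 \<Longrightarrow> boundary_solution b w n (Suc (Suc k)) z
     = (z - of_real (b (Suc k))) * boundary_solution b w n (Suc k) z - boundary_solution b w n k z"
  unfolding boundary_solution_def P_poly_rec by (simp add: Q_poly_rec algebra_simps)

text \<open>Degree and leading coefficient, by downward induction from the end values -1 and
  \<open>w\<close>; \<open>j\<close> is the distance from index n. The second conjunct only carries
  the induction.\<close>

lemma boundary_solution_asymp:
  assumes "j < n"
  shows "((\<lambda>z. boundary_solution b w n (n - j) z / z ^ j) \<longlongrightarrow> -1) at_infinity \<and>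
    ((\<lambda>z. boundary_solution b w n (Suc (n - j)) z / z ^ Suc j) \<longlongrightarrow> 0) at_infinity"
  using assms
proof (induction j)
  case 0
  have "((\<lambda>z. w * inverse z) \<longlongrightarrow> w * 0) at_infinity"
    by (intro tendsto_intros tendsto_inverse_0)
  then show ?case using 0 by (simp add: boundary_solution_end divide_inverse)
next
  case (Suc j)
  let ?y = "boundary_solution b w n"
  have nz: "\<forall>\<^sub>F z in at_infinity. z \<noteq> (0::complex)" by (rule eventually_not_equal_at_infinity)
  define k where "k = n - Suc j"
  have k: "k \<ge> 1" "n - j = Suc k" using Suc.prems by (auto simp: k_def)
  have IH: "((\<lambda>z. ?y (Suc k) z / z ^ j) \<longlongrightarrow> -1) at_infinity" "((\<lambda>z. ?y (Suc (Suc k)) z / z ^ Suc j) \<longlongrightarrow> 0) at_infinity"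
    using Suc k by auto
  have "((\<lambda>z. (1 - of_real (b (Suc k)) * inverse z) * (?y (Suc k) z / z ^ j) - ?y (Suc (Suc k)) z / z ^ Suc j)
      \<longlongrightarrow> (1 - of_real (b (Suc k)) * 0) * (-1) - 0) at_infinity"
    by (intro tendsto_intros tendsto_inverse_0 IH)
  then have "((\<lambda>z. ?y k z / z ^ Suc j) \<longlongrightarrow> -1) at_infinity"
    by (rule tendsto_eventually_eqI) 
      (use nz in \<open>auto elim!: eventually_mono simp: boundary_solution_rec[OF k(1)] field_simps\<close>)
  moreover have "((\<lambda>z. (?y (Suc k) z / z ^ j) * inverse z * inverse z) \<longlongrightarrow> -1 * 0 * 0) at_infinity"
    by (intro tendsto_intros tendsto_inverse_0 IH)
  then have "((\<lambda>z. ?y (Suc k) z / z ^ Suc (Suc j)) \<longlongrightarrow> 0) at_infinity"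
    by (simp add: divide_inverse mult_ac)
  ultimately show ?case unfolding k_def[symmetric] by blast
qed

text \<open>On the real line all polynomials are real, so the imaginary part comes from the quotient
  \<open>(Q_poly b (Suc n) z + w * Q_poly b n z) / boundary_poly b w n z\<close> alone; the
  Wronskian evaluates it.\<close>

lemma Im_boundary_quotient:
  assumes n: "n \<ge> 1" and w: "Im w > 0"
  shows "Im (P_poly b j (of_real x) * boundary_solution b w n k (of_real x) / boundary_poly b w n (of_real x))
    = Im w / (cmod (boundary_poly b w n (of_real x)))\<^sup>2 * (P_real b j x * P_real b k x)"
proof -
  let ?z = "complex_of_real x"
  define D where "D = boundary_poly b w n ?z"
  have D: "D \<noteq> 0" unfolding D_def using w by (intro boundary_poly_nonzero) auto
  obtain p p' where p: "P_poly b n ?z = of_real p" "P_poly b (Suc n) ?z = of_real p'"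
    unfolding P_poly_of_real by blast
  obtain q where q: "Q_poly b n ?z = of_real q" using Q_poly_real[of b n x] by (auto elim: Reals_cases)
  obtain q' where q': "Q_poly b (Suc n) ?z = of_real q'" using Q_poly_real[of b "Suc n" x] by (auto elim: Reals_cases)
  obtain qk where qk: "Q_poly b k ?z = of_real qk" using Q_poly_real[of b k x] by (auto elim: Reals_cases)
  have "complex_of_real (p * q' - p' * q) = 1" using wronskian[OF n, of b ?z] unfolding p q q' by simp
  then have W: "p * q' - p' * q = 1" by (metis of_real_eq_1_iff)
  let ?N = "complex_of_real q' + w * of_real q"
  have ND: "?N / D = ?N * cnj D / of_real ((cmod D)\<^sup>2)"
    by (rule complex_div_cnj)
  have "Im (?N * cnj D) = - Im w * (p * q' - p' * q)"
    unfolding D_def boundary_poly_def p by (simp add: algebra_simps)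
  then have Im: "Im (?N / D) = - (Im w / (cmod D)\<^sup>2)" unfolding ND W by (simp only: Im_divide_of_real)
  have eq: "P_poly b j ?z * boundary_solution b w n k ?z / boundary_poly b w n ?z
      = of_real (P_real b j x) * (of_real qk - of_real (P_real b k x) * (?N / D))"
    unfolding boundary_solution_def q q' qk D_def[symmetric] P_poly_of_real using D by (simp add: field_simps)
  have gen: "Im (of_real A * (of_real qk - of_real B * X)) = - Im X * (A * B)" for A B and X :: complex
    by simp
  show ?thesis unfolding eq gen Im unfolding D_def[symmetric] by simp
qed

text \<open>The spectral density obtained when the part of the matrix beyond index \<open>n\<close> is replaced by a
  half-line with constant Weyl function \<open>w\<close>; it therefore has the right moments up to order \<open>2 n - 2\<close>.\<close>

definition bs_density :: "(nat \<Rightarrow> real) \<Rightarrow> complex \<Rightarrow> nat \<Rightarrow> real \<Rightarrow> real" where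
  "bs_density b w n x = Im w / (pi * (cmod (boundary_poly b w n (of_real x)))\<^sup>2)"

lemma continuous_on_boundary_poly [continuous_intros]:
  "continuous_on A f \<Longrightarrow> continuous_on A (\<lambda>x. boundary_poly b w n (f x))"
  unfolding boundary_poly_def by (intro continuous_intros)

lemma bs_density_nonneg: "Im w > 0 \<Longrightarrow> bs_density b w n x \<ge> 0"
  unfolding bs_density_def by simp

lemma bs_density_measurable [measurable]: "bs_density b w n \<in> borel_measurable borel"
proof -
  have [measurable]: "(\<lambda>x. cmod (boundary_poly b w n (complex_of_real x))) \<in> borel_measurable borel"
    by (intro borel_measurable_continuous_onI continuous_intros)
  show ?thesis unfolding bs_density_def[abs_def] by measurable
qed

text \<open>\<open>R\<close> is the (j, k) entry of the resolvent of the truncation with last entry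
  \<open>b n - w\<close>. Counting degrees gives the limit of \<open>z * R z\<close>, and the form
  \<open>P_poly b j z * boundary_solution b w n k z\<close> of the entry is the one valid for
  \<open>j \<le> k\<close>.\<close>

lemma boundary_quotient_properties:
  fixes b :: "nat \<Rightarrow> real"
  assumes n: "n \<ge> 1" and w: "Im w > 0" and jk: "1 \<le> j" "j \<le> k" "k \<le> n"
  defines "R \<equiv> \<lambda>z. P_poly b j z * boundary_solution b w n k z / boundary_poly b w n z"
  shows "continuous_on {z. Im z \<ge> 0} R"
    and "\<And>z. Im z > 0 \<Longrightarrow> R field_differentiable at z"
    and "((\<lambda>z. z * R z) \<longlongrightarrow> - of_real (if j = k then 1 else 0)) at_infinity"
    and "Im (R (of_real x)) = pi * (bs_density b w n x * (P_real b j x * P_real b k x))"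
proof -
  have fd: "R field_differentiable at z" if "Im z \<ge> 0" for z
  proof -
    have bp: "boundary_poly b w n = (\<lambda>z. P_poly b (Suc n) z + w * P_poly b n z)"
      by (auto simp: fun_eq_iff boundary_poly_def)
    have "boundary_poly b w n field_differentiable at z"
      unfolding bp by (intro field_differentiable_add field_differentiable_mult P_poly_differentiable field_differentiable_const)
    then show ?thesis
      unfolding R_def boundary_solution_def
      using boundary_poly_nonzero[OF that w, of b n]
      by (intro field_differentiable_divide field_differentiable_diff field_differentiable_mult
           field_differentiable_add P_poly_differentiable Q_poly_differentiable field_differentiable_const) auto
  qed
  then show "continuous_on {z. Im z \<ge> 0} R" "\<And>z. Im z > 0 \<Longrightarrow> R field_differentiable at z"
    by (auto intro!: continuous_at_imp_continuous_on field_differentiable_imp_continuous_at)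
  obtain i where i: "j = Suc i" using jk by (cases j) auto
  have nz: "\<forall>\<^sub>F z in at_infinity. z \<noteq> (0::complex)" by (rule eventually_not_equal_at_infinity)
  have y: "((\<lambda>z. boundary_solution b w n k z / z ^ (n - k)) \<longlongrightarrow> -1) at_infinity"
    using boundary_solution_asymp[of "n - k" n b w] jk by auto
  have pw: "((\<lambda>z::complex. inverse z ^ (k - j)) \<longlongrightarrow> (if j = k then 1 else 0)) at_infinity"
  proof (cases "j = k")
    case False
    then have "k - j \<noteq> 0" using jk by simp
    then show ?thesis using False tendsto_power[OF tendsto_inverse_0, of "k - j"]
      by (simp add: power_0_left)
  qed simp
  have "((\<lambda>z. inverse z ^ (k - j) * ((P_poly b (Suc i) z / z ^ i) * (boundary_solution b w n k z / z ^ (n - k)) /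
      (boundary_poly b w n z / z ^ n))) \<longlongrightarrow> (if j = k then 1 else 0) * (1 * (-1) / 1)) at_infinity"
    using P_poly_asymp[of b i] by (intro tendsto_intros pw y boundary_poly_asymp) auto
  then have "((\<lambda>z. z * R z) \<longlongrightarrow> (if j = k then 1 else 0) * (1 * (-1) / 1)) at_infinity"
  proof (rule Lim_transform_eventually)
    show "\<forall>\<^sub>F z in at_infinity. inverse z ^ (k - j) * ((P_poly b (Suc i) z / z ^ i) * (boundary_solution b w n k z / z ^ (n - k)) /
      (boundary_poly b w n z / z ^ n)) = z * R z"
      using nz
    proof eventually_elim
      case (elim z)
      \<comment> \<open>Degree count: \<open>j = Suc i\<close>, so the numerator has degree
        \<open>i + (n - k)\<close>.\<close>
      have "n = (k - j) + i + (n - k) + 1" using jk i by simp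
      then have zn: "z ^ n = z ^ (k - j) * z ^ i * z ^ (n - k) * z"
        by (metis power_add power_one_right)
      show ?case unfolding R_def i zn using elim by (simp add: field_simps)
    qed
  qed
  then show "((\<lambda>z. z * R z) \<longlongrightarrow> - of_real (if j = k then 1 else 0)) at_infinity"
    by (cases "j = k") auto
  show "Im (R (of_real x)) = pi * (bs_density b w n x * (P_real b j x * P_real b k x))"
    unfolding R_def Im_boundary_quotient[OF n w] bs_density_def by simp
qed

text \<open>The diagonal case comes first, from positivity. It dominates the mixed products through
  |a c| \<le> a^2 + c^2, and with integrability known the half plane limit gives their
  value.\<close>

lemma bs_density_orthonormal:
  assumes w: "Im w > 0" and jk: "1 \<le> j" "j \<le> n" "1 \<le> k" "k \<le> n"
  shows "has_bochner_integral lborel (\<lambda>x. bs_density b w n x * (P_real b j x * P_real b k x)) (if j = k then 1 else 0)"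
proof -
  have n: "n \<ge> 1" using jk by simp
  have sq: "has_bochner_integral lborel (\<lambda>x. bs_density b w n x * (P_real b j x * P_real b j x)) 1"
    if j: "1 \<le> j" "j \<le> n" for j
  proof -
    note aux = boundary_quotient_properties[OF n w j(1) order.refl j(2), where b = b]
    have "has_bochner_integral lborel (\<lambda>x. pi * (bs_density b w n x * (P_real b j x * P_real b j x))) (pi * 1)"
      using half_plane_Im_integral(2)[OF aux(1-3)] bs_density_nonneg[OF w] unfolding aux(4) by simp
    then have "has_bochner_integral lborel (\<lambda>x. inverse pi * (pi * (bs_density b w n x * (P_real b j x * P_real b j x)))) (inverse pi * (pi * 1))"
      by - (rule has_bochner_integral_mult_right)
    moreover have "inverse pi * (pi * y) = y" for y by simp
    ultimately show ?thesis by (simp only:)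
  qed
  have int: "integrable lborel (\<lambda>x. bs_density b w n x * (P_real b j x * P_real b k x))"
  proof (rule Bochner_Integration.integrable_bound)
    show "integrable lborel (\<lambda>x. bs_density b w n x * (P_real b j x * P_real b j x) + bs_density b w n x * (P_real b k x * P_real b k x))"
      using sq jk by (intro Bochner_Integration.integrable_add) (auto simp: has_bochner_integral_iff)
    show "AE x in lborel. norm (bs_density b w n x * (P_real b j x * P_real b k x)) \<le>
        norm (bs_density b w n x * (P_real b j x * P_real b j x) + bs_density b w n x * (P_real b k x * P_real b k x))"
    proof (intro AE_I2)
      fix x
      have d: "bs_density b w n x \<ge> 0" using bs_density_nonneg[OF w] .
      have "\<bar>a * c\<bar> \<le> a * a + c * c" for a c :: real
        using sum_squares_bound[of a c] sum_squares_bound[of a "-c"]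
        by (auto simp: abs_if power2_eq_square)
      from mult_left_mono[OF this d, of "P_real b j x" "P_real b k x"]
      have "norm (bs_density b w n x * (P_real b j x * P_real b k x)) \<le>
        bs_density b w n x * (P_real b j x * P_real b j x) + bs_density b w n x * (P_real b k x * P_real b k x)"
        using d by (simp add: abs_mult ring_distribs)
      then show "norm (bs_density b w n x * (P_real b j x * P_real b k x)) \<le>
        norm (bs_density b w n x * (P_real b j x * P_real b j x) + bs_density b w n x * (P_real b k x * P_real b k x))"
        unfolding real_norm_def by (rule order.trans[OF _ abs_ge_self])
    qed
  qed measurable
  have main: "has_bochner_integral lborel (\<lambda>x. bs_density b w n x * (P_real b j x * P_real b k x)) (if j = k then 1 else 0)"
    if jk: "1 \<le> j" "j \<le> k" "k \<le> n" and int: "integrable lborel (\<lambda>x. bs_density b w n x * (P_real b j x * P_real b k x))" for j k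
  proof -
    note aux = boundary_quotient_properties[OF n w jk, where b = b]
    have "(\<integral>x. pi * (bs_density b w n x * (P_real b j x * P_real b k x)) \<partial>lborel) = pi * (if j = k then 1 else 0)"
      using half_plane_Im_integral(3)[OF aux(1-3)] int unfolding aux(4) by auto
    then show ?thesis using int by (auto simp: has_bochner_integral_iff)
  qed
  show ?thesis
  proof (cases "j \<le> k")
    case True
    then show ?thesis using main int jk by blast
  next
    case False
    then show ?thesis using main[of k j] int jk by (auto simp: mult.commute)
  qed
qed

text \<open>Candidates for the spectral measure of the first basis vector;
  \<open>orthonormal_measure_exists\<close> and \<open>orthonormal_measure_unique\<close> show that
  there is exactly one.\<close>

definition orthonormal_measure :: "(nat \<Rightarrow> real) \<Rightarrow> real measure \<Rightarrow> bool" where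
  "orthonormal_measure b M \<longleftrightarrow> real_distribution M \<and>
     (\<forall>j\<ge>1. \<forall>k\<ge>1. has_bochner_integral M (\<lambda>x. P_real b j x * P_real b k x) (if j = k then 1 else 0))"

section \<open>Stable moments and weak limits of the approximating measures\<close>

definition bs_measure :: "(nat \<Rightarrow> real) \<Rightarrow> complex \<Rightarrow> nat \<Rightarrow> real measure" where
  "bs_measure b w n = density lborel (\<lambda>x. ennreal (bs_density b w n x))"

lemma bs_measure_integral:
  fixes f :: "real \<Rightarrow> 'a::{banach, second_countable_topology}"
  assumes "Im w > 0" "f \<in> borel_measurable borel"
  shows "integral\<^sup>L (bs_measure b w n) f = (\<integral>x. bs_density b w n x *\<^sub>R f x \<partial>lborel)"
    and "integrable (bs_measure b w n) f \<longleftrightarrow> integrable lborel (\<lambda>x. bs_density b w n x *\<^sub>R f x)"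
  unfolding bs_measure_def using assms bs_density_nonneg[OF assms(1)]
  by (auto simp: integral_density integrable_density)

lemma bs_measure_orthonormal:
  assumes "Im w > 0" "1 \<le> j" "j \<le> n" "1 \<le> k" "k \<le> n"
  shows "has_bochner_integral (bs_measure b w n) (\<lambda>x. P_real b j x * P_real b k x) (if j = k then 1 else 0)"
  using bs_density_orthonormal[OF assms, of b] assms(1)
  by (simp add: has_bochner_integral_iff bs_measure_integral)

lemma bs_measure_real_distribution:
  assumes "Im w > 0" "n \<ge> 1"
  shows "real_distribution (bs_measure b w n)"
proof -
  have "has_bochner_integral lborel (bs_density b w n) 1"
    using bs_density_orthonormal[OF assms(1), of 1 n 1 b] assms(2) by simp
  then have "(\<integral>\<^sup>+x. ennreal (bs_density b w n x) \<partial>lborel) = 1"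
    using bs_density_nonneg[OF assms(1)] by (subst nn_integral_eq_integral) (auto simp: has_bochner_integral_iff)
  then have "prob_space (bs_measure b w n)"
    unfolding bs_measure_def by (intro prob_spaceI) (simp add: emeasure_density)
  then show ?thesis
    unfolding real_distribution_def real_distribution_axioms_def by (simp add: bs_measure_def)
qed

text \<open>The real polynomials, generated from \<open>P_real b k\<close> because the approximating
  measures are known on products of these. Index 0 contributes the zero function.\<close>

inductive P_span :: "(nat \<Rightarrow> real) \<Rightarrow> (real \<Rightarrow> real) \<Rightarrow> bool" for b where
  basis: "P_span b (\<lambda>x. P_real b k x)"
| add: "P_span b f \<Longrightarrow> P_span b g \<Longrightarrow> P_span b (\<lambda>x. f x + g x)"
| scale: "P_span b f \<Longrightarrow> P_span b (\<lambda>x. c * f x)"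

lemma P_span_diff: "P_span b f \<Longrightarrow> P_span b g \<Longrightarrow> P_span b (\<lambda>x. f x - g x)"
  using P_span.add[of b f "\<lambda>x. -1 * g x"] P_span.scale[of b g "-1"] by simp

lemma P_span_mult_x: "P_span b f \<Longrightarrow> P_span b (\<lambda>x. x * f x)"
proof (induction rule: P_span.induct)
  case (basis k)
  show ?case
  proof (cases k)
    case 0
    then show ?thesis using P_span.basis[of b 0] by simp
  next
    case (Suc m)
    have "(\<lambda>x. x * P_real b k x) = (\<lambda>x. (P_real b (Suc (Suc m)) x + b (Suc m) * P_real b (Suc m) x) + P_real b m x)"
      unfolding Suc P_real_rec by (simp add: algebra_simps)
    then show ?thesis by (auto intro!: P_span.intros)
  qed
next
  case (add f g)
  then show ?case using P_span.add[OF add.IH] by (simp add: algebra_simps)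
next
  case (scale f c)
  then show ?case using P_span.scale[OF scale.IH, of c] by (simp add: algebra_simps)
qed

lemma P_span_mult_P: "P_span b f \<Longrightarrow> P_span b (\<lambda>x. P_real b k x * f x)"
proof -
  assume f: "P_span b f"
  have "P_span b (\<lambda>x. P_real b k x * f x) \<and> P_span b (\<lambda>x. P_real b (Suc k) x * f x)"
  proof (induction k)
    case 0
    show ?case using f P_span.basis[of b 0] by simp
  next
    case (Suc k)
    have "(\<lambda>x. P_real b (Suc (Suc k)) x * f x) =
        (\<lambda>x. (x * (P_real b (Suc k) x * f x) - b (Suc k) * (P_real b (Suc k) x * f x)) - P_real b k x * f x)"
      unfolding P_real_rec by (simp add: algebra_simps)
    then show ?case using Suc by (auto intro!: P_span_diff P_span_mult_x P_span.scale)
  qed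
  then show ?thesis ..
qed

lemma P_span_continuous: "P_span b f \<Longrightarrow> isCont f x"
  by (induction rule: P_span.induct) (auto intro!: continuous_intros isCont_P_real[unfolded eta_contract_eq])

text \<open>Moments stabilise: \<open>N\<close> and \<open>C\<close> depend on \<open>f\<close> but
  not on \<open>w\<close>, since beyond some index orthonormality to \<open>P_real b 1\<close>,
  which is 1, fixes the integral of every basis function.\<close>

lemma P_span_bs_integral:
  assumes "P_span b f"
  shows "\<exists>N C. \<forall>n\<ge>N. \<forall>w. Im w > 0 \<longrightarrow> has_bochner_integral (bs_measure b w n) f C"
  using assms
proof (induction rule: P_span.induct)
  case (basis k)
  show ?case
  proof (cases "k = 0")
    case True
    then show ?thesis by (auto intro!: exI[of _ 0])
  next
    case False
    then have "has_bochner_integral (bs_measure b w n) (\<lambda>x. P_real b k x) (if k = 1 then 1 else 0)"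
      if "n \<ge> k" "Im w > 0" for n w
      using bs_measure_orthonormal[OF that(2), of k n 1 b] that(1) by simp
    then show ?thesis by blast
  qed
next
  case (add f g)
  then obtain N C N' C' where "\<forall>n\<ge>N. \<forall>w. Im w > 0 \<longrightarrow> has_bochner_integral (bs_measure b w n) f C"
    "\<forall>n\<ge>N'. \<forall>w. Im w > 0 \<longrightarrow> has_bochner_integral (bs_measure b w n) g C'" by blast
  then show ?case
    by (intro exI[of _ "max N N'"] exI[of _ "C + C'"]) (auto intro!: has_bochner_integral_add)
next
  case (scale f c)
  then obtain N C where "\<forall>n\<ge>N. \<forall>w. Im w > 0 \<longrightarrow> has_bochner_integral (bs_measure b w n) f C" by blast
  then show ?case
    by (intro exI[of _ N] exI[of _ "c * C"]) (auto intro!: has_bochner_integral_mult_right)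
qed

lemma clamp_error: "T > 0 \<Longrightarrow> \<bar>y - max (-T) (min T y)\<bar> \<le> y\<^sup>2 / T" for y T :: real
proof -
  assume T: "T > 0"
  have "\<bar>y - max (-T) (min T y)\<bar> * T \<le> y\<^sup>2"
  proof (cases "\<bar>y\<bar> \<le> T")
    case True
    then show ?thesis using T by (auto simp: max_def min_def)
  next
    case False
    then have "\<bar>y - max (-T) (min T y)\<bar> \<le> \<bar>y\<bar>" "T \<le> \<bar>y\<bar>" using T by (auto simp: max_def min_def)
    then have "\<bar>y - max (-T) (min T y)\<bar> * T \<le> \<bar>y\<bar> * \<bar>y\<bar>" using T by (intro mult_mono) auto
    then show ?thesis by (simp add: power2_eq_square)
  qed
  then show ?thesis using T by (simp add: field_simps)
qed

lemma real_distribution_clamp_error: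
  fixes f :: "real \<Rightarrow> real" and T C :: real
  assumes M: "real_distribution M" and f: "f \<in> borel_measurable borel"
    and f2: "integrable M (\<lambda>x. (f x)\<^sup>2)" "(\<integral>x. (f x)\<^sup>2 \<partial>M) \<le> C" and T: "T > 0"
  shows "integrable M f" "\<bar>(\<integral>x. f x \<partial>M) - (\<integral>x. max (-T) (min T (f x)) \<partial>M)\<bar> \<le> C / T"
proof -
  interpret real_distribution M by fact
  have [measurable]: "f \<in> borel_measurable M" using f by simp
  have i1: "integrable M (\<lambda>x. max (-T) (min T (f x)))"
    using T by (intro integrable_const_bound[where B = T]) auto
  have i2: "integrable M (\<lambda>x. f x - max (-T) (min T (f x)))"
    by (rule Bochner_Integration.integrable_bound[of M "\<lambda>x. (f x)\<^sup>2 / T"])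
      (use f2(1) clamp_error[OF T] T in auto)
  from Bochner_Integration.integrable_add[OF i1 i2] show fi: "integrable M f" by simp
  have "\<bar>(\<integral>x. f x \<partial>M) - (\<integral>x. max (-T) (min T (f x)) \<partial>M)\<bar> = \<bar>\<integral>x. f x - max (-T) (min T (f x)) \<partial>M\<bar>"
    using i1 fi by simp
  also have "\<dots> \<le> (\<integral>x. \<bar>f x - max (-T) (min T (f x))\<bar> \<partial>M)"
    by (rule integral_abs_bound)
  also have "\<dots> \<le> (\<integral>x. (f x)\<^sup>2 / T \<partial>M)"
    using i2 f2(1) clamp_error[OF T] by (intro integral_mono) auto
  also have "\<dots> \<le> C / T" using f2(2) T by (simp add: divide_right_mono)
  finally show "\<bar>(\<integral>x. f x \<partial>M) - (\<integral>x. max (-T) (min T (f x)) \<partial>M)\<bar> \<le> C / T" .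
qed

text \<open>Weak convergence tests bounded functions only. Fatou's lemma carries the second moment
  bound over to \<open>M\<close>, and truncating at height \<open>T\<close> costs at most
  \<open>C / T\<close> for every measure involved, so the unbounded \<open>f\<close> passes to the
  limit.\<close>

lemma weak_conv_moment:
  fixes f :: "real \<Rightarrow> real"
  assumes \<mu>: "\<And>n. real_distribution (\<mu> n)" and M: "real_distribution M" and wc: "weak_conv_m \<mu> M"
    and f: "\<And>x. isCont f x" and f2: "\<And>n. integrable (\<mu> n) (\<lambda>x. (f x)\<^sup>2)" "\<And>n. (\<integral>x. (f x)\<^sup>2 \<partial>\<mu> n) \<le> C"
  shows "integrable M f" "(\<lambda>n. integral\<^sup>L (\<mu> n) f) \<longlonglongrightarrow> integral\<^sup>L M f"
proof -
  interpret M: real_distribution M by fact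
  have fm [measurable]: "f \<in> borel_measurable borel"
    by (intro borel_measurable_continuous_onI continuous_at_imp_continuous_on ballI f)
  have C0: "C \<ge> 0" by (rule order.trans[OF _ f2(2)[of 0]]) (rule integral_nonneg_AE, simp)
  have trunc: "(\<integral>x. min (real k) ((f x)\<^sup>2) \<partial>M) \<le> C" for k
  proof (rule LIMSEQ_le_const2)
    show "(\<lambda>n. \<integral>x. min (real k) ((f x)\<^sup>2) \<partial>\<mu> n) \<longlonglongrightarrow> (\<integral>x. min (real k) ((f x)\<^sup>2) \<partial>M)"
      by (rule weak_conv_imp_integral_bdd_continuous_conv[OF \<mu> M wc, where B = "real k"])
        (auto intro!: continuous_intros f)
    have "(\<integral>x. min (real k) ((f x)\<^sup>2) \<partial>\<mu> n) \<le> C" for n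
    proof -
      interpret m: real_distribution "\<mu> n" by (rule \<mu>)
      have "(\<integral>x. min (real k) ((f x)\<^sup>2) \<partial>\<mu> n) \<le> (\<integral>x. (f x)\<^sup>2 \<partial>\<mu> n)"
        by (rule integral_mono[OF m.integrable_const_bound[where B = "real k"] f2(1)]) auto
      then show ?thesis using f2(2)[of n] by simp
    qed
    then show "\<exists>N. \<forall>n\<ge>N. (\<integral>x. min (real k) ((f x)\<^sup>2) \<partial>\<mu> n) \<le> C" by blast
  qed
  have lim: "(\<lambda>k. ennreal (min (real k) ((f x)\<^sup>2))) \<longlonglongrightarrow> ennreal ((f x)\<^sup>2)" for x
  proof (rule tendsto_eventually)
    obtain N where "(f x)\<^sup>2 \<le> real N" using real_arch_simple by blast
    then show "\<forall>\<^sub>F k in sequentially. ennreal (min (real k) ((f x)\<^sup>2)) = ennreal ((f x)\<^sup>2)"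
      by (intro eventually_sequentiallyI[of N]) (auto simp: min_def)
  qed
  have "(\<integral>\<^sup>+x. ennreal ((f x)\<^sup>2) \<partial>M) = (\<integral>\<^sup>+x. liminf (\<lambda>k. ennreal (min (real k) ((f x)\<^sup>2))) \<partial>M)"
    using lim by (intro nn_integral_cong lim_imp_Liminf[symmetric]) auto
  also have "\<dots> \<le> liminf (\<lambda>k. \<integral>\<^sup>+x. ennreal (min (real k) ((f x)\<^sup>2)) \<partial>M)"
    by (intro nn_integral_liminf) simp
  also have "\<dots> \<le> limsup (\<lambda>k. \<integral>\<^sup>+x. ennreal (min (real k) ((f x)\<^sup>2)) \<partial>M)"
    by (rule Liminf_le_Limsup) simp
  also have "\<dots> \<le> ennreal C"
  proof (intro Limsup_bounded always_eventually allI)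
    fix k :: nat
    have "(\<integral>\<^sup>+x. ennreal (min (real k) ((f x)\<^sup>2)) \<partial>M) = ennreal (\<integral>x. min (real k) ((f x)\<^sup>2) \<partial>M)"
      by (intro nn_integral_eq_integral M.integrable_const_bound[where B = "real k"]) auto
    then show "(\<integral>\<^sup>+x. ennreal (min (real k) ((f x)\<^sup>2)) \<partial>M) \<le> ennreal C"
      using trunc[of k] by (simp add: ennreal_leI)
  qed
  finally have nn: "(\<integral>\<^sup>+x. ennreal ((f x)\<^sup>2) \<partial>M) \<le> ennreal C" .
  then have "(\<integral>\<^sup>+x. ennreal ((f x)\<^sup>2) \<partial>M) < \<infinity>" by (rule le_less_trans) simp
  then have i2: "integrable M (\<lambda>x. (f x)\<^sup>2)" by (intro integrableI_nonneg) auto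
  have I2: "(\<integral>x. (f x)\<^sup>2 \<partial>M) \<le> C"
    using nn C0 nn_integral_eq_integral[OF i2] by auto
  show "integrable M f" by (rule real_distribution_clamp_error[OF M fm i2 I2 zero_less_one])
  show "(\<lambda>n. integral\<^sup>L (\<mu> n) f) \<longlonglongrightarrow> integral\<^sup>L M f"
  proof (rule tendstoI)
    fix e :: real assume e: "e > 0"
    \<comment> \<open>Gives \<open>C / T < e / 3\<close>; with \<open>C + 1\<close> in place of
      \<open>C\<close>, \<open>T\<close> is positive also for \<open>C = 0\<close>.\<close>
    define T where "T = 4 * (C + 1) / e"
    have "C * e + e * 4 > 0" using e C0 by (intro add_nonneg_pos) auto
    then have T: "T > 0" "C / T < e / 3" using e C0 by (auto simp: T_def field_simps)
    have "(\<lambda>n. \<integral>x. max (-T) (min T (f x)) \<partial>\<mu> n) \<longlonglongrightarrow> (\<integral>x. max (-T) (min T (f x)) \<partial>M)"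
      by (rule weak_conv_imp_integral_bdd_continuous_conv[OF \<mu> M wc, where B = T])
        (use T in \<open>auto intro!: continuous_intros f\<close>)
    from tendstoD[OF this, of "e/3"] e
    have "\<forall>\<^sub>F n in sequentially. dist (\<integral>x. max (-T) (min T (f x)) \<partial>\<mu> n) (\<integral>x. max (-T) (min T (f x)) \<partial>M) < e / 3"
      by simp
    then show "\<forall>\<^sub>F n in sequentially. dist (integral\<^sup>L (\<mu> n) f) (integral\<^sup>L M f) < e"
    proof eventually_elim
      case (elim n)
      then show ?case
        using real_distribution_clamp_error(2)[OF M fm i2 I2 T(1)]
          real_distribution_clamp_error(2)[OF \<mu> fm f2(1) f2(2) T(1), of n] T(2)
        unfolding dist_real_def by linarith
    qed
  qed
qed

text \<open>Chebyshev's inequality, with \<open>T\<close> chosen so that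
  \<open>C / T\<^sup>2 < \<epsilon>\<close>.\<close>

lemma tight_if_second_moment:
  assumes \<mu>: "\<And>n. real_distribution (\<mu> n)"
    and C: "\<And>n. integrable (\<mu> n) (\<lambda>x. x\<^sup>2)" "\<And>n. (\<integral>x. x\<^sup>2 \<partial>\<mu> n) \<le> C"
  shows "tight \<mu>"
  unfolding tight_def
proof (intro conjI allI impI)
  show "real_distribution (\<mu> n)" for n by (rule \<mu>)
  fix \<epsilon> :: real assume e: "\<epsilon> > 0"
  have C0: "C \<ge> 0" by (rule order.trans[OF _ C(2)[of 0]]) (rule integral_nonneg_AE, simp)
  define T where "T = sqrt ((C + 1) / \<epsilon>)"
  have T: "T > 0" "C / T\<^sup>2 < \<epsilon>" using e C0 by (auto simp: T_def field_simps)
  have "1 - \<epsilon> < measure (\<mu> n) {-T<..T}" for n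
  proof -
    interpret real_distribution "\<mu> n" by (rule \<mu>)
    have "measure (\<mu> n) (- {-T<..T}) = (\<integral>x. indicator (- {-T<..T}) x \<partial>\<mu> n)" by simp
    also have "\<dots> \<le> (\<integral>x. x\<^sup>2 / T\<^sup>2 \<partial>\<mu> n)"
    proof (rule integral_mono)
      fix x
      show "indicator (- {-T<..T}) x \<le> x\<^sup>2 / T\<^sup>2"
      proof (cases "x \<in> {-T<..T}")
        case False
        then have "\<bar>T\<bar> \<le> \<bar>x\<bar>" using T by auto
        then have "T\<^sup>2 \<le> x\<^sup>2" by (simp only: abs_le_square_iff)
        then show ?thesis using T False by (simp add: field_simps)
      qed auto
    next
      show "integrable (\<mu> n) (indicat_real (- {-T<..T}))"
        by (rule integrable_const_bound[where B = 1]) auto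
    qed (use C(1) in auto)
    also have "\<dots> \<le> C / T\<^sup>2" using C(2)[of n] by (simp add: divide_right_mono)
    finally have "measure (\<mu> n) (- {-T<..T}) < \<epsilon>" using T by simp
    moreover have "measure (\<mu> n) (- {-T<..T}) = 1 - measure (\<mu> n) {-T<..T}"
      using prob_compl[of "{-T<..T}"] by (simp add: Compl_eq_Diff_UNIV)
    ultimately show ?thesis by linarith
  qed
  then show "\<exists>a b. a < b \<and> (\<forall>n. 1 - \<epsilon> < measure (\<mu> n) {a<..b})"
    using T by (intro exI[of _ "-T"] exI[of _ T]) auto
qed

text \<open>Compactness: the second moment is eventually constant, so the measures are tight and a
  subsequence converges weakly. Products of the polynomials pass to the limit because their squares
  again lie in \<open>P_span\<close> and have stable integrals.\<close>

theorem orthonormal_measure_exists: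
  assumes w: "Im w > 0"
  shows "\<exists>r M. strict_mono r \<and> weak_conv_m (\<lambda>n. bs_measure b w (r n)) M \<and>
    (\<forall>n. r n \<ge> 1) \<and> orthonormal_measure b M"
proof -
  have x2: "P_span b (\<lambda>x. x\<^sup>2)"
    using P_span_mult_x[OF P_span_mult_x[OF P_span.basis[of b 1]]] by (simp add: power2_eq_square)
  from P_span_bs_integral[OF this] obtain N C
    where N: "\<And>n. n \<ge> N \<Longrightarrow> has_bochner_integral (bs_measure b w n) (\<lambda>x. x\<^sup>2) C" using w by blast
  \<comment> \<open>The shift by \<open>N + 1\<close> puts every index where the second moment is
    stable and the total mass is 1.\<close>
  let ?\<mu> = "\<lambda>n. bs_measure b w (n + (N + 1))"
  have \<mu>: "real_distribution (?\<mu> n)" for n by (rule bs_measure_real_distribution[OF w]) simp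
  have "tight ?\<mu>"
    by (rule tight_if_second_moment[OF \<mu>, where C = C]) (use N in \<open>auto simp: has_bochner_integral_iff\<close>)
  from tight_imp_convergent_subsubsequence[OF this strict_mono_id]
  obtain r0 M where r0: "strict_mono r0" "real_distribution M" "weak_conv_m (?\<mu> \<circ> id \<circ> r0) M" by blast
  define r where "r n = r0 n + (N + 1)" for n
  have r: "strict_mono r" "r n \<ge> 1" "n \<le> r n" for n
    using r0(1) seq_suble[OF r0(1), of n] by (auto simp: r_def strict_mono_def)
  have wc: "weak_conv_m (\<lambda>n. bs_measure b w (r n)) M"
    using r0(3) by (simp add: o_def r_def)
  have main: "has_bochner_integral M f c" if f: "P_span b f" "P_span b (\<lambda>x. (f x)\<^sup>2)"
    and c: "\<And>n. n \<ge> N0 \<Longrightarrow> has_bochner_integral (bs_measure b w n) f c" for f c N0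
  proof -
    from P_span_bs_integral[OF f(2)] obtain N1 C1
      where N1: "\<And>n. n \<ge> N1 \<Longrightarrow> has_bochner_integral (bs_measure b w n) (\<lambda>x. (f x)\<^sup>2) C1" using w by blast
    define N2 where "N2 = max N0 N1"
    have rN: "r (n + N2) \<ge> N0" "r (n + N2) \<ge> N1" for n
      using r(3)[of "n + N2"] by (auto simp: N2_def)
    have wc': "weak_conv_m (\<lambda>n. bs_measure b w (r (n + N2))) M"
      using wc unfolding weak_conv_m_def weak_conv_def
      by (auto intro: LIMSEQ_ignore_initial_segment[where k = N2])
    note wm = weak_conv_moment[OF bs_measure_real_distribution[OF w r(2)] r0(2) wc' P_span_continuous[OF f(1)], of C1]
    have i: "integrable M f" and l: "(\<lambda>n. integral\<^sup>L (bs_measure b w (r (n + N2))) f) \<longlonglongrightarrow> integral\<^sup>L M f"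
      using wm N1 rN by (auto simp: has_bochner_integral_iff)
    have "integral\<^sup>L (bs_measure b w (r (n + N2))) f = c" for n
      using c[OF rN(1)] by (simp add: has_bochner_integral_iff)
    with l have "integral\<^sup>L M f = c" by (simp add: LIMSEQ_const_iff)
    with i show ?thesis by (simp add: has_bochner_integral_iff)
  qed
  have "has_bochner_integral M (\<lambda>x. P_real b j x * P_real b k x) (if j = k then 1 else 0)"
    if jk: "j \<ge> 1" "k \<ge> 1" for j k
  proof (rule main[of _ "max j k"])
    show "P_span b (\<lambda>x. P_real b j x * P_real b k x)" by (intro P_span_mult_P P_span.basis)
    have "P_span b (\<lambda>x. P_real b j x * (P_real b j x * (P_real b k x * P_real b k x)))"
      by (intro P_span_mult_P P_span.basis)
    then show "P_span b (\<lambda>x. (P_real b j x * P_real b k x)\<^sup>2)"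
      by (simp add: power2_eq_square mult_ac)
    show "has_bochner_integral (bs_measure b w n) (\<lambda>x. P_real b j x * P_real b k x) (if j = k then 1 else 0)"
      if "n \<ge> max j k" for n
      using that jk by (intro bs_measure_orthonormal w) auto
  qed
  then have "orthonormal_measure b M" unfolding orthonormal_measure_def using r0(2) by blast
  then show ?thesis using r wc by blast
qed

section \<open>Uniqueness of the Stieltjes transform\<close>

lemma cauchy_kernel_norm_le:
  assumes "Im z \<noteq> 0"
  shows "of_real x - z \<noteq> 0" "cmod (1 / (of_real x - z)) \<le> 1 / \<bar>Im z\<bar>"
proof -
  have "\<bar>Im z\<bar> \<le> cmod (of_real x - z)"
    using abs_Im_le_cmod[of "of_real x - z"] by simp
  then show "of_real x - z \<noteq> 0" "cmod (1 / (of_real x - z)) \<le> 1 / \<bar>Im z\<bar>"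
    using assms by (auto simp: norm_divide intro!: divide_left_mono mult_pos_pos)
qed

lemma cauchy_kernel_measurable [measurable]:
  "(\<lambda>x::real. 1 / (complex_of_real x - z)) \<in> borel_measurable borel"
  by measurable

lemma (in finite_borel_measure) integrable_cauchy_kernel:
  "Im z \<noteq> 0 \<Longrightarrow> integrable M (\<lambda>x. 1 / (complex_of_real x - z))"
  using cauchy_kernel_norm_le(2)[of z] M_is_borel
  by (intro integrable_const_bound[where B = "1 / \<bar>Im z\<bar>"]) auto

lemma Im_cauchy_kernel:
  "Im (1 / (complex_of_real x - Complex y e)) = e / ((x - y)\<^sup>2 + e\<^sup>2)"
  by (simp add: Im_divide power2_eq_square)

text \<open>The Poisson kernel is the y-derivative of the arctangent, whose difference quotients are
  bounded by \<open>1 / e\<close>. Differentiating under the integral replaces the interchange of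
  integrals in the usual inversion formula.\<close>

lemma (in finite_borel_measure) arctan_transform_derivative:
  assumes e: "e > 0"
  shows "((\<lambda>y. \<integral>x. arctan ((y - x) / e) \<partial>M) has_real_derivative
    (\<integral>x. Im (1 / (complex_of_real x - Complex y e)) \<partial>M)) (at y)"
  unfolding has_field_derivative_iff
proof (subst tendsto_at_iff_sequentially, intro allI impI)
  fix X :: "nat \<Rightarrow> real" assume X: "\<forall>i. X i \<in> UNIV - {y}" "X \<longlonglongrightarrow> y"
  have m [measurable]: "(\<lambda>x. arctan ((t - x) / e)) \<in> borel_measurable M" for t
    by (simp add: measurable_cong_sets[OF M_is_borel refl])
  have i: "integrable M (\<lambda>x. arctan ((t - x) / e))" for t
  proof (rule integrable_const_bound[where B = pi])
    show "AE x in M. norm (arctan ((t - x) / e)) \<le> pi"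
    proof (intro AE_I2)
      fix x show "norm (arctan ((t - x) / e)) \<le> pi"
        using arctan_bounded[of "(t - x) / e"] unfolding real_norm_def by linarith
    qed
  qed simp
  let ?q = "\<lambda>i x. (arctan ((X i - x) / e) - arctan ((y - x) / e)) / (X i - y)"
  have d: "((\<lambda>t. arctan ((t - x) / e)) has_real_derivative Im (1 / (complex_of_real x - Complex t e))) (at t)" for x t
  proof -
    have "e\<^sup>2 + (t - x)\<^sup>2 > 0" using e by (simp add: add_pos_nonneg)
    then have "e / ((x - t)\<^sup>2 + e\<^sup>2) = 1 / e / (1 + ((t - x) / e)\<^sup>2)"
      using e by (simp add: field_simps power2_commute power2_eq_square)
    then show ?thesis unfolding Im_cauchy_kernel using e
      by (auto intro!: derivative_eq_intros simp: inverse_eq_divide)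
  qed
  have "(\<lambda>i. \<integral>x. ?q i x \<partial>M) \<longlonglongrightarrow> (\<integral>x. Im (1 / (complex_of_real x - Complex y e)) \<partial>M)"
  proof (rule integral_dominated_convergence[where w = "\<lambda>_. 1 / e"])
    show "AE x in M. (\<lambda>i. ?q i x) \<longlonglongrightarrow> Im (1 / (complex_of_real x - Complex y e))"
    proof (intro AE_I2)
      fix x
      from d[of x y] have "((\<lambda>t. (arctan ((t - x) / e) - arctan ((y - x) / e)) / (t - y)) \<longlongrightarrow> Im (1 / (complex_of_real x - Complex y e))) (at y)"
        unfolding has_field_derivative_iff .
      then show "(\<lambda>i. ?q i x) \<longlonglongrightarrow> Im (1 / (complex_of_real x - Complex y e))"
        using X unfolding tendsto_at_iff_sequentially by (auto simp: o_def)
    qed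
    show "AE x in M. norm (?q i x) \<le> 1 / e" for i
    proof (intro AE_I2)
      fix x
      have "norm (arctan ((X i - x) / e) - arctan ((y - x) / e)) \<le> 1 / e * norm (X i - y)"
      proof (rule field_differentiable_bound[where S = UNIV])
        show "((\<lambda>t. arctan ((t - x) / e)) has_real_derivative Im (1 / (complex_of_real x - Complex t e))) (at t within UNIV)" for t
          using d .
        show "norm (Im (1 / (complex_of_real x - Complex t e))) \<le> 1 / e" for t
          using abs_Im_le_cmod[of "1 / (complex_of_real x - Complex t e)"] cauchy_kernel_norm_le(2)[of "Complex t e" x] e by simp
      qed auto
      then show "norm (?q i x) \<le> 1 / e" using X(1) e by (simp add: abs_divide field_simps)
    qed
  qed (use M_is_borel e in \<open>auto simp: measurable_cong_sets[OF M_is_borel refl]\<close>)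
  moreover have "(\<integral>x. ?q i x \<partial>M) = ((\<integral>x. arctan ((X i - x) / e) \<partial>M) - (\<integral>x. arctan ((y - x) / e) \<partial>M)) / (X i - y)" for i
    using i by simp
  ultimately show "((\<lambda>t. ((\<integral>x. arctan ((t - x) / e) \<partial>M) - (\<integral>x. arctan ((y - x) / e) \<partial>M)) / (t - y)) \<circ> X)
      \<longlonglongrightarrow> (\<integral>x. Im (1 / (complex_of_real x - Complex y e)) \<partial>M)"
    by (simp only: o_def)
qed

lemma arctan_scaled_at_top:
  assumes "filterlim f at_top F"
  shows "((\<lambda>k. arctan (f k)) \<longlongrightarrow> pi / 2) F"
  using filterlim_compose[OF tendsto_arctan_at_top assms] .

text \<open>The first limit fixes the constant of integration at minus infinity. In the second the
  kernel narrows faster than its centre approaches \<open>c\<close> from the right, so a point mass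
  at \<open>c\<close> is counted in full, as the distribution function demands.\<close>

lemma (in finite_borel_measure) arctan_transform_limits:
  shows "e > 0 \<Longrightarrow> (\<lambda>k. (\<integral>x. arctan ((y - x) / e) \<partial>M) - (\<integral>x. arctan ((- real k - x) / e) \<partial>M))
      \<longlonglongrightarrow> (\<integral>x. arctan ((y - x) / e) + pi / 2 \<partial>M)"
    and "(\<lambda>k. \<integral>x. arctan ((c + 1 / real (Suc k) - x) / (1 / real (Suc k) ^ 2)) + pi / 2 \<partial>M) \<longlonglongrightarrow> pi * cdf M c"
proof -
  have m [measurable]: "(\<lambda>x. arctan ((t - x) / e)) \<in> borel_measurable M" for t e
    by (simp add: measurable_cong_sets[OF M_is_borel refl])
  have i: "integrable M (\<lambda>x. arctan ((t - x) / e))" for t e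
  proof (rule integrable_const_bound[where B = pi])
    show "AE x in M. norm (arctan ((t - x) / e)) \<le> pi"
    proof (intro AE_I2)
      fix x show "norm (arctan ((t - x) / e)) \<le> pi"
        using arctan_bounded[of "(t - x) / e"] unfolding real_norm_def by linarith
    qed
  qed simp
  show "(\<lambda>k. (\<integral>x. arctan ((y - x) / e) \<partial>M) - (\<integral>x. arctan ((- real k - x) / e) \<partial>M))
      \<longlonglongrightarrow> (\<integral>x. arctan ((y - x) / e) + pi / 2 \<partial>M)" if e: "e > 0"
  proof -
    have "(\<lambda>k. \<integral>x. arctan ((y - x) / e) - arctan ((- real k - x) / e) \<partial>M) \<longlonglongrightarrow> (\<integral>x. arctan ((y - x) / e) + pi / 2 \<partial>M)"
    proof (rule integral_dominated_convergence[where w = "\<lambda>_. pi"])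
      show "AE x in M. (\<lambda>k. arctan ((y - x) / e) - arctan ((- real k - x) / e)) \<longlonglongrightarrow> arctan ((y - x) / e) + pi / 2"
      proof (intro AE_I2)
        fix x
        have "filterlim (\<lambda>k. (real k + x) / e) at_top sequentially"
          using e by real_asymp
        from arctan_scaled_at_top[OF this]
        have "(\<lambda>k. arctan ((y - x) / e) + arctan ((real k + x) / e)) \<longlonglongrightarrow> arctan ((y - x) / e) + pi / 2"
          by (intro tendsto_intros)
        moreover have "arctan ((- real k - x) / e) = - arctan ((real k + x) / e)" for k
        proof -
          have "(- real k - x) / e = - ((real k + x) / e)" by (simp add: minus_divide_left)
          then show ?thesis by (simp only: arctan_minus)
        qed
        ultimately show "(\<lambda>k. arctan ((y - x) / e) - arctan ((- real k - x) / e)) \<longlonglongrightarrow> arctan ((y - x) / e) + pi / 2"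
          by simp
      qed
      show "AE x in M. norm (arctan ((y - x) / e) - arctan ((- real k - x) / e)) \<le> pi" for k
      proof (intro AE_I2)
        fix x show "norm (arctan ((y - x) / e) - arctan ((- real k - x) / e)) \<le> pi"
          using arctan_bounded[of "(y - x) / e"] arctan_bounded[of "(- real k - x) / e"]
          unfolding real_norm_def by linarith
      qed
    qed auto
    then show ?thesis using i by simp
  qed
  have "(\<lambda>k. \<integral>x. arctan ((c + 1 / real (Suc k) - x) / (1 / real (Suc k) ^ 2)) + pi / 2 \<partial>M) \<longlonglongrightarrow> (\<integral>x. pi * indicator {..c} x \<partial>M)"
  proof (rule integral_dominated_convergence[where w = "\<lambda>_. pi"])
    show "AE x in M. (\<lambda>k. arctan ((c + 1 / real (Suc k) - x) / (1 / real (Suc k) ^ 2)) + pi / 2) \<longlonglongrightarrow> pi * indicator {..c} x"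
    proof (intro AE_I2)
      fix x
      show "(\<lambda>k. arctan ((c + 1 / real (Suc k) - x) / (1 / real (Suc k) ^ 2)) + pi / 2) \<longlonglongrightarrow> pi * indicator {..c} x"
      proof (cases "x \<le> c")
        case True
        have "filterlim (\<lambda>k. (c + 1 / real (Suc k) - x) / (1 / real (Suc k) ^ 2)) at_top sequentially"
        proof (cases "c = x")
          case True
          show ?thesis unfolding True by real_asymp
        next
          case False
          then have "c - x > 0" using \<open>x \<le> c\<close> by simp
          then have "filterlim (\<lambda>k. ((c - x) + 1 / real (Suc k)) / (1 / real (Suc k) ^ 2)) at_top sequentially"
            by real_asymp
          then show ?thesis by (simp add: algebra_simps)
        qed
        from tendsto_add[OF arctan_scaled_at_top[OF this] tendsto_const[of "pi/2"]] show ?thesis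
          using True by simp
      next
        case False
        then have "x - c > 0" by simp
        then have "filterlim (\<lambda>k. ((x - c) - 1 / real (Suc k)) / (1 / real (Suc k) ^ 2)) at_top sequentially"
          by real_asymp
        from tendsto_diff[OF tendsto_const[of "pi/2"] arctan_scaled_at_top[OF this]]
        have "(\<lambda>k. pi / 2 - arctan (((x - c) - 1 / real (Suc k)) / (1 / real (Suc k) ^ 2))) \<longlonglongrightarrow> 0" by simp
        moreover have "arctan ((c + 1 / real (Suc k) - x) / (1 / real (Suc k) ^ 2)) =
            - arctan (((x - c) - 1 / real (Suc k)) / (1 / real (Suc k) ^ 2))" for k
        proof -
          have "(c + 1 / real (Suc k) - x) / (1 / real (Suc k) ^ 2) = - (((x - c) - 1 / real (Suc k)) / (1 / real (Suc k) ^ 2))"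
            by (simp add: minus_divide_left algebra_simps)
          then show ?thesis by (simp only: arctan_minus)
        qed
        ultimately show ?thesis using False by simp
      qed
    qed
    show "AE x in M. norm (arctan ((c + 1 / real (Suc k) - x) / (1 / real (Suc k) ^ 2)) + pi / 2) \<le> pi" for k
    proof (intro AE_I2)
      fix x show "norm (arctan ((c + 1 / real (Suc k) - x) / (1 / real (Suc k) ^ 2)) + pi / 2) \<le> pi"
        using arctan_bounded[of "(c + 1 / real (Suc k) - x) / (1 / real (Suc k) ^ 2)"]
        unfolding real_norm_def by linarith
    qed
  qed (auto simp: measurable_cong_sets[OF M_is_borel refl])
  also have "(\<integral>x. pi * indicator {..c} x \<partial>M) = pi * cdf M c"
    using M_is_borel by (simp add: cdf_def borel_UNIV)
  finally show "(\<lambda>k. \<integral>x. arctan ((c + 1 / real (Suc k) - x) / (1 / real (Suc k) ^ 2)) + pi / 2 \<partial>M) \<longlonglongrightarrow> pi * cdf M c" .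
qed

text \<open>Equal transforms give arctangent integrals with equal derivatives, hence equal
  increments; sending one endpoint to minus infinity and then the width to 0 gives equal
  distribution functions.\<close>

theorem stieltjes_transform_unique:
  assumes M: "finite_measure M" "sets M = sets borel" and N: "finite_measure N" "sets N = sets borel"
    and eq: "\<And>z. z \<notin> \<real> \<Longrightarrow> (\<integral>x. 1 / (complex_of_real x - z) \<partial>M) = (\<integral>x. 1 / (complex_of_real x - z) \<partial>N)"
  shows "M = N"
proof -
  interpret M: finite_borel_measure M
    unfolding finite_borel_measure_def finite_borel_measure_axioms_def using M by auto
  interpret N: finite_borel_measure N
    unfolding finite_borel_measure_def finite_borel_measure_axioms_def using N by auto
  have 1: "(\<integral>x. arctan ((y - x) / e) \<partial>M) - (\<integral>x. arctan ((y' - x) / e) \<partial>M) =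
      (\<integral>x. arctan ((y - x) / e) \<partial>N) - (\<integral>x. arctan ((y' - x) / e) \<partial>N)" if e: "e > 0" for e y y'
  proof -
    have "(\<integral>x. Im (1 / (complex_of_real x - Complex t e)) \<partial>M) = (\<integral>x. Im (1 / (complex_of_real x - Complex t e)) \<partial>N)" for t
      using eq[of "Complex t e"] e M.integrable_cauchy_kernel[of "Complex t e"] N.integrable_cauchy_kernel[of "Complex t e"]
      by (simp add: complex_is_Real_iff)
    with DERIV_diff[OF M.arctan_transform_derivative[OF e] N.arctan_transform_derivative[OF e]]
    have "\<forall>t. ((\<lambda>t. (\<integral>x. arctan ((t - x) / e) \<partial>M) - (\<integral>x. arctan ((t - x) / e) \<partial>N)) has_real_derivative 0) (at t)"
      by simp
    from DERIV_isconst_all[OF this, of y y'] show ?thesis by simp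
  qed
  have 2: "(\<integral>x. arctan ((y - x) / e) + pi / 2 \<partial>M) = (\<integral>x. arctan ((y - x) / e) + pi / 2 \<partial>N)" if e: "e > 0" for e y
    using LIMSEQ_unique[OF M.arctan_transform_limits(1)[OF e, of y], of "\<integral>x. arctan ((y - x) / e) + pi / 2 \<partial>N"]
      N.arctan_transform_limits(1)[OF e, of y] unfolding 1[OF e] by blast
  have "pi * cdf M c = pi * cdf N c" for c
  proof (rule LIMSEQ_unique[OF M.arctan_transform_limits(2)])
    have "(\<integral>x. arctan ((c + 1 / real (Suc k) - x) / (1 / real (Suc k) ^ 2)) + pi / 2 \<partial>M) =
      (\<integral>x. arctan ((c + 1 / real (Suc k) - x) / (1 / real (Suc k) ^ 2)) + pi / 2 \<partial>N)" for k
      by (rule 2) simp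
    then show "(\<lambda>k. \<integral>x. arctan ((c + 1 / real (Suc k) - x) / (1 / real (Suc k) ^ 2)) + pi / 2 \<partial>M) \<longlonglongrightarrow> pi * cdf N c"
      using N.arctan_transform_limits(2)[of c] by simp
  qed
  then have "cdf M = cdf N" by (simp add: fun_eq_iff)
  then show ?thesis
    by (intro cdf_unique') unfold_locales
qed

section \<open>Resolvent, Weyl function and spectral measures\<close>

definition sq_int :: "real measure \<Rightarrow> (real \<Rightarrow> complex) \<Rightarrow> bool" where
  "sq_int M f \<longleftrightarrow> f \<in> borel_measurable M \<and> integrable M (\<lambda>x. (cmod (f x))\<^sup>2)"

lemma cmod_mult_le_squares: "cmod (a * c) \<le> (cmod a)\<^sup>2 + (cmod c)\<^sup>2"
proof -
  have "0 \<le> (cmod a - cmod c)\<^sup>2" "0 \<le> (cmod a)\<^sup>2 + (cmod c)\<^sup>2" by auto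
  then show ?thesis unfolding norm_mult power2_diff by linarith
qed

lemma cmod_add_square_le: "(cmod (a + c))\<^sup>2 \<le> 2 * (cmod a)\<^sup>2 + 2 * (cmod c)\<^sup>2"
proof -
  have "(cmod (a + c))\<^sup>2 \<le> (cmod a + cmod c)\<^sup>2" by (intro power_mono norm_triangle_ineq) auto
  also have "\<dots> \<le> 2 * (cmod a)\<^sup>2 + 2 * (cmod c)\<^sup>2"
    using zero_le_power2[of "cmod a - cmod c"] unfolding power2_diff power2_sum by linarith
  finally show ?thesis .
qed

lemma sq_int_measurable: "sq_int M f \<Longrightarrow> f \<in> borel_measurable M" by (simp add: sq_int_def)

lemma sq_int_add: "sq_int M f \<Longrightarrow> sq_int M g \<Longrightarrow> sq_int M (\<lambda>x. f x + g x)"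
  unfolding sq_int_def
proof (elim conjE, intro conjI)
  assume a: "f \<in> borel_measurable M" "g \<in> borel_measurable M"
    "integrable M (\<lambda>x. (cmod (f x))\<^sup>2)" "integrable M (\<lambda>x. (cmod (g x))\<^sup>2)"
  show "(\<lambda>x. f x + g x) \<in> borel_measurable M" using a by simp
  show "integrable M (\<lambda>x. (cmod (f x + g x))\<^sup>2)"
    by (rule Bochner_Integration.integrable_bound[of M "\<lambda>x. 2 * (cmod (f x))\<^sup>2 + 2 * (cmod (g x))\<^sup>2"])
       (use a cmod_add_square_le in \<open>auto\<close>)
qed

lemma sq_int_cnj: "sq_int M f \<Longrightarrow> sq_int M (\<lambda>x. cnj (f x))"
proof -
  have "cnj \<in> borel_measurable borel" by (intro borel_measurable_continuous_onI continuous_intros)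
  then show "sq_int M f \<Longrightarrow> sq_int M (\<lambda>x. cnj (f x))"
    unfolding sq_int_def by (auto intro: measurable_compose)
qed

lemma of_real_cmod_square: "(complex_of_real (cmod z))\<^sup>2 = z * cnj z"
  by (metis complex_norm_square of_real_power)

lemma sq_int_bounded_mult:
  assumes f: "sq_int M f" and h: "h \<in> borel_measurable M" "\<And>x. cmod (h x) \<le> B"
  shows "sq_int M (\<lambda>x. h x * f x)"
  unfolding sq_int_def
proof
  have [measurable]: "f \<in> borel_measurable M" "h \<in> borel_measurable M" using f h by (auto simp: sq_int_def)
  show "(\<lambda>x. h x * f x) \<in> borel_measurable M" by measurable
  show "integrable M (\<lambda>x. (cmod (h x * f x))\<^sup>2)"
  proof (rule Bochner_Integration.integrable_bound[of M "\<lambda>x. B\<^sup>2 * (cmod (f x))\<^sup>2"])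
    show "AE x in M. norm ((cmod (h x * f x))\<^sup>2) \<le> norm (B\<^sup>2 * (cmod (f x))\<^sup>2)"
      using h(2) by (auto simp: norm_mult power_mult_distrib intro!: mult_right_mono power_mono)
  qed (use f in \<open>auto simp: sq_int_def\<close>)
qed

lemma sq_int_scale: "sq_int M f \<Longrightarrow> sq_int M (\<lambda>x. c * f x)"
  by (rule sq_int_bounded_mult) auto

lemma sq_int_diff: "sq_int M f \<Longrightarrow> sq_int M g \<Longrightarrow> sq_int M (\<lambda>x. f x - g x)"
  using sq_int_add[of M f "\<lambda>x. -1 * g x"] sq_int_scale[of M g "-1"] by simp

lemma sq_int_sum: "finite A \<Longrightarrow> (\<And>k. k \<in> A \<Longrightarrow> sq_int M (f k)) \<Longrightarrow> sq_int M (\<lambda>x. \<Sum>k\<in>A. f k x)"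
proof (induction rule: finite_induct)
  case empty
  then show ?case by (simp add: sq_int_def)
next
  case (insert a A)
  then show ?case by (simp add: sq_int_add)
qed

lemma sq_int_mult_integrable:
  assumes "sq_int M f" "sq_int M g" shows "integrable M (\<lambda>x. f x * g x)"
proof (rule Bochner_Integration.integrable_bound)
  show "integrable M (\<lambda>x. (cmod (f x))\<^sup>2 + (cmod (g x))\<^sup>2)"
    using assms by (intro Bochner_Integration.integrable_add) (auto simp: sq_int_def)
  show "AE x in M. norm (f x * g x) \<le> norm ((cmod (f x))\<^sup>2 + (cmod (g x))\<^sup>2)"
    using cmod_mult_le_squares by (auto intro: order.trans[OF _ abs_ge_self])
qed (use assms in \<open>auto simp: sq_int_def\<close>)

text \<open>Additive form of the Cauchy-Schwarz inequality; the weight \<open>t\<close> is left to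
  the application.\<close>

lemma sq_int_mult_integral_le:
  assumes "sq_int M f" "sq_int M g" "t > 0"
  shows "cmod (\<integral>x. f x * g x \<partial>M) \<le> t * (\<integral>x. (cmod (f x))\<^sup>2 \<partial>M) + (\<integral>x. (cmod (g x))\<^sup>2 \<partial>M) / t"
proof -
  have "cmod (\<integral>x. f x * g x \<partial>M) \<le> (\<integral>x. cmod (f x * g x) \<partial>M)"
    by (rule integral_norm_bound)
  also have "\<dots> \<le> (\<integral>x. t * (cmod (f x))\<^sup>2 + (cmod (g x))\<^sup>2 / t \<partial>M)"
  proof (rule integral_mono)
    show "integrable M (\<lambda>x. cmod (f x * g x))"
      by (intro integrable_norm sq_int_mult_integrable assms)
    show "integrable M (\<lambda>x. t * (cmod (f x))\<^sup>2 + (cmod (g x))\<^sup>2 / t)"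
      using assms by (auto simp: sq_int_def)
    fix x
    have "cmod (of_real (sqrt t) * f x * (g x / of_real (sqrt t))) \<le> t * (cmod (f x))\<^sup>2 + (cmod (g x))\<^sup>2 / t"
      using cmod_mult_le_squares[of "of_real (sqrt t) * f x" "g x / of_real (sqrt t)"] assms(3)
      by (simp add: norm_mult norm_divide power_mult_distrib power_divide)
    then show "cmod (f x * g x) \<le> t * (cmod (f x))\<^sup>2 + (cmod (g x))\<^sup>2 / t"
      using assms(3) by simp
  qed
  also have "\<dots> = t * (\<integral>x. (cmod (f x))\<^sup>2 \<partial>M) + (\<integral>x. (cmod (g x))\<^sup>2 \<partial>M) / t"
    using assms by (simp add: sq_int_def)
  finally show ?thesis .
qed

lemma sq_int_tendsto:
  assumes f: "\<And>n. sq_int M (f n)" and g: "sq_int M g"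
    and lim: "(\<lambda>n. \<integral>x. (cmod (f n x))\<^sup>2 \<partial>M) \<longlonglongrightarrow> 0"
  shows "(\<lambda>n. \<integral>x. f n x * g x \<partial>M) \<longlonglongrightarrow> 0"
proof (rule tendstoI)
  fix e :: real assume e: "e > 0"
  define G where "G = (\<integral>x. (cmod (g x))\<^sup>2 \<partial>M)"
  have G: "G \<ge> 0" unfolding G_def by (rule integral_nonneg_AE) simp
  define t where "t = 2 * (G + 1) / e"
  have t: "t > 0" using e G by (simp add: t_def)
  have Ge: "0 < G * e + e" using G e by (intro add_nonneg_pos) auto
  have Gt: "G / t < e / 2" using e G Ge by (simp add: t_def field_simps)
  have "\<forall>\<^sub>F n in sequentially. \<bar>\<integral>x. (cmod (f n x))\<^sup>2 \<partial>M\<bar> < e / (2 * t)"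
    using tendstoD[OF lim, of "e / (2 * t)"] e t by simp
  then show "\<forall>\<^sub>F n in sequentially. dist (\<integral>x. f n x * g x \<partial>M) 0 < e"
  proof eventually_elim
    case (elim n)
    then have "t * (\<integral>x. (cmod (f n x))\<^sup>2 \<partial>M) < e / 2" using t by (simp add: field_simps)
    then show ?case using sq_int_mult_integral_le[OF f g t, of n] Gt
      unfolding G_def dist_norm diff_0_right by linarith
  qed
qed

section \<open>Expansion in the orthonormal polynomials\<close>

locale orthonormal =
  fixes b :: "nat \<Rightarrow> real" and M :: "real measure"
  assumes om: "orthonormal_measure b M"
begin

sublocale real_distribution M using om by (simp add: orthonormal_measure_def)

lemma fbm: "finite_borel_measure M" by unfold_locales

abbreviation P :: "nat \<Rightarrow> real \<Rightarrow> complex" where "P k x \<equiv> complex_of_real (P_real b k x)"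

lemma P_rec: "n \<ge> 1 \<Longrightarrow> P (Suc n) x = (of_real x - of_real (b n)) * P n x - P (n - 1) x"
  by (cases n) (auto simp: P_real_rec)

lemma P_orthonormal:
  assumes "j \<ge> 1" "k \<ge> 1" shows "has_bochner_integral M (\<lambda>x. P j x * P k x) (if j = k then 1 else 0)"
proof -
  have "has_bochner_integral M (\<lambda>x. complex_of_real (P_real b j x * P_real b k x)) (of_real (if j = k then 1 else 0))"
    using om assms by (intro has_bochner_integral_of_real) (auto simp: orthonormal_measure_def)
  then show ?thesis by (simp add: if_distrib cong: if_cong)
qed

lemma sq_int_P: "sq_int M (P k)"
proof (cases "k = 0")
  case True
  then show ?thesis by (simp add: sq_int_def)
next
  case False
  have "integrable M (\<lambda>x. P_real b k x * P_real b k x)"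
    using om False by (auto simp: orthonormal_measure_def has_bochner_integral_iff)
  then show ?thesis unfolding sq_int_def by (simp add: power2_eq_square)
qed

definition p :: "(nat \<Rightarrow> complex) \<Rightarrow> nat set \<Rightarrow> real \<Rightarrow> complex" where
  "p u A x = (\<Sum>k\<in>A. u k * P k x)"

lemma sq_int_p: "finite A \<Longrightarrow> sq_int M (p u A)"
  unfolding p_def by (intro sq_int_sum sq_int_scale sq_int_P)

lemma p_coeff:
  assumes "finite A" "0 \<notin> A" "j \<ge> 1"
  shows "(\<integral>x. p u A x * P j x \<partial>M) = (if j \<in> A then u j else 0)"
proof -
  have i: "integrable M (\<lambda>x. u k * (P k x * P j x))" for k
    by (intro integrable_mult_right sq_int_mult_integrable sq_int_P)
  have "(\<integral>x. p u A x * P j x \<partial>M) = (\<integral>x. (\<Sum>k\<in>A. u k * (P k x * P j x)) \<partial>M)"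
    unfolding p_def by (simp add: sum_distrib_right mult.assoc)
  also have "\<dots> = (\<Sum>k\<in>A. \<integral>x. u k * (P k x * P j x) \<partial>M)"
    by (intro Bochner_Integration.integral_sum i)
  also have "\<dots> = (\<Sum>k\<in>A. u k * (if k = j then 1 else 0))"
  proof (rule sum.cong[OF refl])
    fix k assume "k \<in> A"
    then have "k \<ge> 1" using assms(2) by (cases k) auto
    from P_orthonormal[OF this assms(3)]
    show "(\<integral>x. u k * (P k x * P j x) \<partial>M) = u k * (if k = j then 1 else 0)"
      by (simp add: has_bochner_integral_iff)
  qed
  also have "\<dots> = (if j \<in> A then u j else 0)" using assms(1) by (simp add: if_distrib sum.delta' cong: if_cong)
  finally show ?thesis .
qed

lemma integral_mult_cnj_p:
  assumes g: "sq_int M g" and A: "finite A"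
  shows "(\<integral>x. g x * cnj (p u A x) \<partial>M) = (\<Sum>k\<in>A. cnj (u k) * (\<integral>x. g x * P k x \<partial>M))"
proof -
  have "(\<integral>x. g x * cnj (p u A x) \<partial>M) = (\<integral>x. (\<Sum>k\<in>A. cnj (u k) * (g x * P k x)) \<partial>M)"
    unfolding p_def by (simp add: sum_distrib_left mult_ac)
  also have "\<dots> = (\<Sum>k\<in>A. \<integral>x. cnj (u k) * (g x * P k x) \<partial>M)"
    by (intro Bochner_Integration.integral_sum integrable_mult_right sq_int_mult_integrable sq_int_P g)
  finally show ?thesis by simp
qed

lemma cmod_square_diff: "(cmod (a - c))\<^sup>2 = (cmod a)\<^sup>2 - 2 * Re (a * cnj c) + (cmod c)\<^sup>2"
  unfolding cmod_power2 by (simp add: power2_eq_square algebra_simps)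

lemma p_norm:
  assumes "finite A" "0 \<notin> A"
  shows "(\<integral>x. (cmod (p u A x))\<^sup>2 \<partial>M) = (\<Sum>k\<in>A. (cmod (u k))\<^sup>2)"
proof -
  have "complex_of_real (\<integral>x. (cmod (p u A x))\<^sup>2 \<partial>M) = (\<integral>x. p u A x * cnj (p u A x) \<partial>M)"
    unfolding complex_norm_square[symmetric] by (rule integral_complex_of_real[symmetric])
  also have "\<dots> = (\<Sum>k\<in>A. cnj (u k) * (\<integral>x. p u A x * P k x \<partial>M))"
    by (rule integral_mult_cnj_p[OF sq_int_p assms(1)]) (rule assms)
  also have "\<dots> = (\<Sum>k\<in>A. cnj (u k) * u k)"
  proof (rule sum.cong[OF refl])
    fix k assume k: "k \<in> A"
    then have "k \<ge> 1" using assms(2) by (cases k) auto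
    then show "cnj (u k) * (\<integral>x. p u A x * P k x \<partial>M) = cnj (u k) * u k"
      using k by (simp add: p_coeff[OF assms])
  qed
  also have "\<dots> = of_real (\<Sum>k\<in>A. (cmod (u k))\<^sup>2)"
    by (simp add: of_real_cmod_square mult.commute)
  finally show ?thesis by (simp only: of_real_eq_iff)
qed

lemma bessel:
  assumes g: "sq_int M g" and A: "finite A" "0 \<notin> A"
  shows "(\<Sum>k\<in>A. (cmod (\<integral>x. g x * P k x \<partial>M))\<^sup>2) \<le> (\<integral>x. (cmod (g x))\<^sup>2 \<partial>M)"
proof -
  define c where "c k = (\<integral>x. g x * P k x \<partial>M)" for k
  have i: "integrable M (\<lambda>x. (cmod (g x))\<^sup>2)" "integrable M (\<lambda>x. (cmod (p c A x))\<^sup>2)"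
    "integrable M (\<lambda>x. Re (g x * cnj (p c A x)))"
    using g sq_int_p[OF A(1), of c]
      integrable_bounded_linear[OF bounded_linear_Re sq_int_mult_integrable[OF g sq_int_cnj[OF sq_int_p[OF A(1), of c]]]]
    unfolding sq_int_def by blast+
  have "0 \<le> (\<integral>x. (cmod (g x - p c A x))\<^sup>2 \<partial>M)" by (rule integral_nonneg_AE) simp
  also have "\<dots> = (\<integral>x. (cmod (g x))\<^sup>2 \<partial>M) - 2 * (\<integral>x. Re (g x * cnj (p c A x)) \<partial>M) + (\<integral>x. (cmod (p c A x))\<^sup>2 \<partial>M)"
    unfolding cmod_square_diff using i
    by (simp only: Bochner_Integration.integral_add Bochner_Integration.integral_diff
        Bochner_Integration.integrable_diff integrable_mult_right integral_mult_right_zero)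
  also have "(\<integral>x. Re (g x * cnj (p c A x)) \<partial>M) = Re (\<integral>x. g x * cnj (p c A x) \<partial>M)"
    by (rule integral_bounded_linear[OF bounded_linear_Re sq_int_mult_integrable[OF g sq_int_cnj[OF sq_int_p[OF A(1), of c]]]])
  also have "(\<integral>x. g x * cnj (p c A x) \<partial>M) = (\<Sum>k\<in>A. cnj (c k) * c k)"
    unfolding integral_mult_cnj_p[OF g A(1)] c_def ..
  also have "\<dots> = of_real (\<Sum>k\<in>A. (cmod (c k))\<^sup>2)"
    by (simp add: of_real_cmod_square mult.commute)
  finally show ?thesis unfolding p_norm[OF A] c_def by simp
qed

lemma coeffs_in_l2:
  assumes g: "sq_int M g"
  shows "(\<lambda>k. \<integral>x. g x * P k x \<partial>M) \<in> l2"
  unfolding l2_def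
proof (intro CollectI conjI)
  show "(\<integral>x. g x * P 0 x \<partial>M) = 0" by simp
  show "summable (\<lambda>n. (cmod (\<integral>x. g x * P n x \<partial>M))\<^sup>2)"
  proof (rule summableI_nonneg_bounded)
    fix n
    have "(\<Sum>i<n. (cmod (\<integral>x. g x * P i x \<partial>M))\<^sup>2) = (\<Sum>i\<in>{..<n} - {0}. (cmod (\<integral>x. g x * P i x \<partial>M))\<^sup>2)"
      by (rule sum.mono_neutral_right) auto
    also have "\<dots> \<le> (\<integral>x. (cmod (g x))\<^sup>2 \<partial>M)" by (rule bessel[OF g]) auto
    finally show "(\<Sum>i<n. (cmod (\<integral>x. g x * P i x \<partial>M))\<^sup>2) \<le> (\<integral>x. (cmod (g x))\<^sup>2 \<partial>M)" .
  qed simp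
qed

lemma nonreal_Im: "z \<notin> \<real> \<Longrightarrow> Im z \<noteq> 0" by (simp add: complex_is_Real_iff)

lemma sq_int_cauchy:
  "sq_int M f \<Longrightarrow> Im z \<noteq> 0 \<Longrightarrow> sq_int M (\<lambda>x. 1 / (of_real x - z) * f x)"
  using cauchy_kernel_norm_le(2)[of z] by (intro sq_int_bounded_mult) auto

text \<open>Multiplying \<open>1 / (x - z) * f\<close> by x is the same as multiplying it by z and
  adding \<open>f\<close>; in coefficients with respect to \<open>P\<close>, multiplication by x is
  the Jacobi matrix. Hence \<open>v\<close> solves the resolvent equation whose right side consists
  of the coefficients of \<open>f\<close>.\<close>

lemma resolvent_coeff_rec:
  assumes f: "sq_int M f" and z: "Im z \<noteq> 0" and n: "n \<ge> 1"
  defines "v \<equiv> \<lambda>k. \<integral>x. 1 / (of_real x - z) * f x * P k x \<partial>M"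
  shows "v (Suc n) = (\<integral>x. f x * P n x \<partial>M) + (z - of_real (b n)) * v n - v (n - 1)"
proof -
  note c = sq_int_cauchy[OF f z]
  have i: "integrable M (\<lambda>x. 1 / (of_real x - z) * f x * P k x)" for k
    by (rule sq_int_mult_integrable[OF c sq_int_P])
  have i': "integrable M (\<lambda>x. f x * P k x)" for k
    by (rule sq_int_mult_integrable[OF f sq_int_P])
  have "1 / (of_real x - z) * f x * P (Suc n) x =
      f x * P n x + ((z - of_real (b n)) * (1 / (of_real x - z) * f x * P n x) - 1 / (of_real x - z) * f x * P (n - 1) x)" for x
  proof -
    have d: "1 / (of_real x - z) * (of_real x - z) = 1" using cauchy_kernel_norm_le(1)[OF z, of x] by simp
    show ?thesis unfolding P_rec[OF n] using d by algebra
  qed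
  then have "v (Suc n) = (\<integral>x. f x * P n x + ((z - of_real (b n)) * (1 / (of_real x - z) * f x * P n x) - 1 / (of_real x - z) * f x * P (n - 1) x) \<partial>M)"
    unfolding v_def by simp
  also have "\<dots> = (\<integral>x. f x * P n x \<partial>M) + ((\<integral>x. (z - of_real (b n)) * (1 / (of_real x - z) * f x * P n x) \<partial>M) - v (n - 1))"
  proof -
    have 1: "integrable M (\<lambda>x. (z - of_real (b n)) * (1 / (of_real x - z) * f x * P n x))"
      by (rule integrable_mult_right[OF i])
    show ?thesis
      unfolding v_def Bochner_Integration.integral_add[OF i' Bochner_Integration.integrable_diff[OF 1 i]]
        Bochner_Integration.integral_diff[OF 1 i] ..
  qed
  also have "(\<integral>x. (z - of_real (b n)) * (1 / (of_real x - z) * f x * P n x) \<partial>M) = (z - of_real (b n)) * v n"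
    unfolding v_def by (rule integral_mult_right_zero)
  finally show ?thesis by simp
qed

end

section \<open>Square summable solutions and the resolvent\<close>

lemma l2_products_to_zero:
  assumes "v \<in> l2" shows "(\<lambda>n. v (Suc n) * cnj (v n)) \<longlonglongrightarrow> 0"
proof -
  have "summable (\<lambda>n. (cmod (v n))\<^sup>2)" using assms by (simp add: l2_def)
  then have "(\<lambda>n. (cmod (v n))\<^sup>2) \<longlonglongrightarrow> 0" by (rule summable_LIMSEQ_zero)
  from tendsto_add[OF LIMSEQ_Suc[OF this] this]
  have "(\<lambda>n. (cmod (v (Suc n)))\<^sup>2 + (cmod (v n))\<^sup>2) \<longlonglongrightarrow> 0" by simp
  then show ?thesis
    by (rule Lim_null_comparison[rotated]) (use cmod_mult_le_squares[of "v (Suc n)" "cnj (v n)" for n] in \<open>auto\<close>)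
qed

text \<open>Essential self-adjointness: the Wronskian of an eigenfunction with its conjugate grows,
  but it tends to zero along a square summable sequence.\<close>

lemma l2_eigenfunction_zero:
  assumes v: "v \<in> l2" and z: "Im z \<noteq> 0" and eq: "\<And>n. n \<ge> 1 \<Longrightarrow> v (Suc n) = (z - of_real (b n)) * v n - v (n - 1)"
  shows "v n = 0"
proof (rule ccontr)
  assume nz: "v n \<noteq> 0"
  have v0: "v 0 = 0" using v by (simp add: l2_def)
  have W: "Im (v (Suc m) * cnj (v m)) = Im z * (\<Sum>k\<le>m. (cmod (v k))\<^sup>2)" for m
  proof (induction m)
    case (Suc m)
    have e: "v (Suc (Suc m)) * cnj (v (Suc m)) =
      (z - of_real (b (Suc m))) * of_real ((cmod (v (Suc m)))\<^sup>2) - v m * cnj (v (Suc m))"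
    proof -
      have r: "v (Suc (Suc m)) = (z - of_real (b (Suc m))) * v (Suc m) - v m"
        using eq[of "Suc m"] by simp
      show ?thesis unfolding r complex_norm_square by (simp add: algebra_simps)
    qed
    have 1: "Im ((z - of_real (b (Suc m))) * of_real ((cmod (v (Suc m)))\<^sup>2)) = Im z * (cmod (v (Suc m)))\<^sup>2"
      by (simp del: of_real_power)
    have "Im (v (Suc (Suc m)) * cnj (v (Suc m))) = Im z * (cmod (v (Suc m)))\<^sup>2 + Im (v (Suc m) * cnj (v m))"
      unfolding e minus_complex.simps 1 by simp
    then show ?case using Suc by (simp add: algebra_simps)
  qed (simp add: v0)
  have "(\<lambda>m. \<bar>Im (v (Suc m) * cnj (v m))\<bar>) \<longlonglongrightarrow> 0"
    using tendsto_rabs[OF tendsto_Im[OF l2_products_to_zero[OF v]]] by simp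
  moreover have "\<bar>Im z\<bar> * (cmod (v n))\<^sup>2 \<le> \<bar>Im (v (Suc m) * cnj (v m))\<bar>" if "m \<ge> n" for m
  proof -
    have "(cmod (v n))\<^sup>2 \<le> (\<Sum>k\<le>m. (cmod (v k))\<^sup>2)"
      using that by (intro member_le_sum) auto
    moreover have "(\<Sum>k\<le>m. (cmod (v k))\<^sup>2) \<ge> 0" by (intro sum_nonneg) auto
    ultimately show ?thesis unfolding W abs_mult by (intro mult_left_mono) auto
  qed
  ultimately have "\<bar>Im z\<bar> * (cmod (v n))\<^sup>2 \<le> 0"
    by (intro LIMSEQ_le_const) auto
  then show False using z nz by (simp add: mult_le_0_iff)
qed

text \<open>Since \<open>v 0 = 0\<close>, the special first row of the matrix takes the same form as
  the others.\<close>

lemma jacobi_eq_iff: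
  assumes "v 0 = 0" "u 0 = 0"
  shows "(\<forall>n. jacobi b v n - z * v n = u n) \<longleftrightarrow> (\<forall>n\<ge>1. v (Suc n) = u n + (z - of_real (b n)) * v n - v (n - 1))"
proof -
  have "jacobi b v n - z * v n = u n \<longleftrightarrow> (n \<ge> 1 \<longrightarrow> v (Suc n) = u n + (z - of_real (b n)) * v n - v (n - 1))" for n
    using assms unfolding jacobi_def by (cases "n = 0"; cases "n = 1") (auto simp: algebra_simps numeral_2_eq_2)
  then show ?thesis by simp
qed

text \<open>Two solutions differ by a square summable solution of the homogeneous recurrence at
  nonreal z, which vanishes; so exhibiting one solution evaluates the definite description.\<close>

lemma jacobi_resolvent_eqI:
  assumes v: "v \<in> l2" and u: "u \<in> l2" and z: "Im z \<noteq> 0"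
    and eq: "\<And>n. n \<ge> 1 \<Longrightarrow> v (Suc n) = u n + (z - of_real (b n)) * v n - v (n - 1)"
  shows "jacobi_resolvent b z u = v"
  unfolding jacobi_resolvent_def
proof (rule the_equality)
  have 0: "v 0 = 0" "u 0 = 0" using u v by (auto simp: l2_def)
  show "v \<in> l2 \<and> (\<forall>n. jacobi b v n - z * v n = u n)"
    unfolding jacobi_eq_iff[where v = v and u = u, OF 0] using v eq by blast
  fix v' assume v': "v' \<in> l2 \<and> (\<forall>n. jacobi b v' n - z * v' n = u n)"
  have v0': "v' 0 = 0" using v' by (auto simp: l2_def)
  have eq': "v' (Suc n) = u n + (z - of_real (b n)) * v' n - v' (n - 1)" if "n \<ge> 1" for n
    using v' that unfolding jacobi_eq_iff[where v = v' and u = u, OF v0' 0(2)] by blast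
  have "(\<lambda>n. v' n - v n) \<in> l2"
    unfolding l2_def
  proof (intro CollectI conjI)
    show "summable (\<lambda>n. (cmod (v' n - v n))\<^sup>2)"
    proof (rule summable_comparison_test'[where N = 0])
      show "summable (\<lambda>n. 2 * (cmod (v' n))\<^sup>2 + 2 * (cmod (v n))\<^sup>2)"
        using v v' by (intro summable_add summable_mult) (auto simp: l2_def)
      show "norm ((cmod (v' n - v n))\<^sup>2) \<le> 2 * (cmod (v' n))\<^sup>2 + 2 * (cmod (v n))\<^sup>2" for n
        using cmod_add_square_le[of "v' n" "- v n"] by simp
    qed
  qed (simp add: 0 v0')
  note l2 = this
  have "v' n - v n = 0" for n
    by (rule l2_eigenfunction_zero[OF l2 z, of b]) (simp add: eq eq' algebra_simps)
  then show "v' = v" by (simp add: fun_eq_iff)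
qed

context orthonormal
begin

text \<open>The coefficients of the Cauchy kernel with respect to \<open>P\<close> are square
  summable by Bessel's inequality and obey the recurrence of
  \<open>Q_poly b n z + m * P_poly b n z\<close>, where \<open>m\<close> is the coefficient of index
  1. A second admissible \<open>m'\<close> would make a multiple of \<open>P_poly\<close> square
  summable.\<close>

theorem weyl_m_eq:
  assumes z: "Im z \<noteq> 0"
  shows "weyl_m b z = (\<integral>x. 1 / (of_real x - z) \<partial>M)"
proof -
  have one: "sq_int M (\<lambda>x. 1)" by (simp add: sq_int_def)
  let ?v = "\<lambda>k. \<integral>x. 1 / (of_real x - z) * 1 * P k x \<partial>M"
  define m where "m = (\<integral>x. 1 / (of_real x - z) \<partial>M)"
  have P1: "(\<integral>x. 1 * P n x \<partial>M) = (if n = 1 then 1 else 0)" if "n \<ge> 1" for n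
    using P_orthonormal[of 1 n] that by (auto simp: has_bochner_integral_iff)
  have v: "Q_poly b n z + m * P_poly b n z = ?v n \<and> Q_poly b (Suc n) z + m * P_poly b (Suc n) z = ?v (Suc n)" for n
  proof (induction n)
    case 0
    then show ?case by (simp add: m_def)
  next
    case (Suc n)
    \<comment> \<open>Started from index 0, \<open>Q_poly\<close> breaks the recurrence once, by
      exactly 1; this matches the first basis vector on the right of the resolvent equation.\<close>
    have "Q_poly b (Suc (Suc n)) z = (if n = 0 then 1 else 0) + (z - of_real (b (Suc n))) * Q_poly b (Suc n) z - Q_poly b n z"
      by (cases n) auto
    then have "Q_poly b (Suc (Suc n)) z + m * P_poly b (Suc (Suc n)) z =
        (if n = 0 then 1 else 0) + (z - of_real (b (Suc n))) * (Q_poly b (Suc n) z + m * P_poly b (Suc n) z)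
        - (Q_poly b n z + m * P_poly b n z)"
      unfolding P_poly_rec by (simp add: algebra_simps)
    also have "\<dots> = ?v (Suc (Suc n))"
      unfolding resolvent_coeff_rec[OF one z, of "Suc n", OF le_add1[of 1 n, unfolded plus_1_eq_Suc]]
      using Suc P1[of "Suc n"] by simp
    finally show ?case using Suc by simp
  qed
  have ml2: "(\<lambda>n. Q_poly b n z + m * P_poly b n z) \<in> l2"
    using coeffs_in_l2[OF sq_int_cauchy[OF one z]] v by (simp add: fun_eq_iff[symmetric])
  show ?thesis
    unfolding weyl_m_def m_def[symmetric]
  proof (rule the_equality[where P = "\<lambda>m. (\<lambda>n. Q_poly b n z + m * P_poly b n z) \<in> l2", OF ml2])
    fix m' assume m': "(\<lambda>n. Q_poly b n z + m' * P_poly b n z) \<in> l2"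
    let ?d = "\<lambda>n. (m' - m) * P_poly b n z"
    have "?d \<in> l2"
      unfolding l2_def
    proof (intro CollectI conjI)
      show "summable (\<lambda>n. (cmod (?d n))\<^sup>2)"
      proof (rule summable_comparison_test'[where N = 0])
        show "summable (\<lambda>n. 2 * (cmod (Q_poly b n z + m' * P_poly b n z))\<^sup>2 + 2 * (cmod (Q_poly b n z + m * P_poly b n z))\<^sup>2)"
          using ml2 m' by (intro summable_add summable_mult) (auto simp: l2_def)
        show "norm ((cmod (?d n))\<^sup>2) \<le> 2 * (cmod (Q_poly b n z + m' * P_poly b n z))\<^sup>2 + 2 * (cmod (Q_poly b n z + m * P_poly b n z))\<^sup>2" for n
        proof -
          have "?d n = (Q_poly b n z + m' * P_poly b n z) + - (Q_poly b n z + m * P_poly b n z)"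
            by (simp add: algebra_simps)
          then show ?thesis
            using cmod_add_square_le[of "Q_poly b n z + m' * P_poly b n z" "- (Q_poly b n z + m * P_poly b n z)"]
            by (simp only: norm_minus_cancel) simp
        qed
      qed
    qed simp
    then have "?d 1 = 0"
    proof -
      have "?d (Suc n) = (z - of_real (b n)) * ?d n - ?d (n - 1)" if n: "n \<ge> 1" for n
      proof -
        obtain k where "n = Suc k" using n by (cases n) auto
        then show ?thesis by (simp add: P_poly_rec algebra_simps del: P_poly.simps(3,4))
      qed
      then show ?thesis using l2_eigenfunction_zero[OF \<open>?d \<in> l2\<close> z, of b 1] by blast
    qed
    then show "m' = m" by simp
  qed
qed

text \<open>Along a subsequence with tails below \<open>(1/4) ^ j\<close> the partial sums converge
  almost everywhere, and Fatou's lemma upgrades this to convergence in mean square.\<close>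

lemma riesz_fischer:
  assumes u: "u \<in> l2"
  shows "\<exists>f r. sq_int M f \<and> strict_mono (r::nat\<Rightarrow>nat) \<and> (\<lambda>j. \<integral>x. (cmod (f x - p u {1..r j} x))\<^sup>2 \<partial>M) \<longlonglongrightarrow> 0"
proof -
  have sm: "summable (\<lambda>n. (cmod (u n))\<^sup>2)" using u by (simp add: l2_def)
  have ex: "\<exists>N. \<forall>m\<ge>N. \<forall>n. (\<Sum>k\<in>{m<..n}. (cmod (u k))\<^sup>2) < e" if e: "e > 0" for e
  proof -
    obtain N where N: "\<And>m n. m \<ge> N \<Longrightarrow> norm (\<Sum>k\<in>{m..<n}. (cmod (u k))\<^sup>2) < e"
      using sm[unfolded summable_Cauchy] e by blast
    have "(\<Sum>k\<in>{m<..n}. (cmod (u k))\<^sup>2) < e" if "m \<ge> N" for m n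
    proof -
      have "{m<..n} = {Suc m..<Suc n}" by auto
      then show ?thesis using N[of "Suc m" "Suc n"] that by simp
    qed
    then show ?thesis by blast
  qed
  have "\<forall>j. \<exists>N. \<forall>m\<ge>N. \<forall>n. (\<Sum>k\<in>{m<..n}. (cmod (u k))\<^sup>2) < (1/4) ^ j"
    by (intro allI ex) simp
  then obtain N where N: "\<And>j m n. m \<ge> N j \<Longrightarrow> (\<Sum>k\<in>{m<..n}. (cmod (u k))\<^sup>2) < (1/4) ^ j"
    by metis
  define r where "r j = j + (\<Sum>i\<le>j. N i)" for j
  have r: "strict_mono r" by (auto simp: r_def strict_mono_Suc_iff)
  have rN: "r j \<ge> N j" for j
  proof -
    have "N j \<le> (\<Sum>i\<le>j. N i)" by (rule member_le_sum) auto
    then show ?thesis by (simp add: r_def)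
  qed
  let ?p = "\<lambda>j. p u {1..r j}"
  have pd: "(\<integral>x. (cmod (?p i x - ?p j x))\<^sup>2 \<partial>M) \<le> (1/4) ^ j" if "i \<ge> j" for i j
  proof -
    have rr: "r j \<le> r i" using r that by (simp add: strict_mono_less_eq)
    then have U: "{1..r i} = {1..r j} \<union> {r j<..r i}" by auto
    have "?p i x = ?p j x + p u {r j<..r i} x" for x
      unfolding p_def U by (rule sum.union_disjoint) auto
    then have "?p i x - ?p j x = p u {r j<..r i} x" for x by simp
    then show ?thesis using N[OF rN, of j "r i"] by (simp add: p_norm)
  qed
  have sqp: "sq_int M (?p j)" for j by (rule sq_int_p) simp
  have pm [measurable]: "?p j \<in> borel_measurable M" for j using sqp by (rule sq_int_measurable)
  define d where "d j x = ?p (Suc j) x - ?p j x" for j x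
  have sqd: "sq_int M (d j)" for j unfolding d_def by (intro sq_int_diff sqp)
  have dm [measurable]: "d j \<in> borel_measurable M" for j using sqd by (rule sq_int_measurable)
  have one: "sq_int M (\<lambda>x. 1)" by (simp add: sq_int_def)
  have dint: "integrable M (\<lambda>x. cmod (d j x))" for j
    using sq_int_mult_integrable[OF sqd one] by auto
  \<comment> \<open>The weight \<open>2 ^ j\<close> balances the two terms: squared norms of order
    \<open>(1/4) ^ j\<close> give integrals of order \<open>(1/2) ^ j\<close>, whose sum is
    finite.\<close>
  have dL1: "(\<integral>x. cmod (d j x) \<partial>M) \<le> 2 * (1/2) ^ j" for j
  proof -
    have "(\<integral>x. cmod (d j x) \<partial>M) \<le> (\<integral>x. 2 ^ j * (cmod (d j x))\<^sup>2 + (1/2) ^ j \<partial>M)"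
    proof (rule integral_mono[OF dint])
      show "integrable M (\<lambda>x. 2 ^ j * (cmod (d j x))\<^sup>2 + (1/2) ^ j)" using sqd by (auto simp: sq_int_def)
      fix x
      have "0 \<le> (2 ^ j * cmod (d j x) - 1)\<^sup>2" by simp
      also have "\<dots> = 2 ^ j * (2 ^ j * (cmod (d j x))\<^sup>2) - 2 * (2 ^ j * cmod (d j x)) + 1"
        by (simp add: power2_eq_square algebra_simps)
      finally have 1: "2 * (2 ^ j * cmod (d j x)) \<le> 2 ^ j * (2 ^ j * (cmod (d j x))\<^sup>2) + 1" by simp
      have "2 ^ j * cmod (d j x) \<le> 2 ^ j * (2 ^ j * (cmod (d j x))\<^sup>2) + 1"
      proof -
        have "0 \<le> 2 ^ j * cmod (d j x)" by simp
        then show ?thesis using 1 by linarith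
      qed
      then show "cmod (d j x) \<le> 2 ^ j * (cmod (d j x))\<^sup>2 + (1/2) ^ j"
        by (simp add: power_divide field_simps)
    qed
    also have "\<dots> = 2 ^ j * (\<integral>x. (cmod (d j x))\<^sup>2 \<partial>M) + (1/2) ^ j"
      using sqd prob_space by (subst Bochner_Integration.integral_add) (auto simp: sq_int_def)
    also have "\<dots> \<le> 2 ^ j * (1/4) ^ j + (1/2) ^ j"
      unfolding d_def by (intro add_right_mono mult_left_mono pd) auto
    also have "2 ^ j * (1/4) ^ j = (1/2::real) ^ j" by (simp flip: power_mult_distrib)
    finally show ?thesis by simp
  qed
  have "(\<integral>\<^sup>+x. (\<Sum>j. ennreal (cmod (d j x))) \<partial>M) = (\<Sum>j. \<integral>\<^sup>+x. ennreal (cmod (d j x)) \<partial>M)"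
    by (rule nn_integral_suminf) measurable
  also have "\<dots> \<le> (\<Sum>j. ennreal (2 * (1/2) ^ j))"
    using dL1 by (intro suminf_le) (auto simp: nn_integral_eq_integral[OF dint] intro!: ennreal_leI)
  also have "\<dots> = ennreal (\<Sum>j. 2 * (1/2) ^ j)"
    by (rule suminf_ennreal2) (auto intro!: summable_mult summable_geometric)
  finally have fin: "(\<integral>\<^sup>+x. (\<Sum>j. ennreal (cmod (d j x))) \<partial>M) \<noteq> \<infinity>"
    by (auto simp: top_unique)
  have "AE x in M. (\<Sum>j. ennreal (cmod (d j x))) \<noteq> \<infinity>"
    by (rule nn_integral_noteq_infinite[OF _ fin]) measurable
  then have AEc: "AE x in M. convergent (\<lambda>j. ?p j x)"
  proof eventually_elim
    case (elim x)
    have "summable (\<lambda>j. cmod (d j x))"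
      using elim by (intro summable_suminf_not_top) auto
    then have "summable (\<lambda>j. d j x)" by (rule summable_norm_cancel)
    then have "convergent (\<lambda>n. \<Sum>j<n. d j x)" by (simp add: summable_iff_convergent)
    moreover have "(\<Sum>j<n. d j x) = ?p n x - ?p 0 x" for n
      unfolding d_def by (rule sum_lessThan_telescope)
    ultimately have "convergent (\<lambda>n. ?p n x - ?p 0 x)" by simp
    from convergent_add[OF this convergent_const[of "?p 0 x"]] show ?case by simp
  qed
  define f where "f x = lim (\<lambda>j. ?p j x)" for x
  have fm [measurable]: "f \<in> borel_measurable M"
    unfolding f_def by (rule borel_measurable_lim_metric) (rule pm)
  have AEl: "AE x in M. (\<lambda>j. ?p j x) \<longlonglongrightarrow> f x"
    using AEc by eventually_elim (simp add: f_def convergent_LIMSEQ_iff)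
  have nn: "(\<integral>\<^sup>+x. ennreal ((cmod (f x - ?p j x))\<^sup>2) \<partial>M) \<le> ennreal ((1/4) ^ j)" for j
  proof -
    have "(\<integral>\<^sup>+x. ennreal ((cmod (f x - ?p j x))\<^sup>2) \<partial>M) = (\<integral>\<^sup>+x. liminf (\<lambda>i. ennreal ((cmod (?p i x - ?p j x))\<^sup>2)) \<partial>M)"
    proof (rule nn_integral_cong_AE)
      from AEl show "AE x in M. ennreal ((cmod (f x - ?p j x))\<^sup>2) = liminf (\<lambda>i. ennreal ((cmod (?p i x - ?p j x))\<^sup>2))"
      proof eventually_elim
        case (elim x)
        then have "(\<lambda>i. ennreal ((cmod (?p i x - ?p j x))\<^sup>2)) \<longlonglongrightarrow> ennreal ((cmod (f x - ?p j x))\<^sup>2)"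
          by (intro tendsto_intros)
        then show ?case by (intro lim_imp_Liminf[symmetric]) auto
      qed
    qed
    also have "\<dots> \<le> liminf (\<lambda>i. \<integral>\<^sup>+x. ennreal ((cmod (?p i x - ?p j x))\<^sup>2) \<partial>M)"
      by (rule nn_integral_liminf) measurable
    also have "\<dots> \<le> limsup (\<lambda>i. \<integral>\<^sup>+x. ennreal ((cmod (?p i x - ?p j x))\<^sup>2) \<partial>M)"
      by (rule Liminf_le_Limsup) simp
    also have "\<dots> \<le> ennreal ((1/4) ^ j)"
    proof (rule Limsup_bounded)
      show "\<forall>\<^sub>F i in sequentially. (\<integral>\<^sup>+x. ennreal ((cmod (?p i x - ?p j x))\<^sup>2) \<partial>M) \<le> ennreal ((1/4) ^ j)"
      proof (rule eventually_sequentiallyI[of j])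
        fix i assume "i \<ge> j"
        moreover have "integrable M (\<lambda>x. (cmod (?p i x - ?p j x))\<^sup>2)"
          using sq_int_diff[OF sqp sqp, of i j] by (simp add: sq_int_def)
        ultimately show "(\<integral>\<^sup>+x. ennreal ((cmod (?p i x - ?p j x))\<^sup>2) \<partial>M) \<le> ennreal ((1/4) ^ j)"
          using pd[of j i] by (subst nn_integral_eq_integral) (auto intro!: ennreal_leI)
      qed
    qed
    finally show ?thesis .
  qed
  have sqfp: "sq_int M (\<lambda>x. f x - ?p j x)" for j
    unfolding sq_int_def
  proof
    show "(\<lambda>x. f x - ?p j x) \<in> borel_measurable M" by measurable
    show "integrable M (\<lambda>x. (cmod (f x - ?p j x))\<^sup>2)"
    proof (rule integrableI_nonneg)
      show "(\<lambda>x. (cmod (f x - ?p j x))\<^sup>2) \<in> borel_measurable M" by measurable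
    qed (use nn[of j] in \<open>auto intro: le_less_trans\<close>)
  qed
  have I: "(\<integral>x. (cmod (f x - ?p j x))\<^sup>2 \<partial>M) \<le> (1/4) ^ j" for j
    using nn[of j] sqfp[of j] by (subst (asm) nn_integral_eq_integral) (auto simp: sq_int_def)
  have "sq_int M f" using sq_int_add[OF sqfp[of 0] sqp[of 0]] by simp
  moreover have "(\<lambda>j. \<integral>x. (cmod (f x - ?p j x))\<^sup>2 \<partial>M) \<longlonglongrightarrow> 0"
  proof (rule tendsto_sandwich[OF _ _ tendsto_const])
    show "(\<lambda>j. (1/4::real) ^ j) \<longlonglongrightarrow> 0" by (rule LIMSEQ_power_zero) simp
    show "\<forall>\<^sub>F j in sequentially. 0 \<le> (\<integral>x. (cmod (f x - ?p j x))\<^sup>2 \<partial>M)"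
      by (intro always_eventually allI integral_nonneg_AE) simp
  qed (use I in auto)
  ultimately show ?thesis using r by blast
qed

text \<open>With \<open>f\<close> the function whose coefficients are \<open>u\<close>, the spectral
  measure is \<open>M\<close> with density \<open>(cmod (f x))\<^sup>2\<close>: the resolvent of
  \<open>u\<close> consists of the coefficients of \<open>f\<close> divided by \<open>x - z\<close>,
  and a Parseval identity turns its inner product with \<open>u\<close> into the Stieltjes transform
  of that density.\<close>

theorem spectral_measure_absolutely_continuous:
  assumes u: "u \<in> l2"
  shows "sets (spectral_measure b u) = sets borel" "absolutely_continuous M (spectral_measure b u)"
proof -
  obtain f r where f: "sq_int M f" and r: "strict_mono (r::nat\<Rightarrow>nat)"
    and lim: "(\<lambda>j. \<integral>x. (cmod (f x - p u {1..r j} x))\<^sup>2 \<partial>M) \<longlonglongrightarrow> 0"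
    using riesz_fischer[OF u] by blast
  have fm [measurable]: "f \<in> borel_measurable M" using f by (rule sq_int_measurable)
  have sqd: "sq_int M (\<lambda>x. f x - p u {1..r j} x)" for j
    by (intro sq_int_diff f sq_int_p) simp
  have rj: "r j \<ge> j" for j using r by (rule seq_suble)
  \<comment> \<open>Coefficients are continuous in mean square, and those of the partial sums equal
    \<open>u k\<close> once \<open>r j \<ge> k\<close>.\<close>
  have coeff: "(\<integral>x. f x * P k x \<partial>M) = u k" for k
  proof (cases "k = 0")
    case True
    then show ?thesis using u by (simp add: l2_def)
  next
    case False
    have "(\<lambda>j. \<integral>x. (f x - p u {1..r j} x) * P k x \<partial>M) \<longlonglongrightarrow> 0"
      by (rule sq_int_tendsto[OF sqd sq_int_P lim])
    moreover have "(\<integral>x. (f x - p u {1..r j} x) * P k x \<partial>M) = (\<integral>x. f x * P k x \<partial>M) - u k" if "j \<ge> k" for j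
    proof -
      have "k \<in> {1..r j}" using False rj[of j] that by auto
      then show ?thesis
        using p_coeff[of "{1..r j}" k u] False sq_int_mult_integrable[OF f sq_int_P]
          sq_int_mult_integrable[OF sq_int_p sq_int_P, of "{1..r j}"]
        by (simp add: left_diff_distrib)
    qed
    ultimately have "(\<lambda>j. (\<integral>x. f x * P k x \<partial>M) - u k) \<longlonglongrightarrow> 0"
      by (rule Lim_transform_eventually[OF _ eventually_sequentiallyI])
    then show ?thesis by (simp add: LIMSEQ_const_iff)
  qed
  let ?N = "density M (\<lambda>x. ennreal ((cmod (f x))\<^sup>2))"
  have fin: "finite_measure ?N"
  proof
    have "(\<integral>\<^sup>+x. ennreal ((cmod (f x))\<^sup>2) \<partial>M) = ennreal (\<integral>x. (cmod (f x))\<^sup>2 \<partial>M)"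
      using f by (intro nn_integral_eq_integral) (auto simp: sq_int_def)
    then show "emeasure ?N (space ?N) \<noteq> \<infinity>"
      using emeasure_density[of "\<lambda>x. ennreal ((cmod (f x))\<^sup>2)" M "space M"]
      by (auto cong: nn_integral_cong)
  qed
  have rep: "(\<integral>x. 1 / (complex_of_real x - z) \<partial>?N) = l2_inner (jacobi_resolvent b z u) u" if "z \<notin> \<real>" for z
  proof -
    have z: "Im z \<noteq> 0" using that by (rule nonreal_Im)
    let ?g = "\<lambda>x. 1 / (of_real x - z) * f x"
    have g: "sq_int M ?g" by (rule sq_int_cauchy[OF f z])
    define v where "v k = (\<integral>x. ?g x * P k x \<partial>M)" for k
    have v: "v \<in> l2" using coeffs_in_l2[OF g] unfolding v_def .
    have res: "jacobi_resolvent b z u = v"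
      by (rule jacobi_resolvent_eqI[OF v u z])
         (use resolvent_coeff_rec[OF f z] coeff in \<open>simp add: v_def\<close>)
    have "summable (\<lambda>n. v n * cnj (u n))"
    proof (rule summable_comparison_test'[where N = 0])
      show "summable (\<lambda>n. (cmod (v n))\<^sup>2 + (cmod (u n))\<^sup>2)"
        using u v by (intro summable_add) (auto simp: l2_def)
      show "norm (v n * cnj (u n)) \<le> (cmod (v n))\<^sup>2 + (cmod (u n))\<^sup>2" for n
        using cmod_mult_le_squares[of "v n" "cnj (u n)"] by simp
    qed
    then have "(\<lambda>n. \<Sum>k<n. v k * cnj (u k)) \<longlonglongrightarrow> l2_inner v u"
      unfolding l2_inner_def by (rule summable_LIMSEQ)
    moreover have "filterlim (\<lambda>j. Suc (r j)) at_top sequentially"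
      using filterlim_subseq[OF r] filterlim_compose[OF filterlim_Suc] by blast
    ultimately have L1: "(\<lambda>j. \<Sum>k<Suc (r j). v k * cnj (u k)) \<longlonglongrightarrow> l2_inner v u"
      by (rule filterlim_compose)
    have part: "(\<Sum>k<Suc (r j). v k * cnj (u k)) = (\<integral>x. ?g x * cnj (p u {1..r j} x) \<partial>M)" for j
    proof -
      have "(\<Sum>k<Suc (r j). v k * cnj (u k)) = (\<Sum>k\<in>{1..r j}. v k * cnj (u k))"
        using u by (intro sum.mono_neutral_right) (auto simp: l2_def less_Suc_eq_le Suc_le_eq)
      also have "\<dots> = (\<integral>x. ?g x * cnj (p u {1..r j} x) \<partial>M)"
        unfolding integral_mult_cnj_p[OF g finite_atLeastAtMost] v_def by (simp add: mult.commute)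
      finally show ?thesis .
    qed
    have sqc: "sq_int M (\<lambda>x. cnj (f x - p u {1..r j} x))" for j by (rule sq_int_cnj[OF sqd])
    have "(\<lambda>j. \<integral>x. cnj (f x - p u {1..r j} x) * ?g x \<partial>M) \<longlonglongrightarrow> 0"
      by (rule sq_int_tendsto[OF sqc g]) (use lim in \<open>simp only: complex_mod_cnj\<close>)
    moreover have "(\<integral>x. cnj (f x - p u {1..r j} x) * ?g x \<partial>M) = (\<integral>x. ?g x * cnj (f x) \<partial>M) - (\<integral>x. ?g x * cnj (p u {1..r j} x) \<partial>M)" for j
    proof -
      have "(\<integral>x. ?g x * cnj (f x) - ?g x * cnj (p u {1..r j} x) \<partial>M) = (\<integral>x. ?g x * cnj (f x) \<partial>M) - (\<integral>x. ?g x * cnj (p u {1..r j} x) \<partial>M)"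
        by (intro Bochner_Integration.integral_diff sq_int_mult_integrable g sq_int_cnj f sq_int_p) simp
      moreover have "cnj (f x - p u {1..r j} x) * ?g x = ?g x * cnj (f x) - ?g x * cnj (p u {1..r j} x)" for x
        by (simp add: algebra_simps)
      ultimately show ?thesis by simp
    qed
    ultimately have "(\<lambda>j. (\<integral>x. ?g x * cnj (f x) \<partial>M) - (\<integral>x. ?g x * cnj (p u {1..r j} x) \<partial>M)) \<longlonglongrightarrow> 0"
      by simp
    from tendsto_diff[OF tendsto_const[of "\<integral>x. ?g x * cnj (f x) \<partial>M"] this]
    have L2: "(\<lambda>j. \<integral>x. ?g x * cnj (p u {1..r j} x) \<partial>M) \<longlonglongrightarrow> (\<integral>x. ?g x * cnj (f x) \<partial>M)" by simp
    have "l2_inner v u = (\<integral>x. ?g x * cnj (f x) \<partial>M)"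
      using LIMSEQ_unique[OF L1[unfolded part] L2] .
    moreover have "(\<integral>x. 1 / (complex_of_real x - z) \<partial>?N) = (\<integral>x. (cmod (f x))\<^sup>2 *\<^sub>R (1 / (complex_of_real x - z)) \<partial>M)"
      by (rule integral_density) auto
    moreover have "(cmod (f x))\<^sup>2 *\<^sub>R (1 / (complex_of_real x - z)) = ?g x * cnj (f x)" for x
      by (simp add: scaleR_conv_of_real of_real_cmod_square)
    ultimately show ?thesis unfolding res by simp
  qed
  have "spectral_measure b u = ?N"
    unfolding spectral_measure_def
  proof (rule the_equality)
    show "sets ?N = sets borel \<and> finite_measure ?N \<and> (\<forall>z. z \<notin> \<real> \<longrightarrow>
           (\<integral>x. 1 / (complex_of_real x - z) \<partial>?N) = l2_inner (jacobi_resolvent b z u) u)"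
      using fin rep by simp
    fix M' assume "sets M' = sets borel \<and> finite_measure M' \<and> (\<forall>z. z \<notin> \<real> \<longrightarrow>
           (\<integral>x. 1 / (complex_of_real x - z) \<partial>M') = l2_inner (jacobi_resolvent b z u) u)"
    then show "M' = ?N" using fin rep by (intro stieltjes_transform_unique) auto
  qed
  then show "sets (spectral_measure b u) = sets borel" "absolutely_continuous M (spectral_measure b u)"
    by (auto intro!: absolutely_continuousI_density)
qed

end

text \<open>Both Stieltjes transforms equal the Weyl function, which is defined from
  \<open>b\<close> alone.\<close>

lemma orthonormal_measure_unique:
  assumes "orthonormal_measure b M" "orthonormal_measure b N"
  shows "M = N"
proof -
  interpret M: orthonormal b M by standard fact
  interpret N: orthonormal b N by standard fact
  show ?thesis
  proof (rule stieltjes_transform_unique)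
    fix z :: complex assume "z \<notin> \<real>"
    then have "Im z \<noteq> 0" by (rule M.nonreal_Im)
    then show "(\<integral>x. 1 / (complex_of_real x - z) \<partial>M) = (\<integral>x. 1 / (complex_of_real x - z) \<partial>N)"
      using M.weyl_m_eq[of z] N.weyl_m_eq[of z] by simp
  qed (auto intro: M.finite_measure_axioms N.finite_measure_axioms)
qed

section \<open>The Jost function on the unit circle\<close>

text \<open>With this branch \<open>- circle_pt x\<close> has positive imaginary part and is
  admissible as the boundary parameter \<open>w\<close>.\<close>

definition circle_pt :: "real \<Rightarrow> complex" where
  "circle_pt x = Complex (x/2) (- sqrt (4 - x\<^sup>2) / 2)"

lemma square_less_4: "x \<in> {-2<..<2} \<Longrightarrow> x\<^sup>2 < 4" for x :: real
  using abs_square_less_1[of "x/2"] by (auto simp: power_divide abs_less_iff)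

lemma circle_pt_norm: "x \<in> {-2<..<2} \<Longrightarrow> cmod (circle_pt x) = 1"
  using square_less_4[of x] by (simp add: circle_pt_def cmod_def power_divide flip: add_divide_distrib)

lemma circle_pt_cnj: "x \<in> {-2<..<2} \<Longrightarrow> circle_pt x * cnj (circle_pt x) = 1"
  using circle_pt_norm[of x] by (simp add: complex_norm_square[symmetric])

lemma circle_pt_inverse: "x \<in> {-2<..<2} \<Longrightarrow> 1 / circle_pt x = cnj (circle_pt x)"
  using circle_pt_cnj[of x] by (metis divide_eq_eq mult.commute mult_zero_left zero_neq_one)

lemma circle_pt_add_cnj: "circle_pt x + cnj (circle_pt x) = of_real x"
  by (simp add: circle_pt_def complex_eq_iff)

lemma circle_pt_Re: "x = 2 * Re (circle_pt x)" by (simp add: circle_pt_def)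

lemma continuous_on_circle_pt: "continuous_on {-2<..<2} circle_pt"
  unfolding circle_pt_def Complex_eq
  by (intro continuous_intros) auto

text \<open>Equals \<open>1 / (cnj z - z) = 1 / (\<i> * sqrt (4 - x\<^sup>2))\<close>, hence is
  purely imaginary. In the role of \<open>s\<close> it measures how strongly the perturbation
  couples the amplitude to its conjugate.\<close>

definition refl_coeff :: "real \<Rightarrow> complex" where
  "refl_coeff x = circle_pt x / (1 - (circle_pt x)\<^sup>2)"

lemma one_minus_circle_pt_square:
  assumes "x \<in> {-2<..<2}"
  shows "1 - (circle_pt x)\<^sup>2 = circle_pt x * (cnj (circle_pt x) - circle_pt x)" "cnj (circle_pt x) - circle_pt x \<noteq> 0"
    "1 - (circle_pt x)\<^sup>2 \<noteq> 0"
proof -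
  show 1: "1 - (circle_pt x)\<^sup>2 = circle_pt x * (cnj (circle_pt x) - circle_pt x)"
    using circle_pt_cnj[OF assms] by (simp add: algebra_simps power2_eq_square)
  show 2: "cnj (circle_pt x) - circle_pt x \<noteq> 0"
    using square_less_4[OF assms] by (simp add: circle_pt_def complex_eq_iff)
  have "circle_pt x \<noteq> 0" using circle_pt_norm[OF assms] by auto
  then show "1 - (circle_pt x)\<^sup>2 \<noteq> 0" unfolding 1 using 2 by simp
qed

lemma refl_coeff_eq:
  assumes "x \<in> {-2<..<2}" shows "refl_coeff x * (cnj (circle_pt x) - circle_pt x) = 1"
proof -
  have "circle_pt x \<noteq> 0" using circle_pt_norm[OF assms] by auto
  then show ?thesis
    unfolding refl_coeff_def one_minus_circle_pt_square(1)[OF assms] using one_minus_circle_pt_square(2)[OF assms] by simp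
qed

lemma refl_coeff_imag:
  assumes "x \<in> {-2<..<2}" shows "cnj (refl_coeff x) = - refl_coeff x"
proof -
  have "cnj (refl_coeff x) * (circle_pt x - cnj (circle_pt x)) = 1"
    using arg_cong[OF refl_coeff_eq[OF assms], of cnj] by simp
  then have "(cnj (refl_coeff x) + refl_coeff x) * (circle_pt x - cnj (circle_pt x)) = 0"
    using refl_coeff_eq[OF assms] by algebra
  moreover have "circle_pt x - cnj (circle_pt x) \<noteq> 0"
    using one_minus_circle_pt_square(2)[OF assms] by (metis diff_eq_diff_eq diff_self)
  ultimately have "cnj (refl_coeff x) + refl_coeff x = 0" by simp
  then show ?thesis by (simp only: eq_neg_iff_add_eq_0)
qed

definition jost_amp :: "(nat \<Rightarrow> real) \<Rightarrow> nat \<Rightarrow> real \<Rightarrow> complex" where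
  "jost_amp b n x = circle_pt x ^ n * (of_real (P_real b (Suc n) x) - circle_pt x * of_real (P_real b n x))"

lemma jost_amp_norm: "x \<in> {-2<..<2} \<Longrightarrow>
    cmod (jost_amp b n x) = cmod (of_real (P_real b (Suc n) x) - circle_pt x * of_real (P_real b n x))"
  unfolding jost_amp_def norm_mult norm_power by (simp add: circle_pt_norm)

text \<open>Freed from the power of z, the amplitude is P_(n+1) - z P_n; since the polynomials are
  real, subtracting the conjugate eliminates P_(n+1).\<close>

lemma P_real_eq_amp:
  assumes x: "x \<in> {-2<..<2}"
  shows "of_real (P_real b n x) = refl_coeff x *
    (cnj (circle_pt x) ^ n * jost_amp b n x - circle_pt x ^ n * cnj (jost_amp b n x))"
proof -
  let ?z = "circle_pt x"
  have 1: "cnj ?z ^ n * ?z ^ n = 1" "?z ^ n * cnj ?z ^ n = 1"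
    using circle_pt_cnj[OF x] by (simp_all add: mult.commute flip: power_mult_distrib)
  have "cnj ?z ^ n * jost_amp b n x - ?z ^ n * cnj (jost_amp b n x)
      = (cnj ?z ^ n * ?z ^ n) * (of_real (P_real b (Suc n) x) - ?z * of_real (P_real b n x))
      - (?z ^ n * cnj ?z ^ n) * (of_real (P_real b (Suc n) x) - cnj ?z * of_real (P_real b n x))"
    unfolding jost_amp_def by (simp add: algebra_simps)
  also have "\<dots> = (cnj ?z - ?z) * of_real (P_real b n x)" unfolding 1 by (simp add: algebra_simps)
  finally show ?thesis using refl_coeff_eq[OF x] by (simp add: mult.assoc[symmetric])
qed

text \<open>For \<open>b = 0\<close> the amplitude is constant, being the coefficient of a free
  wave. The perturbation enters only through \<open>P_real b (Suc n) x\<close>, which is then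
  expressed by the amplitude and its conjugate.\<close>

lemma jost_amp_Suc:
  assumes x: "x \<in> {-2<..<2}"
  shows "jost_amp b (Suc n) x = jost_amp b n x
    - refl_coeff x * of_real (b (Suc n)) * (jost_amp b n x - ((circle_pt x)\<^sup>2) ^ Suc n * cnj (jost_amp b n x))"
proof -
  let ?z = "circle_pt x" and ?A = "jost_amp b n x"
  let ?P = "\<lambda>k. complex_of_real (P_real b k x)"
  have zz: "?z * cnj ?z = 1" by (rule circle_pt_cnj[OF x])
  have zn: "?z ^ n * cnj ?z ^ n = 1" using zz by (simp flip: power_mult_distrib)
  have X: "of_real x = ?z + cnj ?z" by (simp add: circle_pt_add_cnj)
  have s: "refl_coeff x * (cnj ?z - ?z) = 1" by (rule refl_coeff_eq[OF x])
  have A: "?A = ?z ^ n * (?P (Suc n) - ?z * ?P n)" "cnj ?A = cnj ?z ^ n * (?P (Suc n) - cnj ?z * ?P n)"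
    unfolding jost_amp_def by simp_all
  have rec: "?P (Suc (Suc n)) = (?z + cnj ?z - of_real (b (Suc n))) * ?P (Suc n) - ?P n"
    unfolding P_real_rec X[symmetric] by simp
  have "jost_amp b (Suc n) x = ?z ^ n * (?z * (?P (Suc (Suc n)) - ?z * ?P (Suc n)))"
    unfolding jost_amp_def by simp
  also have "?z * (?P (Suc (Suc n)) - ?z * ?P (Suc n)) = ?P (Suc n) - ?z * ?P n - of_real (b (Suc n)) * ?z * ?P (Suc n)"
    unfolding rec using zz by algebra
  finally have L: "jost_amp b (Suc n) x = ?A - of_real (b (Suc n)) * (?z ^ Suc n * ?P (Suc n))"
    unfolding A by (simp add: algebra_simps)
  have AA: "?A - (?z\<^sup>2) ^ Suc n * cnj ?A = ?z ^ Suc n * ((cnj ?z - ?z) * ?P (Suc n))"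
  proof -
    have p: "(?z\<^sup>2) ^ Suc n = ?z ^ n * ?z ^ n * ?z * ?z"
      by (simp add: power2_eq_square power_mult_distrib mult_ac)
    \<comment> \<open>Named so that \<open>algebra\<close> treats the powers as variables tied only
      by \<open>zz\<close> and \<open>zn\<close>.\<close>
    define Z C P1 P0 where "Z = ?z ^ n" "C = cnj ?z ^ n" "P1 = ?P (Suc n)" "P0 = ?P n"
    note defs = this
    have "Z * (P1 - ?z * P0) - Z * Z * ?z * ?z * (C * (P1 - cnj ?z * P0)) = ?z * Z * ((cnj ?z - ?z) * P1)"
      using zz zn[folded defs] by algebra
    then show ?thesis unfolding A(2) p unfolding A(1) power_Suc defs .
  qed
  have "refl_coeff x * (?A - (?z\<^sup>2) ^ Suc n * cnj ?A) = ?z ^ Suc n * ?P (Suc n)"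
  proof -
    have "refl_coeff x * (?z ^ Suc n * ((cnj ?z - ?z) * ?P (Suc n))) =
        ?z ^ Suc n * ?P (Suc n) * (refl_coeff x * (cnj ?z - ?z))" by (simp only: mult_ac)
    then show ?thesis unfolding AA s by simp
  qed
  moreover have "refl_coeff x * of_real (b (Suc n)) * X = of_real (b (Suc n)) * (refl_coeff x * X)" for X
    by (simp only: mult_ac)
  ultimately show ?thesis unfolding L by (simp only:)
qed

lemma continuous_bounded_below:
  fixes f :: "real \<Rightarrow> complex"
  assumes "compact K" "continuous_on K f" "\<And>x. x \<in> K \<Longrightarrow> f x \<noteq> 0"
  shows "\<exists>d>0. \<forall>x\<in>K. d \<le> cmod (f x)"
proof (cases "K = {}")
  case False
  have "continuous_on K (\<lambda>x. cmod (f x))" using assms(2) by (intro continuous_intros)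
  from continuous_attains_inf[OF assms(1) False this] obtain x0 where "x0 \<in> K" "\<forall>x\<in>K. cmod (f x0) \<le> cmod (f x)"
    by blast
  then show ?thesis using assms(3)[of x0] by (intro exI[of _ "cmod (f x0)"]) auto
qed (auto intro: exI[of _ 1])

lemma common_lower_bound:
  assumes "finite G" "\<And>f. f \<in> G \<Longrightarrow> \<exists>d>0. \<forall>x\<in>K. d \<le> cmod (f x)"
  shows "\<exists>d>0. \<forall>f\<in>G. \<forall>x\<in>K. d \<le> cmod (f x)"
  using assms
proof (induction rule: finite_induct)
  case empty
  show ?case by (intro exI[of _ 1]) auto
next
  case (insert f G)
  then obtain d d' where "d > 0" "\<forall>f\<in>G. \<forall>x\<in>K. d \<le> cmod (f x)" "d' > 0" "\<forall>x\<in>K. d' \<le> cmod (f x)"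
    by (metis insertCI)
  then show ?case by (intro exI[of _ "min d d'"]) (auto simp: min_le_iff_disj)
qed

section \<open>The excluded spectral points\<close>

definition regular_set :: "real \<Rightarrow> real set" where
  "regular_set \<omega> = {-2<..<2} - {2 * cos \<omega>, - 2 * cos \<omega>, 2 * cos (2*\<omega>), - 2 * cos (2*\<omega>)}"

lemma smallo_one_iff: "f \<in> o(\<lambda>n. 1) \<longleftrightarrow> f \<longlonglongrightarrow> 0" for f :: "nat \<Rightarrow> complex"
  using smalloI_tendsto[of f "\<lambda>n. 1" sequentially] smalloD_tendsto[of f sequentially "\<lambda>n. 1"] by auto

lemma open_regular_set: "open (regular_set \<omega>)"
  unfolding regular_set_def by (intro open_Diff finite_imp_closed) auto

lemma circle_pt_ne_cis:
  assumes "x \<noteq> 2 * cos t" "x \<noteq> - 2 * cos t"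
  shows "circle_pt x \<noteq> cis t" "circle_pt x \<noteq> - cis t" "circle_pt x \<noteq> cis (-t)" "circle_pt x \<noteq> - cis (-t)"
  using assms circle_pt_Re[of x] by auto

lemma cis_square_eq: "cis (2 * t) = (cis t)\<^sup>2" by (simp add: power2_eq_square cis_mult)

text \<open>A resonance forces z to be one of \<pm>\<open>cis t\<close>,
  \<pm>\<open>cis (-t)\<close>, so that x = \<pm>2 cos t. Used with \<open>t = \<omega>\<close> this
  excludes first order resonances, with \<open>t = 2 * \<omega>\<close> those of second
  order.\<close>

lemma circle_pt_square_nonres:
  assumes "x \<noteq> 2 * cos t" "x \<noteq> - 2 * cos t"
  shows "cis (2 * t) * (circle_pt x)\<^sup>2 \<noteq> 1" "cnj (cis (2 * t)) * (circle_pt x)\<^sup>2 \<noteq> 1"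
proof -
  have c: "cis t * cis (-t) = 1" by (simp add: cis_mult)
  show "cis (2 * t) * (circle_pt x)\<^sup>2 \<noteq> 1"
  proof
    assume "cis (2 * t) * (circle_pt x)\<^sup>2 = 1"
    then have "(circle_pt x)\<^sup>2 = (cis (-t))\<^sup>2" unfolding cis_square_eq using c by algebra
    then show False using circle_pt_ne_cis(3,4)[OF assms] by (auto simp: power2_eq_iff)
  qed
  show "cnj (cis (2 * t)) * (circle_pt x)\<^sup>2 \<noteq> 1"
  proof
    assume "cnj (cis (2 * t)) * (circle_pt x)\<^sup>2 = 1"
    then have "(cis (-t))\<^sup>2 * (circle_pt x)\<^sup>2 = 1"
      unfolding cis_cnj using cis_square_eq[of "-t"] by simp
    then have "(circle_pt x)\<^sup>2 = (cis t)\<^sup>2" using c by algebra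
    then show False using circle_pt_ne_cis(1,2)[OF assms] by (auto simp: power2_eq_iff)
  qed
qed

lemma circle_pt_in_U_set:
  assumes "x \<in> regular_set \<omega>" shows "circle_pt x \<in> sphere 0 1 \<inter> U_set \<omega>"
proof -
  have x: "x \<in> {-2<..<2}" using assms by (simp add: regular_set_def)
  have "circle_pt x \<noteq> 0" "circle_pt x \<noteq> 1" "circle_pt x \<noteq> -1"
    using circle_pt_norm[OF x] one_minus_circle_pt_square(3)[OF x] by auto
  moreover have "x \<noteq> 2 * cos \<omega>" "x \<noteq> - 2 * cos \<omega>" "x \<noteq> 2 * cos (2*\<omega>)" "x \<noteq> - 2 * cos (2*\<omega>)"
    using assms by (auto simp: regular_set_def)
  ultimately show ?thesis
    unfolding U_set_def using circle_pt_ne_cis[of x \<omega>] circle_pt_ne_cis[of x "2 * \<omega>"] circle_pt_norm[OF x] by simp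
qed

section \<open>The oscillating potential on the regular set\<close>

locale wigner_von_neumann =
  fixes c \<omega> \<delta> \<gamma> :: real and q b :: "nat \<Rightarrow> real"
  assumes gamma: "1/3 < \<gamma>" "\<gamma> < 1/2"
    and nonres: "\<forall>k::int. 2 * \<omega> \<noteq> pi * of_int k"
    and q: "summable (\<lambda>n. \<bar>q n\<bar>)"
    and b: "\<forall>n\<ge>1. b n = c * sin (2 * \<omega> * real n + \<delta>) / real n powr \<gamma> + q n"
begin

abbreviation E :: complex where "E \<equiv> cis (2 * \<omega>)"

text \<open>Fourier coefficient: \<open>c * sin (2 * \<omega> * n + \<delta>)\<close> is
  \<open>pc * E ^ n\<close> plus its conjugate.\<close>

definition pc :: complex where "pc = of_real c * cis \<delta> / (2 * \<i>)"

text \<open>The hypothesis on \<open>\<omega>\<close> says exactly that \<open>E\<close> is neither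
  1 nor -1, which rules out resonance at the frequencies \<open>E\<close> and
  \<open>E\<^sup>2\<close> that do not depend on x.\<close>

lemma E_sq_ne_1: "E \<noteq> 1" "E\<^sup>2 \<noteq> 1"
proof -
  have s: "sin (2 * \<omega>) \<noteq> 0"
    using nonres by (auto simp: sin_zero_iff_int2 mult.commute)
  then show "E \<noteq> 1" by (auto simp: complex_eq_iff)
  have "E \<noteq> -1" using s by (auto simp: complex_eq_iff)
  with \<open>E \<noteq> 1\<close> show "E\<^sup>2 \<noteq> 1" by (auto simp: power2_eq_1_iff)
qed

lemma b_Suc: "complex_of_real (b (Suc m)) =
    of_real (real (Suc m) powr -\<gamma>) * (pc * E ^ Suc m + cnj pc * cnj E ^ Suc m) + of_real (q (Suc m))"
proof -
  let ?t = "2 * \<omega> * real (Suc m) + \<delta>"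
  have "pc * E ^ Suc m = of_real c * cis ?t / (2 * \<i>)"
  proof -
    have "E ^ Suc m = cis (real (Suc m) * (2 * \<omega>))" by (rule Complex.DeMoivre)
    then show ?thesis unfolding pc_def by (simp add: cis_mult add_ac mult_ac del: power_Suc of_nat_Suc)
  qed
  then have pe: "pc * E ^ Suc m = Complex (c * sin ?t / 2) (- c * cos ?t / 2)"
    by (simp add: complex_eq_iff Re_divide Im_divide power2_eq_square del: power_Suc of_nat_Suc)
  have "pc * E ^ Suc m + cnj pc * cnj E ^ Suc m = pc * E ^ Suc m + cnj (pc * E ^ Suc m)" by simp
  also have "\<dots> = of_real (c * sin ?t)" unfolding pe by (simp add: complex_eq_iff)
  finally have 1: "pc * E ^ Suc m + cnj pc * cnj E ^ Suc m = of_real (c * sin ?t)" .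
  have "b (Suc m) = c * sin ?t / real (Suc m) powr \<gamma> + q (Suc m)" using b by auto
  also have "\<dots> = real (Suc m) powr -\<gamma> * (c * sin ?t) + q (Suc m)" by (simp add: powr_minus field_simps)
  finally show ?thesis unfolding 1 of_real_mult[symmetric] of_real_add[symmetric] by simp
qed

lemma pc_norm: "pc * cnj pc = of_real (c\<^sup>2 / 4)"
proof -
  have "cis \<delta> * cis (-\<delta>) = 1" by (simp add: cis_mult)
  then have "of_real c * cis \<delta> * (of_real c * cis (-\<delta>)) = (of_real c)\<^sup>2" by algebra
  then show ?thesis unfolding pc_def by (simp add: cis_cnj power2_eq_square mult_ac)
qed

lemma regular_nonres:
  assumes "x \<in> regular_set \<omega>"
  shows "x \<in> {-2<..<2}" "(circle_pt x)\<^sup>2 - 1 \<noteq> 0" "E * (circle_pt x)\<^sup>2 - 1 \<noteq> 0" "cnj E * (circle_pt x)\<^sup>2 - 1 \<noteq> 0"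
    "E\<^sup>2 * (circle_pt x)\<^sup>2 - 1 \<noteq> 0" "(cnj E)\<^sup>2 * (circle_pt x)\<^sup>2 - 1 \<noteq> 0"
proof -
  have x: "x \<noteq> 2 * cos \<omega>" "x \<noteq> - 2 * cos \<omega>" "x \<noteq> 2 * cos (2*\<omega>)" "x \<noteq> - 2 * cos (2*\<omega>)"
    using assms by (auto simp: regular_set_def)
  show x2: "x \<in> {-2<..<2}" using assms by (simp add: regular_set_def)
  show "(circle_pt x)\<^sup>2 - 1 \<noteq> 0" using one_minus_circle_pt_square(3)[OF x2] by auto
  show "E * (circle_pt x)\<^sup>2 - 1 \<noteq> 0" "cnj E * (circle_pt x)\<^sup>2 - 1 \<noteq> 0"
    using circle_pt_square_nonres[OF x(1,2)] by auto
  have "E\<^sup>2 = cis (2 * (2 * \<omega>))" "(cnj E)\<^sup>2 = cnj (cis (2 * (2 * \<omega>)))"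
    using cis_square_eq[of "2 * \<omega>"] by auto
  then show "E\<^sup>2 * (circle_pt x)\<^sup>2 - 1 \<noteq> 0" "(cnj E)\<^sup>2 * (circle_pt x)\<^sup>2 - 1 \<noteq> 0"
    using circle_pt_square_nonres[OF x(3,4)] by auto
qed

lemma mu2_eq:
  assumes "x \<in> regular_set \<omega>"
  shows "mu2 c \<omega> (circle_pt x) = (refl_coeff x)\<^sup>2 * (pc * cnj pc) * (((circle_pt x)\<^sup>2)\<^sup>2 - 1)
        / ((E * (circle_pt x)\<^sup>2 - 1) * (cnj E * (circle_pt x)\<^sup>2 - 1))"
proof -
  note nz = regular_nonres[OF assms]
  let ?u = "(circle_pt x)\<^sup>2"
  have EE: "E * cnj E = 1" by (simp add: cis_cnj cis_mult)
  have E0: "E \<noteq> 0" by simp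
  have uE: "cnj E * ?u - 1 = cnj E * (?u - E)" using EE by (simp add: algebra_simps)
  then have nz': "?u - E \<noteq> 0" "1 - ?u * E \<noteq> 0" "1 - ?u \<noteq> 0" using nz by (auto simp: mult.commute)
  have s2: "(refl_coeff x)\<^sup>2 = ?u / (1 - ?u)\<^sup>2" unfolding refl_coeff_def power_divide ..
  have cE: "cnj E = 1 / E" using EE E0 by (simp add: field_simps)
  have D: "cnj E * ?u - 1 = (?u - E) / E" unfolding uE unfolding cE by simp
  have N: "?u\<^sup>2 - 1 = - ((1 - ?u) * (1 + ?u))" by (simp add: power2_eq_square algebra_simps)
  have B: "E * ?u - 1 = - (1 - ?u * E)" by simp
  have gen: "U / X\<^sup>2 * (k / 4) * - (X * V) / (- Y * (Z / W)) = k * U * V * W / (4 * X * Z * Y)"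
    if "X \<noteq> 0" "Y \<noteq> 0" "Z \<noteq> 0" "W \<noteq> 0" for X Y Z W U V k :: complex
    using that by (simp add: field_simps power2_eq_square)
  have pcn: "pc * cnj pc = (of_real c)\<^sup>2 / 4" unfolding pc_norm by simp
  have "(refl_coeff x)\<^sup>2 * (pc * cnj pc) * (?u\<^sup>2 - 1) / ((E * ?u - 1) * (cnj E * ?u - 1)) = mu2 c \<omega> (circle_pt x)"
    unfolding s2 pcn N B D gen[OF nz'(3,2,1) E0] mu2_def ..
  then show ?thesis ..
qed

text \<open>On a compact set the finitely many resonance factors are continuous and nonzero, so a
  common gap \<open>d\<close> exists; continuity also bounds \<open>refl_coeff\<close>.\<close>

lemma wkb_regular:
  assumes K: "compact K" "K \<subseteq> regular_set \<omega>"
  shows "\<exists>d. wkb K refl_coeff (\<lambda>x. (circle_pt x)\<^sup>2) (\<lambda>x. mu2 c \<omega> (circle_pt x)) E pc \<gamma> d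
    (\<lambda>n. q (Suc n)) (\<lambda>n. b (Suc n)) (jost_amp b)"
proof -
  have Ksub: "x \<in> {-2<..<2}" if "x \<in> K" for x using regular_nonres(1) K(2) that by blast
  have cz: "continuous_on K circle_pt"
    by (rule continuous_on_subset[OF continuous_on_circle_pt]) (use Ksub in blast)
  let ?G = "{\<lambda>x. E - 1, \<lambda>x. E\<^sup>2 - 1, \<lambda>x. (circle_pt x)\<^sup>2 - 1, \<lambda>x. E * (circle_pt x)\<^sup>2 - 1,
    \<lambda>x. cnj E * (circle_pt x)\<^sup>2 - 1, \<lambda>x. E\<^sup>2 * (circle_pt x)\<^sup>2 - 1, \<lambda>x. (cnj E)\<^sup>2 * (circle_pt x)\<^sup>2 - 1}"
  have 1: "continuous_on K f \<and> (\<forall>x\<in>K. f x \<noteq> 0)" if "f \<in> ?G" for f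
  proof -
    have nz: "x \<in> K \<Longrightarrow> x \<in> regular_set \<omega>" for x using K(2) by blast
    have "continuous_on K f" using that by (auto intro!: continuous_intros cz)
    moreover have "\<forall>x\<in>K. f x \<noteq> 0"
    proof
      fix x assume "x \<in> K"
      then have "x \<in> regular_set \<omega>" by (rule nz)
      note r = regular_nonres[OF this]
      have "E - 1 \<noteq> 0" "E\<^sup>2 - 1 \<noteq> 0" using E_sq_ne_1 by auto
      with r that show "f x \<noteq> 0" by blast
    qed
    ultimately show ?thesis by blast
  qed
  have "\<exists>d>0. \<forall>f\<in>?G. \<forall>x\<in>K. d \<le> cmod (f x)"
  proof (rule common_lower_bound)
    fix f assume "f \<in> ?G"
    from 1[OF this] show "\<exists>d>0. \<forall>x\<in>K. d \<le> cmod (f x)"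
      by (intro continuous_bounded_below[OF K(1)]) auto
  qed simp
  then obtain d where d: "d > 0" "\<forall>f\<in>?G. \<forall>x\<in>K. d \<le> cmod (f x)" by blast
  have dE: "\<exists>d>0. d \<le> cmod (E - 1) \<and> d \<le> cmod (E\<^sup>2 - 1)"
    using E_sq_ne_1 by (intro exI[of _ "min (cmod (E - 1)) (cmod (E\<^sup>2 - 1))"]) auto
  then obtain d1 where d1: "d1 > 0" "d1 \<le> cmod (E - 1)" "d1 \<le> cmod (E\<^sup>2 - 1)" by blast
  define d2 where "d2 = min d d1"
  have d2: "d2 > 0" "d2 \<le> d" "d2 \<le> d1" using d d1 by (auto simp: d2_def)
  have b1: "d2 \<le> cmod ((circle_pt x)\<^sup>2 - 1)" "d2 \<le> cmod (E * (circle_pt x)\<^sup>2 - 1)"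
    "d2 \<le> cmod (cnj E * (circle_pt x)\<^sup>2 - 1)" "d2 \<le> cmod (E\<^sup>2 * (circle_pt x)\<^sup>2 - 1)"
    "d2 \<le> cmod ((cnj E)\<^sup>2 * (circle_pt x)\<^sup>2 - 1)" if "x \<in> K" for x
    using d(2) that d2(2) by (auto intro: order.trans)
  have "continuous_on K refl_coeff"
    unfolding refl_coeff_def[abs_def] using one_minus_circle_pt_square(3) Ksub
    by (intro continuous_intros cz) auto
  then have "bounded (refl_coeff ` K)" by (intro compact_imp_bounded compact_continuous_image K(1))
  then have sb: "unif_bounded K refl_coeff" unfolding unif_bounded_def bounded_iff by auto
  have "wkb K refl_coeff (\<lambda>x. (circle_pt x)\<^sup>2) (\<lambda>x. mu2 c \<omega> (circle_pt x)) E pc \<gamma> d2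
    (\<lambda>n. q (Suc n)) (\<lambda>n. b (Suc n)) (jost_amp b)"
  proof
    show "summable (\<lambda>n. \<bar>q (Suc n)\<bar>)" using q by (subst summable_Suc_iff)
    show "cmod E = 1" by simp
    show "cmod ((circle_pt x)\<^sup>2) = 1" if "x \<in> K" for x using circle_pt_norm[OF Ksub[OF that]] by (simp add: norm_power)
    show "jost_amp b 0 x = 1" for x by (simp add: jost_amp_def)
    show "mu2 c \<omega> (circle_pt x) = (refl_coeff x)\<^sup>2 * (pc * cnj pc) * (((circle_pt x)\<^sup>2)\<^sup>2 - 1)
        / ((E * (circle_pt x)\<^sup>2 - 1) * (cnj E * (circle_pt x)\<^sup>2 - 1))" if "x \<in> K" for x
      using mu2_eq K(2) that by blast
  qed (use gamma sb d1 d2 b1 refl_coeff_imag Ksub b_Suc jost_amp_Suc in auto)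
  then show ?thesis by blast
qed

text \<open>Conjugation on the circle is inversion of \<open>u\<close> and \<open>E\<close>, under
  which the quotient changes sign, while the prefactor
  \<open>(refl_coeff x)\<^sup>2 * (pc * cnj pc)\<close> is real. Hence the growth factor is a mere
  phase on the regular set.\<close>

lemma mu2_imag:
  assumes x: "x \<in> regular_set \<omega>"
  shows "cnj (mu2 c \<omega> (circle_pt x)) = - mu2 c \<omega> (circle_pt x)"
proof -
  note nz = regular_nonres[OF x]
  let ?u = "(circle_pt x)\<^sup>2"
  have uu: "?u * cnj ?u = 1" using circle_pt_cnj[OF nz(1)] by (simp flip: power_mult_distrib)
  have EE: "E * cnj E = 1" by (simp add: cis_cnj cis_mult)
  have nz1: "cnj E * cnj ?u - 1 \<noteq> 0" "E * cnj ?u - 1 \<noteq> 0"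
    using nz(3,4) by (metis complex_cnj_cnj complex_cnj_diff complex_cnj_mult complex_cnj_one complex_cnj_zero_iff)+
  have "((cnj ?u)\<^sup>2 - 1) / ((cnj E * cnj ?u - 1) * (E * cnj ?u - 1)) = - (?u\<^sup>2 - 1) / ((E * ?u - 1) * (cnj E * ?u - 1))"
  proof (subst frac_eq_eq)
    show "((cnj ?u)\<^sup>2 - 1) * ((E * ?u - 1) * (cnj E * ?u - 1)) = - (?u\<^sup>2 - 1) * ((cnj E * cnj ?u - 1) * (E * cnj ?u - 1))"
    proof -
      have "cnj E * cnj ?u - 1 = - (E * ?u - 1) * cnj E * cnj ?u" "E * cnj ?u - 1 = - (cnj E * ?u - 1) * E * cnj ?u"
        using uu EE by algebra+
      then have "(cnj E * cnj ?u - 1) * (E * cnj ?u - 1) = (E * ?u - 1) * (cnj E * ?u - 1) * (cnj ?u)\<^sup>2"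
        using EE by algebra
      moreover have "- (?u\<^sup>2 - 1) * (cnj ?u)\<^sup>2 = (cnj ?u)\<^sup>2 - 1" using uu by algebra
      ultimately show ?thesis by algebra
    qed
  qed (use nz nz1 in auto)
  then have h: "cnj ((?u\<^sup>2 - 1) / ((E * ?u - 1) * (cnj E * ?u - 1))) = - ((?u\<^sup>2 - 1) / ((E * ?u - 1) * (cnj E * ?u - 1)))"
    unfolding complex_cnj_divide complex_cnj_mult complex_cnj_diff complex_cnj_one complex_cnj_power complex_cnj_cnj
    by (simp only: minus_divide_left)
  have "cnj ((refl_coeff x)\<^sup>2 * (pc * cnj pc)) = (refl_coeff x)\<^sup>2 * (pc * cnj pc)"
    by (simp add: refl_coeff_imag[OF nz(1)] mult.commute)
  then show ?thesis
    unfolding mu2_eq[OF x] times_divide_eq_right[symmetric] complex_cnj_mult[of "(refl_coeff x)\<^sup>2 * (pc * cnj pc)"] h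
    by simp
qed

lemma growth_exponent_exp:
  assumes x: "x \<in> regular_set \<omega>"
  shows "cnj (exp (growth_exponent c \<omega> \<gamma> (circle_pt x) n)) = exp (- growth_exponent c \<omega> \<gamma> (circle_pt x) n)"
    "cmod (exp (growth_exponent c \<omega> \<gamma> (circle_pt x) n)) = 1"
proof -
  have i: "cnj (growth_exponent c \<omega> \<gamma> (circle_pt x) n) = - growth_exponent c \<omega> \<gamma> (circle_pt x) n"
    unfolding growth_exponent_def by (simp add: mu2_imag[OF x])
  then show "cnj (exp (growth_exponent c \<omega> \<gamma> (circle_pt x) n)) = exp (- growth_exponent c \<omega> \<gamma> (circle_pt x) n)"
    unfolding exp_cnj by (simp only:)
  have "Re (growth_exponent c \<omega> \<gamma> (circle_pt x) n) = 0" using i by (simp add: complex_eq_iff)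
  then show "cmod (exp (growth_exponent c \<omega> \<gamma> (circle_pt x) n)) = 1" by simp
qed

lemma is_jost_value_unit_circle:
  assumes x: "x \<in> regular_set \<omega>"
  defines "g \<equiv> growth_exponent c \<omega> \<gamma> (circle_pt x)"
  shows "is_jost_value c \<omega> \<gamma> b (circle_pt x) w \<longleftrightarrow>
    (\<lambda>n. of_real (P_real b n x) - refl_coeff x *
      (cnj (circle_pt x) ^ n * exp (g n) * w - circle_pt x ^ n * exp (- g n) * cnj w)) \<longlonglongrightarrow> 0"
proof -
  let ?z = "circle_pt x"
  have x2: "x \<in> {-2<..<2}" by (rule regular_nonres(1)[OF x])
  have zz: "?z + 1 / ?z = of_real x" unfolding circle_pt_inverse[OF x2] by (rule circle_pt_add_cnj)
  have zn: "1 / ?z ^ n = cnj ?z ^ n" for n using circle_pt_inverse[OF x2] by (metis power_one_over)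
  have s: "?z * v / (1 - ?z\<^sup>2) = refl_coeff x * v" "?z * v / (?z\<^sup>2 - 1) = - (refl_coeff x * v)" for v
  proof -
    show "?z * v / (1 - ?z\<^sup>2) = refl_coeff x * v" unfolding refl_coeff_def by simp
    moreover have "?z\<^sup>2 - 1 = - (1 - ?z\<^sup>2)" by simp
    ultimately show "?z * v / (?z\<^sup>2 - 1) = - (refl_coeff x * v)" by (simp only: divide_minus_right)
  qed
  have eq: "P_poly b n (?z + 1 / ?z) - (?z * w / (1 - ?z\<^sup>2) * (1 / ?z ^ n) * exp (g n)
      + ?z * cnj w / (?z\<^sup>2 - 1) * ?z ^ n * exp (- g n)) =
     of_real (P_real b n x) - refl_coeff x * (cnj ?z ^ n * exp (g n) * w - ?z ^ n * exp (- g n) * cnj w)" for n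
    unfolding zz zn s P_poly_of_real by (simp add: algebra_simps)
  have ball: "?z \<notin> ball 0 1 - {0}" using circle_pt_norm[OF x2] by simp
  show ?thesis
    unfolding is_jost_value_def g_def[symmetric] eq
    using ball circle_pt_in_U_set[OF x] by (auto simp: smallo_one_iff)
qed

text \<open>Existence: \<open>P_real\<close> is a combination of the amplitude and its conjugate.
  Uniqueness: the asymptotics at two consecutive indices determine the amplitude up to o(1), because
  by \<open>dg\<close> the growth phase hardly changes from one index to the next, and this forces
  \<open>w = L\<close>.\<close>

lemma jost_unit_circle:
  assumes x: "x \<in> regular_set \<omega>" 
    and L: "(\<lambda>n. jost_amp b n x * exp (- growth_exponent c \<omega> \<gamma> (circle_pt x) n)) \<longlonglongrightarrow> L"
    and dg: "(\<lambda>n. growth_exponent c \<omega> \<gamma> (circle_pt x) (Suc n) - growth_exponent c \<omega> \<gamma> (circle_pt x) n) \<longlonglongrightarrow> 0"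
  shows "jost c \<omega> \<gamma> b (circle_pt x) = L"
proof -
  define z where "z = circle_pt x"
  define g where "g = growth_exponent c \<omega> \<gamma> z"
  define s where "s = refl_coeff x"
  let ?P = "\<lambda>n. complex_of_real (P_real b n x)"
  let ?A = "\<lambda>n. jost_amp b n x"
  have x2: "x \<in> {-2<..<2}" by (rule regular_nonres(1)[OF x])
  have z1: "cmod z = 1" "z * cnj z = 1" unfolding z_def using circle_pt_norm[OF x2] circle_pt_cnj[OF x2] by auto
  have ge: "cnj (exp (g n)) = exp (- g n)" "cmod (exp (g n)) = 1" "cmod (exp (- g n)) = 1" for n
    using growth_exponent_exp[OF x, of n] unfolding g_def z_def by (auto simp del: exp_minus simp: complex_mod_cnj[symmetric, of "exp _"])
  have ee: "exp (- g n) * exp (g n) = 1" for n by (simp flip: exp_add)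
  have iff: "is_jost_value c \<omega> \<gamma> b z w \<longleftrightarrow>
    (\<lambda>n. ?P n - s * (cnj z ^ n * exp (g n) * w - z ^ n * exp (- g n) * cnj w)) \<longlonglongrightarrow> 0" for w
    using is_jost_value_unit_circle[OF x, of w] unfolding g_def z_def s_def .
  have P: "?P n = s * (cnj z ^ n * ?A n - z ^ n * cnj (?A n))" for n
    unfolding s_def z_def by (rule P_real_eq_amp[OF x2])
  define B where "B n = ?A n * exp (- g n)" for n
  have B: "B \<longlonglongrightarrow> L" using L unfolding B_def g_def z_def .
  have "is_jost_value c \<omega> \<gamma> b z L"
    unfolding iff
  proof (rule Lim_null_comparison)
    show "\<forall>\<^sub>F n in sequentially. norm (?P n - s * (cnj z ^ n * exp (g n) * L - z ^ n * exp (- g n) * cnj L))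
        \<le> 2 * cmod s * cmod (B n - L)"
    proof (intro always_eventually allI)
      fix n
      have A1: "?A n = exp (g n) * B n"
      proof -
        have "exp (g n) * B n = ?A n * (exp (- g n) * exp (g n))" unfolding B_def by (simp only: mult_ac)
        then show ?thesis unfolding ee by simp
      qed
      have A2: "cnj (?A n) = exp (- g n) * cnj (B n)"
        unfolding A1 complex_cnj_mult ge(1) ..
      have "?P n - s * (cnj z ^ n * exp (g n) * L - z ^ n * exp (- g n) * cnj L)
        = s * (cnj z ^ n * exp (g n) * (B n - L) - z ^ n * exp (- g n) * cnj (B n - L))"
        unfolding P A2 unfolding A1 complex_cnj_diff by (simp only: algebra_simps)
      also have "cmod \<dots> \<le> cmod s * (cmod (B n - L) + cmod (B n - L))"
        unfolding norm_mult[of s]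
        by (intro mult_left_mono order.trans[OF norm_triangle_ineq4])
           (simp_all only: norm_mult norm_power complex_mod_cnj z1 ge power_one mult_1 order.refl norm_ge_zero)
      finally show "norm (?P n - s * (cnj z ^ n * exp (g n) * L - z ^ n * exp (- g n) * cnj L))
        \<le> 2 * cmod s * cmod (B n - L)" by simp
    qed
    have "(\<lambda>n. 2 * cmod s * cmod (B n - L)) \<longlonglongrightarrow> 2 * cmod s * cmod (L - L)"
      by (intro tendsto_intros B)
    then show "(\<lambda>n. 2 * cmod s * cmod (B n - L)) \<longlonglongrightarrow> 0" by simp
  qed
  moreover have "w = L" if w: "is_jost_value c \<omega> \<gamma> b z w" for w
  proof -
    let ?R = "\<lambda>n. ?P n - s * (cnj z ^ n * exp (g n) * w - z ^ n * exp (- g n) * cnj w)"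
    have R: "?R \<longlonglongrightarrow> 0" using w unfolding iff .
    define e where "e n = exp (g (Suc n) - g n)" for n
    have e: "e \<longlonglongrightarrow> 1"
      using tendsto_exp[OF dg] unfolding e_def g_def z_def by simp
    have e': "(\<lambda>n. exp (- (g (Suc n) - g n))) \<longlonglongrightarrow> 1"
      using tendsto_exp[OF tendsto_minus[OF dg]] unfolding g_def z_def by simp
    have s1: "s * (cnj z - z) = 1" unfolding s_def z_def by (rule refl_coeff_eq[OF x2])
    \<comment> \<open>Form P_(n+1) - z P_n from the assumed asymptotics: the wave with
      \<open>w\<close> survives, and the conjugate one cancels up to the increment of the
      phase.\<close>
    have key: "B n - w = z ^ n * exp (- g n) * (?R (Suc n) - z * ?R n)
        + s * cnj z * w * (e n - 1) - s * z * cnj w * (z ^ n * z ^ n * (exp (- g n) * exp (- g n))) * (exp (- (g (Suc n) - g n)) - 1)" for n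
    proof -
      have A: "?A n = z ^ n * (?P (Suc n) - z * ?P n)" unfolding jost_amp_def z_def ..
      have zn: "z ^ n * cnj z ^ n = 1" using z1(2) by (simp flip: power_mult_distrib)
      have g1: "exp (g (Suc n)) = exp (g n) * e n" "exp (- g (Suc n)) = exp (- g n) * exp (- (g (Suc n) - g n))"
        unfolding e_def by (simp_all flip: exp_add)
      have R1: "?P (Suc n) = ?R (Suc n) + s * (cnj z * cnj z ^ n * (exp (g n) * e n) * w - z * z ^ n * (exp (- g n) * exp (- (g (Suc n) - g n))) * cnj w)"
        unfolding power_Suc g1 by simp
      have R2: "?P n = ?R n + s * (cnj z ^ n * exp (g n) * w - z ^ n * exp (- g n) * cnj w)" by simp
      define p1 p0 r1 r0 where "p1 = ?P (Suc n)" "p0 = ?P n" "r1 = ?R (Suc n)" "r0 = ?R n"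
      define X Y where "X = exp (g n)" "Y = exp (- g n)"
      define zz cz where "zz = z ^ n" "cz = cnj z ^ n"
      have "p1 = r1 + s * (cnj z * cz * (X * e n) * w - z * zz * (Y * exp (- (g (Suc n) - g n))) * cnj w)"
        "p0 = r0 + s * (cz * X * w - zz * Y * cnj w)" "zz * cz = 1" "Y * X = 1"
        using R1 R2 zn ee[of n] unfolding p1_p0_r1_r0_def X_Y_def zz_cz_def by blast+
      then have "zz * (p1 - z * p0) * Y - w = zz * Y * (r1 - z * r0)
        + s * cnj z * w * (e n - 1) - s * z * cnj w * (zz * zz * (Y * Y)) * (exp (- (g (Suc n) - g n)) - 1)"
        using s1 by algebra
      then show ?thesis unfolding B_def A p1_p0_r1_r0_def X_Y_def zz_cz_def by simp
    qed
    have "(\<lambda>n. B n - w) \<longlonglongrightarrow> 0"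
    proof (rule Lim_null_comparison)
      show "\<forall>\<^sub>F n in sequentially. norm (B n - w) \<le> cmod (?R (Suc n) - z * ?R n)
          + cmod (s * cnj z * w) * cmod (e n - 1) + cmod (s * z * cnj w) * cmod (exp (- (g (Suc n) - g n)) - 1)"
      proof (intro always_eventually allI)
        fix n
        have "cmod (X + Y - Z) \<le> cmod X + cmod Y + cmod Z" for X Y Z
          by (meson add_mono norm_triangle_ineq norm_triangle_ineq4 order.refl order.trans)
        then show "norm (B n - w) \<le> cmod (?R (Suc n) - z * ?R n)
          + cmod (s * cnj z * w) * cmod (e n - 1) + cmod (s * z * cnj w) * cmod (exp (- (g (Suc n) - g n)) - 1)"
          unfolding key
          by (rule order.trans)
             (simp only: norm_mult norm_power z1 ge power_one mult_1 mult_1_right order.refl)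
      qed
      have "(\<lambda>n. cmod (?R (Suc n) - z * ?R n)
          + cmod (s * cnj z * w) * cmod (e n - 1) + cmod (s * z * cnj w) * cmod (exp (- (g (Suc n) - g n)) - 1))
          \<longlonglongrightarrow> cmod (0 - z * 0) + cmod (s * cnj z * w) * cmod (1 - 1) + cmod (s * z * cnj w) * cmod (1 - 1 :: complex)"
        by (intro tendsto_add tendsto_mult tendsto_norm tendsto_diff tendsto_const e e' R LIMSEQ_Suc[OF R])
      then show "(\<lambda>n. cmod (?R (Suc n) - z * ?R n)
          + cmod (s * cnj z * w) * cmod (e n - 1) + cmod (s * z * cnj w) * cmod (exp (- (g (Suc n) - g n)) - 1)) \<longlonglongrightarrow> 0"
        by simp
    qed
    then have "B \<longlonglongrightarrow> w" by (simp add: LIM_zero_iff)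
    then show ?thesis using B LIMSEQ_unique by blast
  qed
  ultimately show ?thesis unfolding jost_def z_def[symmetric] by (rule the_equality)
qed

text \<open>\<open>wkb_limit\<close> yields a zero-free uniform limit of the amplitude with its
  phase removed, and \<open>jost_unit_circle\<close> identifies it with the Jost function. In
  modulus the phase disappears, and moduli are what the spectral weights contain.\<close>

theorem jost_local_asymptotics:
  assumes K: "compact K" "K \<subseteq> regular_set \<omega>"
  shows "\<forall>x\<in>K. jost c \<omega> \<gamma> b (circle_pt x) \<noteq> 0"
    and "uniform_limit K (\<lambda>n x. cmod (jost_amp b n x)) (\<lambda>x. cmod (jost c \<omega> \<gamma> b (circle_pt x))) sequentially"
    and "continuous_on K (\<lambda>x. cmod (jost c \<omega> \<gamma> b (circle_pt x)))"
proof -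
  obtain d where "wkb K refl_coeff (\<lambda>x. (circle_pt x)\<^sup>2) (\<lambda>x. mu2 c \<omega> (circle_pt x)) E pc \<gamma> d
    (\<lambda>n. q (Suc n)) (\<lambda>n. b (Suc n)) (jost_amp b)"
    using wkb_regular[OF K] by blast
  then interpret W: wkb K refl_coeff "\<lambda>x. (circle_pt x)\<^sup>2" "\<lambda>x. mu2 c \<omega> (circle_pt x)" E pc \<gamma> d
    "\<lambda>n. q (Suc n)" "\<lambda>n. b (Suc n)" "jost_amp b" .
  have ge: "mu2 c \<omega> (circle_pt x) * of_real (W.h n) = growth_exponent c \<omega> \<gamma> (circle_pt x) n" for x n
    unfolding growth_exponent_def W.h_def by simp
  obtain L where L: "uniform_limit K (\<lambda>n x. jost_amp b n x * exp (- growth_exponent c \<omega> \<gamma> (circle_pt x) n)) L sequentially"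
    "\<forall>x\<in>K. L x \<noteq> 0"
    using W.wkb_limit unfolding ge by blast
  \<comment> \<open>The increments of \<open>h\<close> differ from \<open>a\<^sup>2\<close> by a
    null sequence, hence tend to 0; this provides the hypothesis \<open>dg\<close> of
    \<open>jost_unit_circle\<close>.\<close>
  have hd: "(\<lambda>n. W.h (Suc n) - W.h n) \<longlonglongrightarrow> 0"
  proof -
    have m: "(\<lambda>m. real m powr (-2*\<gamma>)) \<longlonglongrightarrow> 0"
      using gamma by (intro tendsto_neg_powr filterlim_real_sequentially) auto
    have "(\<lambda>m. (W.a m)\<^sup>2 - (W.h (Suc m) - W.h m)) \<longlonglongrightarrow> 0"
    proof (rule Lim_null_comparison)
      show "\<forall>\<^sub>F m in sequentially. norm ((W.a m)\<^sup>2 - (W.h (Suc m) - W.h m)) \<le> real m powr (-2*\<gamma>) - real (Suc m) powr (-2*\<gamma>)"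
        unfolding real_norm_def by (intro eventually_sequentiallyI[of 1] W.h_increment)
      show "(\<lambda>m. real m powr (-2*\<gamma>) - real (Suc m) powr (-2*\<gamma>)) \<longlonglongrightarrow> 0"
        using tendsto_diff[OF m LIMSEQ_Suc[OF m]] by simp
    qed
    from tendsto_diff[OF W.a2_lim this] show ?thesis by simp
  qed
  have J: "jost c \<omega> \<gamma> b (circle_pt x) = L x" if x: "x \<in> K" for x
  proof (rule jost_unit_circle)
    show "x \<in> regular_set \<omega>" using K(2) x by blast
    show "(\<lambda>n. jost_amp b n x * exp (- growth_exponent c \<omega> \<gamma> (circle_pt x) n)) \<longlonglongrightarrow> L x"
      using tendsto_uniform_limitI[OF L(1) x] .
    have "(\<lambda>n. mu2 c \<omega> (circle_pt x) * of_real (W.h (Suc n) - W.h n)) \<longlonglongrightarrow> mu2 c \<omega> (circle_pt x) * of_real 0"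
      by (intro tendsto_intros hd)
    then show "(\<lambda>n. growth_exponent c \<omega> \<gamma> (circle_pt x) (Suc n) - growth_exponent c \<omega> \<gamma> (circle_pt x) n) \<longlonglongrightarrow> 0"
      unfolding ge[symmetric] by (simp add: right_diff_distrib)
  qed
  show "\<forall>x\<in>K. jost c \<omega> \<gamma> b (circle_pt x) \<noteq> 0" using J L(2) by simp
  have "uniform_limit K (\<lambda>n x. cmod (jost_amp b n x * exp (- growth_exponent c \<omega> \<gamma> (circle_pt x) n))) (\<lambda>x. cmod (L x)) sequentially"
    by (rule uniform_limit_norm[OF L(1)])
  moreover have "cmod (jost_amp b n x * exp (- growth_exponent c \<omega> \<gamma> (circle_pt x) n)) = cmod (jost_amp b n x)" if "x \<in> K" for n x
  proof -
    have x: "x \<in> regular_set \<omega>" using K(2) that by blast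
    have "cmod (exp (- growth_exponent c \<omega> \<gamma> (circle_pt x) n)) = 1"
      using growth_exponent_exp[OF x, of n] by (metis complex_mod_cnj)
    then show ?thesis by (simp only: norm_mult mult_1_right)
  qed
  ultimately show u: "uniform_limit K (\<lambda>n x. cmod (jost_amp b n x)) (\<lambda>x. cmod (jost c \<omega> \<gamma> b (circle_pt x))) sequentially"
    by (subst uniform_limit_cong'[where g = "\<lambda>n x. cmod (jost_amp b n x * exp (- growth_exponent c \<omega> \<gamma> (circle_pt x) n))"
          and i = "\<lambda>x. cmod (L x)"]) (auto simp: J)
  have cz: "continuous_on K circle_pt"
    by (rule continuous_on_subset[OF continuous_on_circle_pt]) (use K(2) in \<open>auto simp: regular_set_def\<close>)
  show "continuous_on K (\<lambda>x. cmod (jost c \<omega> \<gamma> b (circle_pt x)))"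
    by (rule uniform_limit_theorem[OF _ u])
       (auto simp: jost_amp_def intro!: always_eventually continuous_intros cz continuous_on_P_real)
qed

end

section \<open>The spectral density\<close>

text \<open>Imaginary part of a Cauchy kernel with its pole in the lower half plane, so
  \<open>half_plane_Im_integral\<close> applies.\<close>

lemma poisson_kernel_integral:
  assumes e: "e > 0"
  shows "has_bochner_integral lborel (\<lambda>x. e / ((x - y)\<^sup>2 + e\<^sup>2)) pi"
proof -
  let ?d = "Complex y (-e)" let ?R = "\<lambda>z. - 1 / (z - ?d)"
  have nz: "z - ?d \<noteq> 0" if "Im z \<ge> 0" for z
    using that e by (auto simp: complex_eq_iff)
  have Im: "Im (?R (of_real x)) = e / ((x - y)\<^sup>2 + e\<^sup>2)" for x
    using Im_cauchy_kernel[of x y "-e"] by simp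
  have "has_bochner_integral lborel (\<lambda>x. Im (?R (of_real x))) (pi * 1)"
  proof (rule half_plane_Im_integral(2))
    show "continuous_on {z. Im z \<ge> 0} ?R" using nz by (intro continuous_intros) auto
    show "?R field_differentiable at z" if "Im z > 0" for z
      using nz[of z] that by (intro derivative_intros) auto
    have "((\<lambda>z. - inverse (1 - ?d * inverse z)) \<longlongrightarrow> - inverse (1 - ?d * 0)) at_infinity"
      by (intro tendsto_intros tendsto_inverse_0) auto
    then show "((\<lambda>z. z * ?R z) \<longlongrightarrow> - of_real 1) at_infinity"
    proof (rule tendsto_eventually_eqI)
      show "\<forall>\<^sub>F z in at_infinity. - inverse (1 - ?d * inverse z) = z * ?R z"
        using eventually_not_equal_at_infinity[of 0]
      proof eventually_elim
        case (elim z)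
        have "1 - ?d * inverse z = (z - ?d) / z" using elim by (simp add: field_simps)
        then show ?case by (simp add: inverse_eq_divide)
      qed
    qed simp
    show "0 \<le> Im (?R (of_real x))" for x unfolding Im using e by simp
  qed
  then show ?thesis unfolding Im by simp
qed

section \<open>Local comparison of the spectral measure with the Jost density\<close>

context wigner_von_neumann
begin

definition jost_density :: "real \<Rightarrow> real" where
  "jost_density x = sqrt (4 - x\<^sup>2) / (2 * pi * (cmod (jost c \<omega> \<gamma> b (circle_pt x)))\<^sup>2)"

lemma jost_density_nonneg: "x \<in> {-2<..<2} \<Longrightarrow> jost_density x \<ge> 0"
  unfolding jost_density_def using square_less_4[of x] by simp

lemma Im_neg_circle_pt: "x \<in> {-2<..<2} \<Longrightarrow> Im (- circle_pt x) > 0"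
  unfolding circle_pt_def using square_less_4[of x] by simp

text \<open>The distance of the denominator from its limit at x0 splits into three parts, each below
  \<tau>/3: freezing \<open>w\<close> at x0, convergence of the amplitude, and continuity of the
  limit. For the first, \<open>P_real b n x\<close> is bounded uniformly for large n, being a
  combination of bounded amplitudes.\<close>

lemma bs_density_local:
  assumes x0: "x0 \<in> regular_set \<omega>" and eta: "\<eta> > 0"
  shows "\<exists>r>0. cball x0 r \<subseteq> regular_set \<omega> \<and>
    (\<exists>N. \<forall>n\<ge>N. \<forall>x\<in>cball x0 r. \<bar>bs_density b (- circle_pt x0) n x - jost_density x0\<bar> \<le> \<eta>)"
proof -
  obtain r0 where r0: "r0 > 0" "cball x0 r0 \<subseteq> regular_set \<omega>"
    using open_regular_set x0 open_contains_cball_eq by blast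
  let ?K = "cball x0 r0" and ?z0 = "circle_pt x0"
  define J where "J x = cmod (jost c \<omega> \<gamma> b (circle_pt x))" for x
  have cK: "compact ?K" by simp
  have x0K: "x0 \<in> ?K" using r0 by simp
  have K2: "x \<in> {-2<..<2}" if "x \<in> ?K" for x using regular_nonres(1) r0(2) that by blast
  note loc = jost_local_asymptotics[OF cK r0(2), folded J_def]
  have J0: "J x0 > 0" using loc(1) x0K by (simp add: J_def)
  define k where "k = Im (- ?z0) / pi"
  \<comment> \<open>The numerator of the density formula originates here:
    \<open>Im (- ?z0) = sqrt (4 - x0\<^sup>2) / 2\<close>.\<close>
  have phi0: "k / (J x0)\<^sup>2 = jost_density x0"
    unfolding k_def jost_density_def J_def circle_pt_def by (simp add: field_simps)
  have "isCont (\<lambda>t. k / t\<^sup>2) (J x0)" using J0 by (intro continuous_intros) auto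
  then obtain \<tau> where tau: "\<tau> > 0" "\<And>t. \<bar>t - J x0\<bar> < \<tau> \<Longrightarrow> \<bar>k / t\<^sup>2 - jost_density x0\<bar> < \<eta>"
    unfolding continuous_at_eps_delta phi0[symmetric] dist_real_def using eta by blast
  have cz: "continuous_on ?K circle_pt"
    by (rule continuous_on_subset[OF continuous_on_circle_pt]) (use K2 in blast)
  have cs: "continuous_on ?K refl_coeff"
    unfolding refl_coeff_def[abs_def] using one_minus_circle_pt_square(3) K2
    by (intro continuous_intros cz) auto
  obtain S where S: "S > 0" "\<And>x. x \<in> ?K \<Longrightarrow> cmod (refl_coeff x) \<le> S"
    using compact_imp_bounded[OF compact_continuous_image[OF cs cK]] unfolding bounded_pos by auto
  obtain JB where JB: "JB > 0" "\<And>x. x \<in> ?K \<Longrightarrow> \<bar>J x\<bar> \<le> JB"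
    using compact_imp_bounded[OF compact_continuous_image[OF loc(3) cK]] unfolding bounded_pos by auto
  define Bd where "Bd = S * (2 * (JB + 1))"
  have Bd: "Bd > 0" using S JB by (simp add: Bd_def)
  obtain r1 where r1: "r1 > 0" "\<And>x. x \<in> ?K \<Longrightarrow> \<bar>x - x0\<bar> < r1 \<Longrightarrow> cmod (circle_pt x - ?z0) < \<tau> / (3 * Bd)"
    using cz x0K Bd tau(1) unfolding continuous_on_iff dist_norm real_norm_def
    by (metis divide_pos_pos mult_pos_pos zero_less_numeral)
  obtain r2 where r2: "r2 > 0" "\<And>x. x \<in> ?K \<Longrightarrow> \<bar>x - x0\<bar> < r2 \<Longrightarrow> \<bar>J x - J x0\<bar> < \<tau> / 3"
    using loc(3) x0K tau(1) unfolding continuous_on_iff dist_norm real_norm_def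
    by (metis divide_pos_pos zero_less_numeral)
  have "\<forall>\<^sub>F n in sequentially. \<forall>x\<in>?K. dist (cmod (jost_amp b n x)) (J x) < min 1 (\<tau> / 3)"
    using tau(1) by (intro uniform_limitD[OF loc(2)]) simp
  then obtain N where N: "\<And>n x. n \<ge> N \<Longrightarrow> x \<in> ?K \<Longrightarrow> \<bar>cmod (jost_amp b n x) - J x\<bar> < min 1 (\<tau> / 3)"
    unfolding eventually_sequentially dist_real_def by blast
  \<comment> \<open>Halved because the ball is closed, while \<open>r1\<close> and \<open>r2\<close>
    are used with strict inequalities.\<close>
  define r where "r = min r0 (min r1 r2 / 2)"
  have r: "r > 0" "r \<le> r0" "r < r1" "r < r2" using r0 r1 r2 by (auto simp: r_def)
  have "\<bar>bs_density b (- ?z0) n x - jost_density x0\<bar> \<le> \<eta>" if n: "n \<ge> N" and x: "x \<in> cball x0 r" for n x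
  proof -
    have xK: "x \<in> ?K" using x r by auto
    have dx: "\<bar>x - x0\<bar> < r1" "\<bar>x - x0\<bar> < r2" using x r by (auto simp: dist_real_def)
    let ?P = "\<lambda>n. complex_of_real (P_real b n x)"
    let ?A = "jost_amp b n x"
    define D where "D = cmod (boundary_poly b (- ?z0) n (of_real x))"
    have An: "cmod ?A \<le> JB + 1" using N[OF n xK] JB(2)[OF xK] by linarith
    have "cmod (?P n) = cmod (refl_coeff x) * cmod (cnj (circle_pt x) ^ n * ?A - circle_pt x ^ n * cnj ?A)"
      unfolding P_real_eq_amp[OF K2[OF xK]] norm_mult ..
    also have "\<dots> \<le> S * (cmod ?A + cmod ?A)"
    proof (intro mult_mono S(2)[OF xK])
      show "cmod (cnj (circle_pt x) ^ n * ?A - circle_pt x ^ n * cnj ?A) \<le> cmod ?A + cmod ?A"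
        by (rule order.trans[OF norm_triangle_ineq4])
           (simp add: norm_mult norm_power circle_pt_norm[OF K2[OF xK]])
    qed (use S in auto)
    also have "\<dots> \<le> Bd" unfolding Bd_def using An S by (intro mult_left_mono) auto
    finally have Pn: "cmod (?P n) \<le> Bd" .
    have "boundary_poly b (- ?z0) n (of_real x) = (?P (Suc n) - circle_pt x * ?P n) + (circle_pt x - ?z0) * ?P n"
      unfolding boundary_poly_def P_poly_of_real by (simp add: algebra_simps)
    then have "\<bar>D - cmod ?A\<bar> \<le> cmod ((circle_pt x - ?z0) * ?P n)"
      unfolding D_def jost_amp_norm[OF K2[OF xK]] by (metis add_diff_cancel_left' norm_triangle_ineq3)
    also have "\<dots> \<le> cmod (circle_pt x - ?z0) * Bd"
      unfolding norm_mult by (intro mult_left_mono Pn) auto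
    also have "\<dots> < \<tau> / (3 * Bd) * Bd" using r1(2)[OF xK dx(1)] Bd by (intro mult_strict_right_mono)
    also have "\<dots> = \<tau> / 3" using Bd by simp
    finally have "\<bar>D - cmod ?A\<bar> < \<tau> / 3" .
    moreover have "\<bar>cmod ?A - J x\<bar> < \<tau> / 3" using N[OF n xK] by simp
    moreover have "\<bar>J x - J x0\<bar> < \<tau> / 3" using r2(2)[OF xK dx(2)] .
    ultimately have "\<bar>D - J x0\<bar> < \<tau>" by linarith
    from tau(2)[OF this] have "\<bar>k / D\<^sup>2 - jost_density x0\<bar> < \<eta>" .
    moreover have "bs_density b (- ?z0) n x = k / D\<^sup>2" unfolding bs_density_def k_def D_def by simp
    ultimately show ?thesis by simp
  qed
  moreover have "cball x0 r \<subseteq> regular_set \<omega>" using r(2) r0(2) by (meson subset_cball subset_trans)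
  ultimately show ?thesis using r(1) by blast
qed

text \<open>Weak convergence controls continuous test functions, so the local bound on densities is
  transferred to the limit in this form. The approximating \<open>w\<close> depends on x0, but
  uniqueness of the orthonormal measure makes the limit the given \<open>M\<close>.\<close>

lemma spectral_sandwich:
  assumes M: "orthonormal_measure b M" and x0: "x0 \<in> regular_set \<omega>" and eta: "\<eta> > 0"
  shows "\<exists>r>0. cball x0 r \<subseteq> regular_set \<omega> \<and>
    (\<forall>h B. (\<forall>x. isCont h x) \<longrightarrow> (\<forall>x. 0 \<le> h x \<and> h x \<le> B) \<longrightarrow> (\<forall>x. x \<notin> cball x0 r \<longrightarrow> h x = 0) \<longrightarrow>
      integrable lborel h \<and> \<bar>(\<integral>x. h x \<partial>M) - jost_density x0 * (\<integral>x. h x \<partial>lborel)\<bar> \<le> \<eta> * (\<integral>x. h x \<partial>lborel))"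
proof -
  have x2: "x0 \<in> {-2<..<2}" by (rule regular_nonres(1)[OF x0])
  let ?w = "- circle_pt x0"
  have w: "Im ?w > 0" by (rule Im_neg_circle_pt[OF x2])
  obtain r N where r: "r > 0" "cball x0 r \<subseteq> regular_set \<omega>"
    and N: "\<And>n x. n \<ge> N \<Longrightarrow> x \<in> cball x0 r \<Longrightarrow> \<bar>bs_density b ?w n x - jost_density x0\<bar> \<le> \<eta>"
    using bs_density_local[OF x0 eta] by blast
  obtain s M' where s: "strict_mono s" "weak_conv_m (\<lambda>n. bs_measure b ?w (s n)) M'" "\<And>n. s n \<ge> 1" "orthonormal_measure b M'"
    using orthonormal_measure_exists[OF w, of b] by blast
  have M': "M' = M" by (rule orthonormal_measure_unique[OF s(4) M])
  have rdM: "real_distribution M" using M by (simp add: orthonormal_measure_def)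
  have rd: "real_distribution (bs_measure b ?w (s n))" for n by (rule bs_measure_real_distribution[OF w s(3)])
  show ?thesis
  proof (rule exI[of _ r], intro conjI r allI impI)
    fix h :: "real \<Rightarrow> real" and B :: real
    assume h: "\<forall>x. isCont h x" "\<forall>x. 0 \<le> h x \<and> h x \<le> B" "\<forall>x. x \<notin> cball x0 r \<longrightarrow> h x = 0"
    have hc: "continuous_on A h" for A using h(1) by (simp add: continuous_at_imp_continuous_on)
    then have hm [measurable]: "h \<in> borel_measurable borel" by (rule borel_measurable_continuous_onI)
    have hb: "norm (h x) \<le> B" for x using h(2) by auto
    have "integrable lborel (\<lambda>x. indicator (cball x0 r) x *\<^sub>R h x)"
      by (rule borel_integrable_compact) (auto intro: hc)
    also have "(\<lambda>x. indicator (cball x0 r) x *\<^sub>R h x) = h" using h(3) by (auto simp: indicator_def fun_eq_iff)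
    finally show hi: "integrable lborel h" .
    have "(\<lambda>n. integral\<^sup>L (bs_measure b ?w (s n)) h) \<longlonglongrightarrow> integral\<^sup>L M h"
      by (rule weak_conv_imp_integral_bdd_continuous_conv[OF rd rdM s(2)[unfolded M'] _ hb]) (use h(1) in blast)
    then have lim: "(\<lambda>n. \<bar>integral\<^sup>L (bs_measure b ?w (s n)) h - jost_density x0 * (\<integral>x. h x \<partial>lborel)\<bar>)
        \<longlonglongrightarrow> \<bar>(\<integral>x. h x \<partial>M) - jost_density x0 * (\<integral>x. h x \<partial>lborel)\<bar>"
      by (intro tendsto_intros)
    show "\<bar>(\<integral>x. h x \<partial>M) - jost_density x0 * (\<integral>x. h x \<partial>lborel)\<bar> \<le> \<eta> * (\<integral>x. h x \<partial>lborel)"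
    proof (rule LIMSEQ_le_const2[OF lim], intro exI[of _ N] allI impI)
      fix n assume "n \<ge> N"
      then have sn: "s n \<ge> N" using seq_suble[OF s(1), of n] by simp
      interpret real_distribution "bs_measure b ?w (s n)" by (rule rd)
      have "integrable (bs_measure b ?w (s n)) h" 
        by (rule integrable_const_bound[of _ B]) (use hb in auto)
      then have di: "integrable lborel (\<lambda>x. bs_density b ?w (s n) x * h x)"
        using bs_measure_integral(2)[OF w hm] by simp
      have dif: "integral\<^sup>L (bs_measure b ?w (s n)) h - jost_density x0 * (\<integral>x. h x \<partial>lborel)
          = (\<integral>x. bs_density b ?w (s n) x * h x - jost_density x0 * h x \<partial>lborel)"
        using bs_measure_integral(1)[OF w hm] di hi by simp
      have "\<bar>integral\<^sup>L (bs_measure b ?w (s n)) h - jost_density x0 * (\<integral>x. h x \<partial>lborel)\<bar>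
          \<le> (\<integral>x. \<bar>bs_density b ?w (s n) x * h x - jost_density x0 * h x\<bar> \<partial>lborel)"
        unfolding dif by (rule integral_abs_bound)
      also have "\<dots> \<le> (\<integral>x. \<eta> * h x \<partial>lborel)"
      proof (rule integral_mono)
        show "\<bar>bs_density b ?w (s n) x * h x - jost_density x0 * h x\<bar> \<le> \<eta> * h x" for x
        proof (cases "x \<in> cball x0 r")
          case True
          have "\<bar>bs_density b ?w (s n) x * h x - jost_density x0 * h x\<bar> = \<bar>bs_density b ?w (s n) x - jost_density x0\<bar> * h x"
            unfolding left_diff_distrib[symmetric] abs_mult using h(2) by simp
          then show ?thesis using N[OF sn True] h(2) by (simp add: mult_right_mono)
        next
          case False
          then show ?thesis using h(3) by simp
        qed
      qed (use di hi in auto)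
      finally show "\<bar>integral\<^sup>L (bs_measure b ?w (s n)) h - jost_density x0 * (\<integral>x. h x \<partial>lborel)\<bar> \<le> \<eta> * (\<integral>x. h x \<partial>lborel)"
        by simp
    qed
  qed
qed

text \<open>The indicator of an open set is the increasing limit of the continuous
  \<open>h k\<close>; the sandwich with tolerance 1 already bounds their integrals by a multiple of
  the Lebesgue integrals.\<close>

lemma spectral_measure_open_le:
  assumes M: "orthonormal_measure b M" and x0: "x0 \<in> regular_set \<omega>"
  shows "\<exists>r>0. \<exists>C\<ge>0. \<forall>U. open U \<longrightarrow> U \<subseteq> cball x0 r \<longrightarrow> measure M U \<le> C * measure lborel U"
proof -
  obtain r where r: "r > 0" and H: "\<And>h B. (\<forall>x. isCont h x) \<Longrightarrow> (\<forall>x. 0 \<le> h x \<and> h x \<le> B) \<Longrightarrow> (\<forall>x. x \<notin> cball x0 r \<longrightarrow> h x = 0) \<Longrightarrow>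
      integrable lborel h \<and> \<bar>(\<integral>x. h x \<partial>M) - jost_density x0 * (\<integral>x. h x \<partial>lborel)\<bar> \<le> 1 * (\<integral>x. h x \<partial>lborel)"
    using spectral_sandwich[OF M x0 zero_less_one] by blast
  interpret real_distribution M using M by (simp add: orthonormal_measure_def)
  define C where "C = jost_density x0 + 1"
  have C: "C \<ge> 0" using jost_density_nonneg[OF regular_nonres(1)[OF x0]] by (simp add: C_def)
  have "measure M U \<le> C * measure lborel U" if U: "open U" "U \<subseteq> cball x0 r" for U
  proof -
    define h where "h k x = min 1 (real k * infdist x (- U))" for k x
    \<comment> \<open>\<open>infdist\<close> to the empty set is 0, so \<open>h\<close> would
      degenerate for the whole line; boundedness of \<open>U\<close> excludes this case.\<close>
    have "U \<noteq> UNIV"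
    proof
      assume "U = UNIV"
      then have "bounded (UNIV :: real set)" using U(2) bounded_subset[OF bounded_cball] by blast
      then show False using not_bounded_UNIV by blast
    qed
    then have cl: "closed (- U)" "- U \<noteq> {}" using U(1) by (auto simp: closed_def)
    have hU: "h k x = 0" if "x \<notin> U" for k x using that by (simp add: h_def)
    have h01: "0 \<le> h k x" "h k x \<le> 1" for k x by (auto simp: h_def infdist_nonneg)
    have hcont: "isCont (h k) x" for k x
      unfolding h_def by (intro continuous_intros)
    have hle: "h k x \<le> indicator U x" for k x using hU h01 by (auto simp: indicator_def)
    have lim: "(\<lambda>k. h k x) \<longlonglongrightarrow> indicator U x" for x
    proof (cases "x \<in> U")
      case True
      then have d: "infdist x (- U) > 0"
        using in_closed_iff_infdist_zero[OF cl, of x] infdist_nonneg[of x "- U"] by auto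
      obtain N where "1 / infdist x (- U) \<le> real N" using real_arch_simple by blast
      then have "1 \<le> real k * infdist x (- U)" if "k \<ge> N" for k
        using d that by (meson divide_le_eq of_nat_mono order.trans)
      then have "\<forall>\<^sub>F k in sequentially. h k x = indicator U x"
        using True by (intro eventually_sequentiallyI[of N]) (auto simp: h_def min_def)
      then show ?thesis by (rule tendsto_eventually)
    qed (simp add: hU)
    have Um [measurable]: "U \<in> sets borel" using U(1) by (rule borel_open)
    have hm [measurable]: "h k \<in> borel_measurable borel" for k
      by (intro borel_measurable_continuous_onI continuous_at_imp_continuous_on ballI hcont)
    have fin: "emeasure lborel U < \<infinity>"
      using emeasure_bounded_finite[OF bounded_subset[OF bounded_cball U(2)]] .
    then have iU: "integrable lborel (indicator U :: real \<Rightarrow> real)" by simp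
    have "(\<lambda>k. \<integral>x. h k x \<partial>M) \<longlonglongrightarrow> (\<integral>x. indicator U x \<partial>M)"
      by (rule integral_dominated_convergence[where w = "\<lambda>_. 1"]) (use lim h01 in auto)
    then have "(\<lambda>k. \<integral>x. h k x \<partial>M) \<longlonglongrightarrow> measure M U" by simp
    moreover have "(\<integral>x. h k x \<partial>M) \<le> C * measure lborel U" for k
    proof -
      have Hk: "integrable lborel (h k)" "\<bar>(\<integral>x. h k x \<partial>M) - jost_density x0 * (\<integral>x. h k x \<partial>lborel)\<bar> \<le> 1 * (\<integral>x. h k x \<partial>lborel)"
        using H[of "h k" 1] hcont h01 hU U(2) by blast+
      then have "(\<integral>x. h k x \<partial>M) \<le> C * (\<integral>x. h k x \<partial>lborel)" unfolding C_def by (simp add: algebra_simps)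
      also have "\<dots> \<le> C * (\<integral>x. indicator U x \<partial>lborel)"
        using C Hk(1) iU hle by (intro mult_left_mono integral_mono) auto
      finally show ?thesis by simp
    qed
    ultimately show ?thesis by (intro LIMSEQ_le_const2) auto
  qed
  then show ?thesis using r C by blast
qed

text \<open>Outer regularity encloses \<open>A\<close> in open sets of small Lebesgue excess, and
  locally these have small \<open>M\<close> measure; the Lindelof property reduces the local
  statements to countably many.\<close>

lemma null_sets_regular:
  assumes M: "orthonormal_measure b M" and A: "A \<in> null_sets lborel" "A \<subseteq> regular_set \<omega>"
  shows "A \<in> null_sets M"
proof -
  interpret real_distribution M using M by (simp add: orthonormal_measure_def)
  have "\<exists>r>0. A \<inter> ball x r \<in> null_sets M" if x: "x \<in> regular_set \<omega>" for x
  proof -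
    obtain r C where r: "r > 0" "C \<ge> 0" and le: "\<And>U. open U \<Longrightarrow> U \<subseteq> cball x r \<Longrightarrow> measure M U \<le> C * measure lborel U"
      using spectral_measure_open_le[OF M x] by blast
    have Ab: "A \<in> sets borel" using A(1) by auto
    have "measure M (A \<inter> ball x r) \<le> 0 + e" if e: "e > 0" for e
    proof -
      \<comment> \<open>\<open>C + 1\<close> because \<open>C\<close> may be 0.\<close>
      have e': "e / (C + 1) > 0" using e r by simp
      obtain U where U: "open U" "A \<subseteq> U" "emeasure lborel (U - A) < ennreal (e / (C + 1))"
        using outer_regular_lborel[OF Ab e'] by blast
      have Um: "U \<in> sets borel" using U(1) by (rule borel_open)
      have "emeasure lborel (U \<inter> ball x r) \<le> emeasure lborel ((U - A) \<union> A)"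
        using Um Ab by (intro emeasure_mono) auto
      also have "\<dots> \<le> emeasure lborel (U - A) + emeasure lborel A"
        using Um Ab by (intro emeasure_subadditive) auto
      also have "\<dots> < ennreal (e / (C + 1))" using U(3) A(1) by (simp add: null_setsD1)
      finally have "emeasure lborel (U \<inter> ball x r) < ennreal (e / (C + 1))" .
      then have m: "measure lborel (U \<inter> ball x r) \<le> e / (C + 1)"
        unfolding measure_def using e' by (intro enn2real_leI) auto
      have "measure M (A \<inter> ball x r) \<le> measure M (U \<inter> ball x r)"
        using U(2) Um by (intro finite_measure_mono) auto
      also have "\<dots> \<le> C * measure lborel (U \<inter> ball x r)"
        using U(1) by (intro le) auto
      also have "\<dots> \<le> C * (e / (C + 1))" by (intro mult_left_mono m r)
      also have "\<dots> \<le> e" using e r by (simp add: field_simps)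
      finally show ?thesis by simp
    qed
    then have "measure M (A \<inter> ball x r) \<le> 0" by (rule field_le_epsilon)
    then have "measure M (A \<inter> ball x r) = 0" using measure_nonneg[of M "A \<inter> ball x r"] by linarith
    then have "A \<inter> ball x r \<in> null_sets M"
      using Ab by (simp add: null_sets_def emeasure_eq_measure)
    then show ?thesis using r(1) by blast
  qed
  then obtain r where r: "\<And>x. x \<in> regular_set \<omega> \<Longrightarrow> r x > 0 \<and> A \<inter> ball x (r x) \<in> null_sets M" by metis
  obtain F where F: "F \<subseteq> (\<lambda>x. ball x (r x)) ` regular_set \<omega>" "countable F" "\<Union>F = \<Union>((\<lambda>x. ball x (r x)) ` regular_set \<omega>)"
    by (rule Lindelof[of "(\<lambda>x. ball x (r x)) ` regular_set \<omega>"]) auto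
  have "A \<subseteq> \<Union>F" unfolding F(3) using A(2) r by fastforce
  then have "A = (\<Union>B\<in>F. A \<inter> B)" by auto
  moreover have "(\<Union>B\<in>F. A \<inter> B) \<in> null_sets M"
    by (rule null_sets_UN'[OF F(2)]) (use F(1) r in auto)
  ultimately show ?thesis by simp
qed

text \<open>\<open>Im m\<close> is the Poisson integral of \<open>M\<close>. The cutoff
  \<open>ct\<close> turns the kernel into an admissible test function for
  \<open>spectral_sandwich\<close>; the part cut off is of order \<open>\<epsilon>\<close> for both
  \<open>M\<close> and Lebesgue measure. The total mass of the kernel is the factor pi in the
  limit.\<close>

lemma Im_weyl_m_tendsto:
  assumes M: "orthonormal_measure b M" and x0: "x0 \<in> regular_set \<omega>"
  shows "((\<lambda>\<epsilon>. Im (weyl_m b (Complex x0 \<epsilon>))) \<longlongrightarrow> pi * jost_density x0) (at_right 0)"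
proof (rule tendstoI)
  fix e :: real assume e: "e > 0"
  interpret O: orthonormal b M by standard (rule M)
  have jd: "jost_density x0 \<ge> 0" by (rule jost_density_nonneg[OF regular_nonres(1)[OF x0]])
  \<comment> \<open>The kernel has mass pi, so the sandwich costs at most e/2; the tails receive the
    other half.\<close>
  define \<eta> where "\<eta> = e / (2 * pi)"
  have eta: "\<eta> > 0" using e by (simp add: \<eta>_def)
  obtain r where r: "r > 0" and H: "\<And>h B. (\<forall>x. isCont h x) \<Longrightarrow> (\<forall>x. 0 \<le> h x \<and> h x \<le> B) \<Longrightarrow> (\<forall>x. x \<notin> cball x0 r \<longrightarrow> h x = 0) \<Longrightarrow>
      integrable lborel h \<and> \<bar>(\<integral>x. h x \<partial>M) - jost_density x0 * (\<integral>x. h x \<partial>lborel)\<bar> \<le> \<eta> * (\<integral>x. h x \<partial>lborel)"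
    using spectral_sandwich[OF M x0 eta] by blast
  define ct where "ct x = max 0 (min 1 (2 - 2 * \<bar>x - x0\<bar> / r))" for x
  have ct01: "0 \<le> ct x" "ct x \<le> 1" for x by (auto simp: ct_def)
  have ct_outside: "ct x = 0" if "x \<notin> cball x0 r" for x
  proof -
    have "r < \<bar>x - x0\<bar>" using that by (simp add: dist_real_def abs_minus_commute)
    then have "2 < 2 * \<bar>x - x0\<bar> / r" using r by (simp add: field_simps)
    then show ?thesis by (simp add: ct_def)
  qed
  have ct_inside: "ct x = 1" if "\<bar>x - x0\<bar> \<le> r / 2" for x
    using that r by (auto simp: ct_def field_simps max_def min_def)
  have ct_cont: "isCont ct x" for x unfolding ct_def by (intro continuous_intros) (use r in auto)
  have ct_meas [measurable]: "ct \<in> borel_measurable borel"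
    by (intro borel_measurable_continuous_onI continuous_at_imp_continuous_on ballI ct_cont)
  \<comment> \<open>As t^2 / (1 + t^2) increases with |t|, this is the constant with (x - x0)^2
    \<ge> m (1 + (x - x0)^2) outside the inner ball. It compares the tail with a Poisson kernel of
    width 1.\<close>
  define m where "m = (r/2)\<^sup>2 / (1 + (r/2)\<^sup>2)"
  have m: "m > 0" using r by (simp add: m_def add_pos_nonneg)
  \<comment> \<open>Below \<open>B\<close> the tail errors \<open>\<epsilon> / m\<close> and
    \<open>jost_density x0 * (\<epsilon> / m * pi)\<close> add up to less than e/2.\<close>
  define B where "B = min 1 (e * m / (2 * (jost_density x0 * pi + 1)))"
  have jp: "jost_density x0 * pi + 1 > 0" using jd by (simp add: add_nonneg_pos)
  have B: "B > 0" using e m jp by (simp add: B_def)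
  have main: "dist (Im (weyl_m b (Complex x0 \<epsilon>))) (pi * jost_density x0) < e" if eps: "0 < \<epsilon>" "\<epsilon> < B" for \<epsilon>
  proof -
    define k where "k x = \<epsilon> / ((x - x0)\<^sup>2 + \<epsilon>\<^sup>2)" for x
    have den: "(x - x0)\<^sup>2 + \<epsilon>\<^sup>2 > 0" for x using eps by (simp add: add_nonneg_pos)
    have k0: "k x \<ge> 0" for x using eps by (simp add: k_def)
    have kb: "k x \<le> 1 / \<epsilon>" for x
    proof -
      have "\<epsilon> / ((x - x0)\<^sup>2 + \<epsilon>\<^sup>2) \<le> \<epsilon> / \<epsilon>\<^sup>2"
        using eps den[of x] by (intro divide_left_mono) auto
      then show ?thesis using eps by (simp add: k_def power2_eq_square)
    qed
    have kc: "isCont k x" for x unfolding k_def using den[of x] by (intro continuous_intros) auto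
    have km [measurable]: "k \<in> borel_measurable borel"
      by (intro borel_measurable_continuous_onI continuous_at_imp_continuous_on ballI kc)
    have kint: "has_bochner_integral lborel k pi"
      using poisson_kernel_integral[OF eps(1), of x0] by (simp add: k_def[abs_def])
    have kM: "integrable M k"
      by (rule O.integrable_const_bound[of _ "1/\<epsilon>"]) (use k0 kb in auto)
    have ck: "0 \<le> ct x * k x" "ct x * k x \<le> k x" for x
      using ct01 k0 by (auto intro: mult_left_le_one_le)
    have hM: "integrable M (\<lambda>x. ct x * k x)"
    proof (rule Bochner_Integration.integrable_bound[OF kM])
      show "AE x in M. norm (ct x * k x) \<le> norm (k x)"
        using ck k0 by (intro AE_I2) (simp only: real_norm_def abs_of_nonneg)
    qed measurable
    have Imw: "Im (weyl_m b (Complex x0 \<epsilon>)) = (\<integral>x. k x \<partial>M)"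
    proof -
      have "Im (\<integral>x. 1 / (complex_of_real x - Complex x0 \<epsilon>) \<partial>M) = (\<integral>x. Im (1 / (complex_of_real x - Complex x0 \<epsilon>)) \<partial>M)"
        by (rule integral_bounded_linear[OF bounded_linear_Im finite_borel_measure.integrable_cauchy_kernel[OF O.fbm], symmetric]) (use eps in simp)
      then show ?thesis using O.weyl_m_eq[of "Complex x0 \<epsilon>"] eps unfolding Im_cauchy_kernel k_def by simp
    qed
    let ?h = "\<lambda>x. ct x * k x"
    have Hh: "integrable lborel ?h" "\<bar>(\<integral>x. ?h x \<partial>M) - jost_density x0 * (\<integral>x. ?h x \<partial>lborel)\<bar> \<le> \<eta> * (\<integral>x. ?h x \<partial>lborel)"
    proof -
      have "\<forall>x. isCont ?h x" by (intro allI continuous_mult ct_cont[unfolded eta_contract_eq] kc[unfolded eta_contract_eq])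
      moreover have "\<forall>x. 0 \<le> ?h x \<and> ?h x \<le> 1 / \<epsilon>"
        using ck kb order.trans by blast
      moreover have "\<forall>x. x \<notin> cball x0 r \<longrightarrow> ?h x = 0" using ct_outside by auto
      ultimately show "integrable lborel ?h" "\<bar>(\<integral>x. ?h x \<partial>M) - jost_density x0 * (\<integral>x. ?h x \<partial>lborel)\<bar> \<le> \<eta> * (\<integral>x. ?h x \<partial>lborel)"
        using H[of ?h "1 / \<epsilon>"] by blast+
    qed
    have tail: "k x - ?h x \<le> \<epsilon> / m * (1 / ((x - x0)\<^sup>2 + 1\<^sup>2))" for x
    proof (cases "\<bar>x - x0\<bar> \<le> r / 2")
      case True
      then show ?thesis using ct_inside[OF True] eps m by (simp add: add_nonneg_pos)
    next
      case False
      then have "(r/2)\<^sup>2 \<le> (x - x0)\<^sup>2" using r by (simp only: abs_le_square_iff[symmetric])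
      then have "m * ((x - x0)\<^sup>2 + 1) \<le> (x - x0)\<^sup>2"
        unfolding m_def by (simp add: field_simps add_pos_nonneg)
      also have "\<dots> \<le> (x - x0)\<^sup>2 + \<epsilon>\<^sup>2" by simp
      finally have "\<epsilon> / ((x - x0)\<^sup>2 + \<epsilon>\<^sup>2) \<le> \<epsilon> / (m * ((x - x0)\<^sup>2 + 1))"
        using eps m den[of x] by (intro divide_left_mono) (auto intro!: mult_pos_pos add_nonneg_pos)
      moreover have "k x - ?h x \<le> k x" using ck(1)[of x] by simp
      ultimately show ?thesis by (simp add: k_def)
    qed
    have p1: "has_bochner_integral lborel (\<lambda>x. 1 / ((x - x0)\<^sup>2 + 1\<^sup>2)) pi"
      using poisson_kernel_integral[of 1 x0] by simp
    have tailM: "(\<integral>x. k x - ?h x \<partial>M) \<le> \<epsilon> / m"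
    proof -
      have "1 / ((x - x0)\<^sup>2 + 1\<^sup>2) \<le> 1" for x by (simp add: add_nonneg_pos)
      then have "k x - ?h x \<le> \<epsilon> / m" for x
        using tail[of x] mult_left_mono[of "1 / ((x - x0)\<^sup>2 + 1\<^sup>2)" 1 "\<epsilon> / m"] eps m by force
      then have "(\<integral>x. k x - ?h x \<partial>M) \<le> (\<integral>x. \<epsilon> / m \<partial>M)"
        using kM hM by (intro integral_mono) auto
      then show ?thesis using O.prob_space by simp
    qed
    have tailM0: "(\<integral>x. k x - ?h x \<partial>M) \<ge> 0"
      using ck by (intro integral_nonneg_AE AE_I2) simp
    have tailL: "(\<integral>x. k x - ?h x \<partial>lborel) \<le> \<epsilon> / m * pi"
    proof -
      have "(\<integral>x. k x - ?h x \<partial>lborel) \<le> (\<integral>x. \<epsilon> / m * (1 / ((x - x0)\<^sup>2 + 1\<^sup>2)) \<partial>lborel)"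
        using kint Hh(1) p1 tail
        by (intro integral_mono Bochner_Integration.integrable_diff integrable_mult_right) (auto simp: has_bochner_integral_iff)
      also have "\<dots> = \<epsilon> / m * pi"
        using p1 unfolding integral_mult_right_zero by (simp only: has_bochner_integral_iff)
      finally show ?thesis .
    qed
    have tailL0: "(\<integral>x. k x - ?h x \<partial>lborel) \<ge> 0"
      using ck by (intro integral_nonneg_AE AE_I2) simp
    define Hl Hm where "Hl = (\<integral>x. ?h x \<partial>lborel)" "Hm = (\<integral>x. ?h x \<partial>M)"
    note Hdefs = this
    have L: "pi - \<epsilon> / m * pi \<le> Hl" "Hl \<le> pi"
      using tailL tailL0 kint Hh(1) unfolding Hdefs by (auto simp: has_bochner_integral_iff)
    have Mm: "(\<integral>x. k x \<partial>M) - Hm \<le> \<epsilon> / m" "0 \<le> (\<integral>x. k x \<partial>M) - Hm"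
      using tailM tailM0 kM hM unfolding Hdefs by auto
    have 1: "\<bar>Hm - jost_density x0 * Hl\<bar> \<le> \<eta> * pi"
      using Hh(2)[folded Hdefs] mult_left_mono[OF L(2), of \<eta>] eta by linarith
    have 2: "\<bar>jost_density x0 * Hl - pi * jost_density x0\<bar> \<le> jost_density x0 * (\<epsilon> / m * pi)"
    proof -
      have "\<bar>jost_density x0 * Hl - pi * jost_density x0\<bar> = jost_density x0 * \<bar>Hl - pi\<bar>"
        unfolding mult.commute[of pi] right_diff_distrib[symmetric] abs_mult using jd by simp
      also have "\<dots> \<le> jost_density x0 * (\<epsilon> / m * pi)" using L jd by (intro mult_left_mono) auto
      finally show ?thesis .
    qed
    have "\<bar>(\<integral>x. k x \<partial>M) - pi * jost_density x0\<bar> \<le> \<epsilon> / m + \<eta> * pi + jost_density x0 * (\<epsilon> / m * pi)"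
      using 1 2 Mm by linarith
    also have "\<dots> = e / 2 + \<epsilon> * (jost_density x0 * pi + 1) / m"
      using m by (simp add: \<eta>_def field_simps)
    also have "\<epsilon> * (jost_density x0 * pi + 1) / m < e / 2"
    proof -
      have "\<epsilon> < e * m / (2 * (jost_density x0 * pi + 1))" using eps(2) by (simp add: B_def)
      then have "\<epsilon> * (2 * (jost_density x0 * pi + 1)) < e * m" using jp by (simp add: pos_less_divide_eq)
      then show ?thesis using m by (simp add: field_simps)
    qed
    finally show ?thesis unfolding Imw dist_real_def by simp
  qed
  have "\<forall>\<^sub>F \<epsilon> in at_right 0. \<epsilon> \<in> {0<..<B}" by (rule eventually_at_rightI[OF _ B]) 
  then show "\<forall>\<^sub>F \<epsilon> in at_right 0. dist (Im (weyl_m b (Complex x0 \<epsilon>))) (pi * jost_density x0) < e"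
    by eventually_elim (use main in auto)
qed

lemma spectral_density_eq:
  assumes "x \<in> regular_set \<omega>"
  shows "spectral_density b x = jost_density x"
proof -
  \<comment> \<open>Any boundary parameter in the upper half plane produces the measure;
    \<open>\<i>\<close> is one choice.\<close>
  obtain M where M: "orthonormal_measure b M"
    using orthonormal_measure_exists[of \<i> b] by auto
  have "Lim (at_right 0) (\<lambda>\<epsilon>. Im (weyl_m b (Complex x \<epsilon>))) = pi * jost_density x"
    by (rule tendsto_Lim[OF _ Im_weyl_m_tendsto[OF M assms]]) simp
  then show ?thesis unfolding spectral_density_def by simp
qed

lemma purely_ac_regular: "purely_ac_spectrum_on b (regular_set \<omega>)"
  unfolding purely_ac_spectrum_on_def
proof
  fix u :: "nat \<Rightarrow> complex" assume u: "u \<in> l2"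
  obtain M where M: "orthonormal_measure b M"
    using orthonormal_measure_exists[of \<i> b] by auto
  interpret O: orthonormal b M by standard (rule M)
  note ac = O.spectral_measure_absolutely_continuous[OF u]
  have S: "regular_set \<omega> \<in> sets borel" by (rule borel_open[OF open_regular_set])
  have sp: "space (spectral_measure b u) = UNIV" using sets_eq_imp_space_eq[OF ac(1)] by simp
  show "absolutely_continuous (restrict_space lborel (regular_set \<omega>)) (restrict_space (spectral_measure b u) (regular_set \<omega>))"
    unfolding absolutely_continuous_def
  proof
    fix A assume "A \<in> null_sets (restrict_space lborel (regular_set \<omega>))"
    then have A: "A \<subseteq> regular_set \<omega>" "A \<in> null_sets lborel"
      using S by (auto simp: null_sets_restrict_space)
    from null_sets_regular[OF M A(2,1)] have "A \<in> null_sets (spectral_measure b u)"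
      using ac(2) by (auto simp: absolutely_continuous_def)
    then show "A \<in> null_sets (restrict_space (spectral_measure b u) (regular_set \<omega>))"
      using A(1) S ac(1) sp by (simp add: null_sets_restrict_space)
  qed
qed

end

theorem theorem2:
  fixes c \<omega> \<delta> \<gamma> :: real and q b :: "nat \<Rightarrow> real"
  assumes "1/3 < \<gamma>" and "\<gamma> < 1/2"
    and "\<forall>k::int. 2 * \<omega> \<noteq> pi * of_int k"
    and "summable (\<lambda>n. \<bar>q n\<bar>)"
    and "\<forall>n\<ge>1. b n = c * sin (2 * \<omega> * real n + \<delta>) / real n powr \<gamma> + q n"
  defines "S \<equiv> {-2<..<2} - {2 * cos \<omega>, - 2 * cos \<omega>, 2 * cos (2*\<omega>), - 2 * cos (2*\<omega>)}"
    and "F \<equiv> jost c \<omega> \<gamma> b"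
  shows "purely_ac_spectrum_on b S
    \<and> (AE x in lborel. x \<in> {-2<..<2} \<longrightarrow>
          spectral_density b x =
            sqrt (4 - x\<^sup>2) / (2 * pi * (cmod (F (Complex (x/2) (- sqrt (4 - x\<^sup>2) / 2))))\<^sup>2))
    \<and> (\<forall>x\<in>S. 2 * pi * (cmod (F (Complex (x/2) (- sqrt (4 - x\<^sup>2) / 2))))\<^sup>2 \<noteq> 0)"
proof -
  interpret wigner_von_neumann c \<omega> \<delta> \<gamma> q b
    using assms(1-5) by unfold_locales
  have S: "S = regular_set \<omega>" unfolding S_def regular_set_def ..
  show ?thesis
  proof (intro conjI)
    show "purely_ac_spectrum_on b S" unfolding S by (rule purely_ac_regular)
    \<comment> \<open>The excluded points form a null set, so the identity on \<open>S\<close> holds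
      almost everywhere on the interval.\<close>
    have "finite {2 * cos \<omega>, - 2 * cos \<omega>, 2 * cos (2*\<omega>), - 2 * cos (2*\<omega>)}" by simp
    then have "AE x in lborel. x \<notin> {2 * cos \<omega>, - 2 * cos \<omega>, 2 * cos (2*\<omega>), - 2 * cos (2*\<omega>)}"
      by (intro AE_not_in finite_imp_null_set_lborel)
    then show "AE x in lborel. x \<in> {-2<..<2} \<longrightarrow> spectral_density b x =
        sqrt (4 - x\<^sup>2) / (2 * pi * (cmod (F (Complex (x/2) (- sqrt (4 - x\<^sup>2) / 2))))\<^sup>2)"
    proof eventually_elim
      case (elim x)
      show ?case
      proof
        assume "x \<in> {-2<..<2}"
        then have "x \<in> regular_set \<omega>" using elim unfolding regular_set_def by blast
        from spectral_density_eq[OF this] show "spectral_density b x =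
            sqrt (4 - x\<^sup>2) / (2 * pi * (cmod (F (Complex (x/2) (- sqrt (4 - x\<^sup>2) / 2))))\<^sup>2)"
          unfolding jost_density_def circle_pt_def F_def .
      qed
    qed
    show "\<forall>x\<in>S. 2 * pi * (cmod (F (Complex (x/2) (- sqrt (4 - x\<^sup>2) / 2))))\<^sup>2 \<noteq> 0"
    proof
      fix x assume "x \<in> S"
      then have "jost c \<omega> \<gamma> b (circle_pt x) \<noteq> 0"
        \<comment> \<open>A single point is a compact set, so the local theorem gives nonvanishing
          at x.\<close>
        using jost_local_asymptotics(1)[of "{x}"] unfolding S by auto
      then show "2 * pi * (cmod (F (Complex (x/2) (- sqrt (4 - x\<^sup>2) / 2))))\<^sup>2 \<noteq> 0"
        unfolding F_def circle_pt_def by simp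
    qed
  qed
qed

end
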